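(* Let $M$ be a $2$-dimensional, simply-connected surface, and let $g$ be a metric on $M$ in $H^1_{\rm loc}$. Let $\{f^\epsilon\}$ be a family of $H^2_{\rm loc}$ isometric immersions of $(M,g)$ into $\mathbb{R}^3$ such that the corresponding second fundamental forms $\{B^\epsilon\}$ are uniformly bounded in $L^2$. Then, after passing to subsequences, $\{f^\epsilon\}$ converges weakly in $H^2_{\rm loc}$ to some $\bar f$ which is still an isometric immersion $\bar f:(M,g)\hookrightarrow\mathbb{R}^3$. Moreover, the corresponding second fundamental form $\overline B$ is a weak limit of $\{B^\epsilon\}$ in $L^2_{\rm loc}$.
   Context: $H^k=W^{k,2}$. An isometric immersion $f:(M,g)\to\mathbb{R}^3$ satisfies $df(X)\cdot df(Y)=g(X,Y)$ for all tangent fields $X,Y$ and has injective differential. The second fundamental form is $B(X,Y)=\overline\nabla_XY-\nabla_XY$, where $\overline\nabla$ is the flat Euclidean connection and $\nabla$ the Levi-Civita connection of $g$ (tangent bundle identified with its image under $df$).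
   Formalization: The f^ε converge after subtracting constant vectors (f + n e_1 refutes the literal claim); these vanish if {f^ε} is bounded in L²_loc. The L² bound on B^ε is read in coordinates, on compact subsets of charts. *)

theory Defs
  imports "HOL-Analysis.Analysis"
begin

text \<open>\<open>C_on k S f\<close> means that \<open>f\<close> is of class $C^k$ on the open set \<open>S\<close>: it is differentiable and
  its partial derivatives are of class $C^{k-1}$.\<close>

fun C_on :: "nat \<Rightarrow> (real^2) set \<Rightarrow> (real^2 \<Rightarrow> 'b::real_normed_vector) \<Rightarrow> bool" where
  "C_on 0 S f \<longleftrightarrow> continuous_on S f"
| "C_on (Suc k) S f \<longleftrightarrow> (\<forall>x\<in>S. f differentiable (at x)) \<and>
     (\<forall>i. C_on k S (\<lambda>x. frechet_derivative f (at x) (axis i 1)))"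

definition smooth_on :: "(real^2) set \<Rightarrow> (real^2 \<Rightarrow> 'b::real_normed_vector) \<Rightarrow> bool" where
  "smooth_on S f \<longleftrightarrow> (\<forall>k. C_on k S f)"

text \<open>A chart is a pair of its domain and its coordinate map; outside of the domain the values of
  the coordinate map are irrelevant.\<close>

type_synonym 'a chart = "'a set \<times> ('a \<Rightarrow> real^2)"

definition coord_dom :: "'a chart \<Rightarrow> (real^2) set" where
  "coord_dom c = snd c ` fst c"

definition chart_inv :: "'a chart \<Rightarrow> real^2 \<Rightarrow> 'a" where
  "chart_inv c = inv_into (fst c) (snd c)"

definition is_chart :: "'a::topological_space set \<Rightarrow> 'a chart \<Rightarrow> bool" where
  "is_chart M c \<longleftrightarrow> openin (top_of_set M) (fst c) \<and> open (coord_dom c) \<and>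
     homeomorphism (fst c) (coord_dom c) (snd c) (chart_inv c)"

definition overlap :: "'a chart \<Rightarrow> 'a chart \<Rightarrow> (real^2) set" where
  "overlap c d = snd c ` (fst c \<inter> fst d)"

definition transition :: "'a chart \<Rightarrow> 'a chart \<Rightarrow> real^2 \<Rightarrow> real^2" where
  "transition c d = snd d \<circ> chart_inv c"

definition smooth_surface ::
  "'a::{t2_space, second_countable_topology} set \<Rightarrow> 'a chart set \<Rightarrow> bool" where
  "smooth_surface M A \<longleftrightarrow> (\<forall>c\<in>A. is_chart M c) \<and> (\<Union>c\<in>A. fst c) = M \<and>
     (\<forall>c\<in>A. \<forall>d\<in>A. smooth_on (overlap c d) (transition c d))"


definition L2_on :: "(real^2) set \<Rightarrow> (real^2 \<Rightarrow> 'b::euclidean_space) \<Rightarrow> bool" where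
  "L2_on S u \<longleftrightarrow> u \<in> borel_measurable (lebesgue_on S) \<and>
     integrable (lebesgue_on S) (\<lambda>x. (norm (u x))\<^sup>2)"

definition L2loc :: "(real^2) set \<Rightarrow> (real^2 \<Rightarrow> 'b::euclidean_space) \<Rightarrow> bool" where
  "L2loc W u \<longleftrightarrow> (\<forall>K. compact K \<and> K \<subseteq> W \<longrightarrow> L2_on K u)"

definition L1loc :: "(real^2) set \<Rightarrow> (real^2 \<Rightarrow> 'b::euclidean_space) \<Rightarrow> bool" where
  "L1loc W u \<longleftrightarrow> (\<forall>K. compact K \<and> K \<subseteq> W \<longrightarrow> integrable (lebesgue_on K) u)"

definition test_function :: "(real^2) set \<Rightarrow> (real^2 \<Rightarrow> real) \<Rightarrow> bool" where
  "test_function W \<phi> \<longleftrightarrow> smooth_on UNIV \<phi> \<and>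
     (\<exists>K. compact K \<and> K \<subseteq> W \<and> (\<forall>x. x \<notin> K \<longrightarrow> \<phi> x = 0))"

definition is_weak_partial ::
  "(real^2) set \<Rightarrow> 2 \<Rightarrow> (real^2 \<Rightarrow> 'b::euclidean_space) \<Rightarrow> (real^2 \<Rightarrow> 'b) \<Rightarrow> bool" where
  "is_weak_partial W i u v \<longleftrightarrow> L1loc W u \<and> L1loc W v \<and>
     (\<forall>\<phi>. test_function W \<phi> \<longrightarrow>
        (LINT x|lebesgue_on W. frechet_derivative \<phi> (at x) (axis i 1) *\<^sub>R u x) =
        - (LINT x|lebesgue_on W. \<phi> x *\<^sub>R v x))"

text \<open>A representative of the weak partial derivative. It is unique up to a null set, and it is only
  ever used up to null sets; if no weak derivative exists, the value is unspecified.\<close>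

definition weak_partial ::
  "(real^2) set \<Rightarrow> 2 \<Rightarrow> (real^2 \<Rightarrow> 'b::euclidean_space) \<Rightarrow> real^2 \<Rightarrow> 'b" where
  "weak_partial W i u = (SOME v. is_weak_partial W i u v)"

fun Hloc :: "nat \<Rightarrow> (real^2) set \<Rightarrow> (real^2 \<Rightarrow> 'b::euclidean_space) \<Rightarrow> bool" where
  "Hloc 0 W u \<longleftrightarrow> L2loc W u"
| "Hloc (Suc k) W u \<longleftrightarrow> L2loc W u \<and> (\<forall>i. \<exists>v. is_weak_partial W i u v \<and> Hloc k W v)"

text \<open>Weak convergence in $L^2_{\mathrm{loc}}$: the continuous functionals on this space are the
  pairings with compactly supported $L^2$ functions.\<close>

definition weakly_conv_L2loc ::
  "(real^2) set \<Rightarrow> (nat \<Rightarrow> real^2 \<Rightarrow> 'b::euclidean_space) \<Rightarrow> (real^2 \<Rightarrow> 'b) \<Rightarrow> bool" where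
  "weakly_conv_L2loc W u v \<longleftrightarrow> (\<forall>n. L2loc W (u n)) \<and> L2loc W v \<and>
     (\<forall>K h. compact K \<and> K \<subseteq> W \<and> L2_on K h \<longrightarrow>
        (\<lambda>n. LINT x|lebesgue_on K. u n x \<bullet> h x) \<longlonglongrightarrow> (LINT x|lebesgue_on K. v x \<bullet> h x))"

text \<open>Weak convergence in $H^k_{\mathrm{loc}}$: all weak derivatives of order at most $k$ converge
  weakly in $L^2_{\mathrm{loc}}$.\<close>

fun weak_derivs_conv ::
  "nat \<Rightarrow> (real^2) set \<Rightarrow> (nat \<Rightarrow> real^2 \<Rightarrow> 'b::euclidean_space) \<Rightarrow> (real^2 \<Rightarrow> 'b) \<Rightarrow> bool" where
  "weak_derivs_conv 0 W u v \<longleftrightarrow> weakly_conv_L2loc W u v"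
| "weak_derivs_conv (Suc k) W u v \<longleftrightarrow> weakly_conv_L2loc W u v \<and>
     (\<forall>i. weak_derivs_conv k W (\<lambda>n. weak_partial W i (u n)) (weak_partial W i v))"

definition weakly_conv_Hloc ::
  "nat \<Rightarrow> (real^2) set \<Rightarrow> (nat \<Rightarrow> real^2 \<Rightarrow> 'b::euclidean_space) \<Rightarrow> (real^2 \<Rightarrow> 'b) \<Rightarrow> bool" where
  "weakly_conv_Hloc k W u v \<longleftrightarrow> (\<forall>n. Hloc k W (u n)) \<and> Hloc k W v \<and> weak_derivs_conv k W u v"


text \<open>A tensor field is given by its components in each chart of the atlas. These are functions on
  the coordinate domain, determined up to null sets, and only their values there matter.\<close>

type_synonym 'a metric_tensor = "'a chart \<Rightarrow> real^2 \<Rightarrow> real^2^2"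

definition H1loc_metric :: "'a chart set \<Rightarrow> 'a metric_tensor \<Rightarrow> bool" where
  "H1loc_metric A g \<longleftrightarrow>
     (\<forall>c\<in>A. (\<forall>i j. Hloc 1 (coord_dom c) (\<lambda>x. g c x $ i $ j)) \<and>
        (AE x in lebesgue_on (coord_dom c).
           transpose (g c x) = g c x \<and> (\<forall>X. X \<noteq> 0 \<longrightarrow> X \<bullet> (g c x *v X) > 0))) \<and>
     (\<forall>c\<in>A. \<forall>d\<in>A. AE x in lebesgue_on (overlap c d).
        (let J = matrix (frechet_derivative (transition c d) (at x))
         in g c x = transpose J ** g d (transition c d x) ** J))"

definition in_coords :: "'a chart \<Rightarrow> ('a \<Rightarrow> 'b) \<Rightarrow> real^2 \<Rightarrow> 'b" where
  "in_coords c f = f \<circ> chart_inv c"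

definition D1 :: "'a chart \<Rightarrow> ('a \<Rightarrow> real^3) \<Rightarrow> 2 \<Rightarrow> real^2 \<Rightarrow> real^3" where
  "D1 c f i = weak_partial (coord_dom c) i (in_coords c f)"

definition D2 :: "'a chart \<Rightarrow> ('a \<Rightarrow> real^3) \<Rightarrow> 2 \<Rightarrow> 2 \<Rightarrow> real^2 \<Rightarrow> real^3" where
  "D2 c f i j = weak_partial (coord_dom c) i (D1 c f j)"

definition differential :: "'a chart \<Rightarrow> ('a \<Rightarrow> real^3) \<Rightarrow> real^2 \<Rightarrow> real^2 \<Rightarrow> real^3" where
  "differential c f x X = (\<Sum>i\<in>UNIV. X $ i *\<^sub>R D1 c f i x)"

definition H2loc_isometric_immersion ::
  "'a chart set \<Rightarrow> 'a metric_tensor \<Rightarrow> ('a \<Rightarrow> real^3) \<Rightarrow> bool" where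
  "H2loc_isometric_immersion A g f \<longleftrightarrow>
     (\<forall>c\<in>A. Hloc 2 (coord_dom c) (in_coords c f) \<and>
        (AE x in lebesgue_on (coord_dom c).
           inj (differential c f x) \<and>
           (\<forall>X Y. differential c f x X \<bullet> differential c f x Y = X \<bullet> (g c x *v Y))))"

text \<open>$\Gamma^k_{ij} = \frac12 g^{kl}(\partial_i g_{jl} + \partial_j g_{il} - \partial_l g_{ij})$\<close>

definition christoffel :: "'a chart \<Rightarrow> 'a metric_tensor \<Rightarrow> 2 \<Rightarrow> 2 \<Rightarrow> 2 \<Rightarrow> real^2 \<Rightarrow> real" where
  "christoffel c g k i j x =
     (let dg = (\<lambda>l a b. weak_partial (coord_dom c) l (\<lambda>y. g c y $ a $ b) x)
      in (\<Sum>l\<in>UNIV. matrix_inv (g c x) $ k $ l * (dg i j l + dg j i l - dg l i j)) / 2)"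

text \<open>The component $B(\partial_i,\partial_j) = \overline\nabla_{\partial_i}\partial_j -
  \nabla_{\partial_i}\partial_j$ of the second fundamental form, where $\partial_j$ is identified with
  $df(\partial_j) = \partial_j f$. It takes values in the ambient space.\<close>

definition second_fundamental_form ::
  "'a chart \<Rightarrow> 'a metric_tensor \<Rightarrow> ('a \<Rightarrow> real^3) \<Rightarrow> 2 \<Rightarrow> 2 \<Rightarrow> real^2 \<Rightarrow> real^3" where
  "second_fundamental_form c g f i j x =
     D2 c f i j x - (\<Sum>k\<in>UNIV. christoffel c g k i j x *\<^sub>R D1 c f k x)"


text \<open>The $L^2$ norms are taken with respect to the coordinates, over compact subsets of the coordinate
  domains (equivalently, with respect to any smooth background metric, over compact subsets of chart
  domains). As \<open>g\<close> is merely in $H^1_{\mathrm{loc}}$, it need not be bounded above or below and would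
  not give the usual $L^2_{\mathrm{loc}}$. When \<open>g\<close> and its inverse are locally bounded, a uniform
  bound on the $L^2$ norms with respect to \<open>g\<close> and its volume implies this one.\<close>

definition L2_bounded ::
  "(real^2) set \<Rightarrow> (nat \<Rightarrow> real^2 \<Rightarrow> 'b::euclidean_space) \<Rightarrow> bool" where
  "L2_bounded W u \<longleftrightarrow> (\<forall>K. compact K \<and> K \<subseteq> W \<longrightarrow>
     (\<exists>C. \<forall>n. L2_on K (u n) \<and> (LINT x|lebesgue_on K. (norm (u n x))\<^sup>2) \<le> C))"

text \<open>Translations change neither the induced metric nor the second fundamental form, so a family of
  isometric immersions can escape to infinity. Boundedness in $L^2_{\mathrm{loc}}$, which every weakly
  convergent sequence satisfies, excludes this.\<close>

definition functions_L2_bounded :: "'a chart set \<Rightarrow> (nat \<Rightarrow> 'a \<Rightarrow> real^3) \<Rightarrow> bool" where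
  "functions_L2_bounded A f \<longleftrightarrow> (\<forall>c\<in>A. L2_bounded (coord_dom c) (\<lambda>n. in_coords c (f n)))"

definition sff_L2_bounded ::
  "'a chart set \<Rightarrow> 'a metric_tensor \<Rightarrow> (nat \<Rightarrow> 'a \<Rightarrow> real^3) \<Rightarrow> bool" where
  "sff_L2_bounded A g f \<longleftrightarrow> (\<forall>c\<in>A. \<forall>i j.
     L2_bounded (coord_dom c) (\<lambda>n. second_fundamental_form c g (f n) i j))"

definition weakly_conv_H2loc ::
  "'a chart set \<Rightarrow> (nat \<Rightarrow> 'a \<Rightarrow> real^3) \<Rightarrow> ('a \<Rightarrow> real^3) \<Rightarrow> bool" where
  "weakly_conv_H2loc A f F \<longleftrightarrow>
     (\<forall>c\<in>A. weakly_conv_Hloc 2 (coord_dom c) (\<lambda>n. in_coords c (f n)) (in_coords c F))"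

definition sff_weakly_conv_L2loc ::
  "'a chart set \<Rightarrow> 'a metric_tensor \<Rightarrow> (nat \<Rightarrow> 'a \<Rightarrow> real^3) \<Rightarrow> ('a \<Rightarrow> real^3) \<Rightarrow> bool" where
  "sff_weakly_conv_L2loc A g f F \<longleftrightarrow> (\<forall>c\<in>A. \<forall>i j.
     weakly_conv_L2loc (coord_dom c) (\<lambda>n. second_fundamental_form c g (f n) i j)
       (second_fundamental_form c g F i j))"

end

theory Submission
  imports Defs "HOL-Library.Diagonal_Subsequence"
begin

text \<open>
  Put \<open>T\<close> for the tangential term $\Gamma^k_{ij}\partial_k f^n$ of the second fundamental form. By the isometry
  condition the pointwise norms of $\partial_i f^n$ and of \<open>T\<close> are determined by \<open>g\<close>, hence equal to those for
  $f^0$, which are locally square integrable. So first and second derivatives of $f^n$ are bounded in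
  $L^2_{\mathrm{loc}}$ although the Christoffel symbols themselves are not controlled.

  Poincare's inequality and Rellich's theorem on the boxes of a countable cover by chart boxes make $f^n$ minus
  constants converge almost everywhere on each box. On overlapping boxes the constants differ by convergent
  sequences, so by connectedness of the surface one sequence of translations serves all boxes, and the limit is
  defined pointwise on the surface. Almost everywhere convergence is invariant under change of charts because the
  transition maps preserve null sets; this is all that is ever transported between charts. In each chart the bounds
  then give weak convergence of the derivatives, Rellich's theorem turns it into almost everywhere convergence of
  first derivatives along subsequences, and this passes the isometry condition and \<open>T\<close> to the limit.

  Both theorems rest on the estimate of differences
  $\int_{Q \cap (Q - z)} |u(x+z) - u(x)|^2 \le 2 h^2 \int_Q |\nabla u|^2$ for a box \<open>Q\<close> and $|z_i| \le h$. Weak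
  compactness in $L^2$ comes from strongly convergent convex combinations (Mazur).
\<close>

section \<open>Smooth bump functions and test functions\<close>

text \<open>The inverse of \<open>g\<close> may be unbounded, so the Christoffel symbols need not
  even be locally integrable, and no product of strong and weak limits is available for the
  tangential term. For one immersion the term is locally square integrable all the same, being the
  second derivative minus the second fundamental form; this is what makes the comparison with
  \<open>f 0\<close> meaningful. At a fixed point the symbols are mere constants, so almost
  everywhere convergence of first derivatives passes through them, and an L^2 bound upgrades this to
  weak convergence. Almost everywhere convergence is also what crosses charts cheaply: weak
  derivatives would require a chain rule, whereas null sets only require differentiable transitions.
  The price is that the local L^2 bound on the functions must be rebuilt in each chart from their
  convergence and the gradient bound. The estimate of differences is obtained by duality, moving
  translations onto test functions, without mollification. Its averaged form, with a variable set of
  averaging, yields both compactness tools at once.\<close>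

lemma C_on_SucI:
  assumes "\<And>x. (f has_derivative f' x) (at x)"
    and "\<And>i. C_on k UNIV (\<lambda>x. f' x (axis i 1))"
  shows "C_on (Suc k) UNIV f"
proof -
  have "frechet_derivative f (at x) = f' x" for x
    using frechet_derivative_at[OF assms(1)] by simp
  then show ?thesis using assms by (auto simp: differentiable_def)
qed

text \<open>In the product rule an undifferentiated factor stands beside a derivative, so the
  induction for products has to lower the order of that factor.\<close>

lemma C_on_SucD: "C_on (Suc k) S f \<Longrightarrow> C_on k S f"
proof (induction k arbitrary: f)
  case 0
  then show ?case
    by (auto intro!: continuous_at_imp_continuous_on differentiable_imp_continuous_within)
next
  case (Suc k)
  have "C_on k S (\<lambda>x. frechet_derivative f (at x) (axis i 1))" for i
    using Suc.prems C_on.simps(2)[of "Suc k" S f] by (intro Suc.IH) blast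
  then show ?case using Suc.prems C_on.simps(2)[of k S f] C_on.simps(2)[of "Suc k" S f] by blast
qed

lemma C_on_has_derivative:
  assumes "C_on (Suc k) UNIV f"
  shows "(f has_derivative frechet_derivative f (at x)) (at x)"
  using assms frechet_derivative_works by auto

lemma C_on_const: "C_on k UNIV (\<lambda>x. c)"
proof (induction k arbitrary: c)
  case (Suc k)
  show ?case by (rule C_on_SucI[OF has_derivative_const Suc.IH])
qed simp

lemma C_on_add:
  "C_on k UNIV f \<Longrightarrow> C_on k UNIV g \<Longrightarrow> C_on k UNIV (\<lambda>x. f x + g x)"
proof (induction k arbitrary: f g)
  case (Suc k)
  show ?case
  proof (rule C_on_SucI)
    show "((\<lambda>x. f x + g x) has_derivative (\<lambda>h. frechet_derivative f (at x) h + frechet_derivative g (at x) h)) (at x)" for x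
      by (intro derivative_intros C_on_has_derivative[OF Suc.prems(1)] C_on_has_derivative[OF Suc.prems(2)])
  qed (use Suc in auto)
qed (auto intro: continuous_intros)

lemma C_on_mult:
  fixes f g :: "real^2 \<Rightarrow> real"
  shows "C_on k UNIV f \<Longrightarrow> C_on k UNIV g \<Longrightarrow> C_on k UNIV (\<lambda>x. f x * g x)"
proof (induction k arbitrary: f g)
  case (Suc k)
  show ?case
  proof (rule C_on_SucI)
    show "((\<lambda>x. f x * g x) has_derivative (\<lambda>h. f x * frechet_derivative g (at x) h + frechet_derivative f (at x) h * g x)) (at x)" for x
      by (intro derivative_intros C_on_has_derivative[OF Suc.prems(1)] C_on_has_derivative[OF Suc.prems(2)])
    show "C_on k UNIV (\<lambda>x. f x * frechet_derivative g (at x) (axis i 1) + frechet_derivative f (at x) (axis i 1) * g x)" for i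
      using Suc.prems C_on_SucD[OF Suc.prems(1)] C_on_SucD[OF Suc.prems(2)]
      by (intro C_on_add Suc.IH) auto
  qed
qed (auto intro: continuous_intros)

lemma has_derivative_translate:
  fixes f :: "real^2 \<Rightarrow> 'b::real_normed_vector"
  assumes "(f has_derivative f') (at (x - c))"
  shows "((\<lambda>x. f (x - c)) has_derivative f') (at x)"
proof -
  have "((\<lambda>x. x - c) has_derivative (\<lambda>h. h)) (at x)"
    by (auto intro!: derivative_eq_intros)
  from has_derivative_compose[OF this assms] show ?thesis by simp
qed

lemma C_on_translate: "C_on k UNIV f \<Longrightarrow> C_on k UNIV (\<lambda>x. f (x - c))"
proof (induction k arbitrary: f)
  case (Suc k)
  show ?case
  proof (rule C_on_SucI)
    show "((\<lambda>x. f (x - c)) has_derivative frechet_derivative f (at (x - c))) (at x)" for x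
      by (intro has_derivative_translate C_on_has_derivative[OF Suc.prems(1)])
  qed (use Suc in auto)
next
  case 0
  have "continuous_on UNIV (\<lambda>x. x - c)" by (intro continuous_intros)
  with 0 show ?case using continuous_on_compose2[of UNIV f UNIV "\<lambda>x. x - c"] by simp
qed

text \<open>The functions exp(-1/t)/t^k, extended by 0 to t at most 0. The powers are carried along
  because the span of the family is then closed under differentiation; k = 0 is the usual flat
  function.\<close>

definition flat_exp :: "nat \<Rightarrow> real \<Rightarrow> real" where
  "flat_exp k t = (if t \<le> 0 then 0 else (1/t)^k * exp (- (1/t)))"

lemma flat_exp_tendsto_0: "(flat_exp k \<longlongrightarrow> 0) (at 0)"
proof -
  have "((\<lambda>t. (inverse t)^k / exp (inverse t)) \<longlongrightarrow> 0) (at_right (0::real))"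
    using tendsto_power_div_exp_0[of k] filterlim_inverse_at_top_right
    by (rule filterlim_compose)
  then have "(flat_exp k \<longlongrightarrow> 0) (at_right 0)"
    by (rule Lim_transform_eventually)
       (auto simp: eventually_at_right_less flat_exp_def exp_minus field_simps intro!: eventually_at_rightI[of 0 1])
  moreover have "(flat_exp k \<longlongrightarrow> 0) (at_left 0)"
    by (rule Lim_transform_eventually[OF tendsto_const])
       (auto simp: flat_exp_def intro!: eventually_at_leftI[of "-1"])
  ultimately show ?thesis by (simp add: filterlim_split_at)
qed

lemma DERIV_flat_exp:
  "(flat_exp k has_field_derivative (flat_exp (k+2) t - real k * flat_exp (k+1) t)) (at t)"
proof -
  consider "t < 0" | "t = 0" | "t > 0" by linarith
  then show ?thesis
  proof cases
    case 1
    have "((\<lambda>t. 0) has_field_derivative 0) (at t)" by simp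
    then have "(flat_exp k has_field_derivative 0) (at t)"
      by (rule has_field_derivative_transform_within_open[where S="{..<0}"])
         (use 1 in \<open>auto simp: flat_exp_def\<close>)
    then show ?thesis using 1 by (simp add: flat_exp_def)
  next
    case 2
    \<comment> \<open>The difference quotient at 0 belongs to the same family, so its limit is the
      one already computed.\<close>
    have "(\<lambda>h. flat_exp k h / h) = flat_exp (Suc k)"
      by (auto simp: flat_exp_def fun_eq_iff)
    then have "(flat_exp k has_field_derivative 0) (at 0)"
      using flat_exp_tendsto_0[of "Suc k"] by (simp add: has_field_derivative_iff flat_exp_def)
    then show ?thesis using 2 by (simp add: flat_exp_def)
  next
    case 3
    have "((\<lambda>t. (1/t)^k * exp (- (1/t))) has_field_derivative
        (flat_exp (k+2) t - real k * flat_exp (k+1) t)) (at t)"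
      using 3
      apply (cases k)
       apply (auto intro!: derivative_eq_intros simp: flat_exp_def)
       apply (auto simp: field_simps power2_eq_square)
      by (metis power_eq_if One_nat_def)
    then show ?thesis
      by (rule has_field_derivative_transform_within_open[where S="{0<..}"])
         (use 3 in \<open>auto simp: flat_exp_def\<close>)
  qed
qed

text \<open>The affine argument is built in because the chain rule only adds the constant factor
  \<open>c\<close>; both signs of \<open>c\<close> occur, for the left and the right edge of a
  box.\<close>

lemma C_on_flat_exp: "C_on n UNIV (\<lambda>x. flat_exp k (c * x $ i + d))"
proof (induction n arbitrary: k)
  case 0
  have "continuous_on UNIV (flat_exp k)"
    using DERIV_flat_exp by (meson DERIV_isCont continuous_at_imp_continuous_on)
  moreover have "continuous_on UNIV (\<lambda>x::real^2. c * x $ i + d)" by (intro continuous_intros)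
  ultimately show ?case using continuous_on_compose2[of UNIV "flat_exp k" UNIV "\<lambda>x::real^2. c * x $ i + d"] by simp
next
  case (Suc n)
  show ?case
  proof (rule C_on_SucI)
    fix x :: "real^2"
    have 1: "((\<lambda>x. c * x $ i + d) has_derivative (\<lambda>h. c * h $ i)) (at x)"
      by (auto intro!: derivative_eq_intros bounded_linear_imp_has_derivative bounded_linear_vec_nth)
    show "((\<lambda>x. flat_exp k (c * x $ i + d)) has_derivative
       (\<lambda>h. (flat_exp (k+2) (c * x $ i + d) + (- real k) * flat_exp (k+1) (c * x $ i + d)) * (c * h $ i))) (at x)"
      using has_derivative_compose[OF 1 DERIV_flat_exp[unfolded has_field_derivative_def]] by simp
  next
    show "C_on n UNIV (\<lambda>x. (flat_exp (k+2) (c * x $ i + d) + (- real k) * flat_exp (k+1) (c * x $ i + d)) * (c * axis j 1 $ i))" for j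
      by (intro C_on_mult C_on_add C_on_const Suc)
  qed
qed

text \<open>A product of cutoffs for the left and right edge in each coordinate, with arguments
  expanded to fit \<open>C_on_flat_exp\<close>. The factor n+1 steepens the edges: exp(-1/((n+1)t))
  tends to 1 for t > 0, so the bumps approximate the indicator of the open box.\<close>

definition box_bump :: "real^2 \<Rightarrow> real^2 \<Rightarrow> nat \<Rightarrow> real^2 \<Rightarrow> real" where
  "box_bump a b n x = (\<Prod>i\<in>UNIV. flat_exp 0 (real (Suc n) * x $ i + - real (Suc n) * a $ i) *
      flat_exp 0 (- real (Suc n) * x $ i + real (Suc n) * b $ i))"

lemma smooth_on_box_bump: "smooth_on UNIV (box_bump a b n)"
proof -
  have "C_on k UNIV (\<lambda>x. box_bump a b n x)" for k
    unfolding box_bump_def UNIV_2 by (simp, intro C_on_mult C_on_flat_exp)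
  then show ?thesis by (auto simp: smooth_on_def)
qed

lemma flat_exp_bounds: "0 \<le> flat_exp 0 t" "flat_exp 0 t \<le> 1"
  by (auto simp: flat_exp_def)

lemma box_bump_bounds: "0 \<le> box_bump a b n x" "box_bump a b n x \<le> 1"
  unfolding box_bump_def
  by (auto intro!: prod_nonneg prod_le_1 mult_nonneg_nonneg mult_le_one simp: flat_exp_bounds)

lemma box_bump_eq_0: 
  assumes "x \<notin> box a b" shows "box_bump a b n x = 0"
proof -
  obtain i where i: "x $ i \<le> a $ i \<or> b $ i \<le> x $ i"
    using assms by (auto simp: mem_box_cart not_less)
  have "real (Suc n) * (x $ i - a $ i) \<le> 0 \<or> real (Suc n) * (b $ i - x $ i) \<le> 0"
    using i by (auto simp: mult_le_0_iff)
  then have "flat_exp 0 (real (Suc n) * x $ i + - real (Suc n) * a $ i) *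
      flat_exp 0 (- real (Suc n) * x $ i + real (Suc n) * b $ i) = 0"
    by (auto simp: flat_exp_def algebra_simps)
  then show ?thesis by (auto simp: box_bump_def intro!: prod_zero)
qed

lemma box_bump_tendsto: "(\<lambda>n. box_bump a b n x) \<longlonglongrightarrow> indicator (box a b) x"
proof (cases "x \<in> box a b")
  case True
  have *: "(\<lambda>n. flat_exp 0 (real (Suc n) * t)) \<longlonglongrightarrow> 1" if "t > 0" for t
  proof -
    have "(\<lambda>n. exp (- ((1/t) * inverse (real (Suc n))))) \<longlonglongrightarrow> exp (- (1/t * 0))"
      by (intro tendsto_intros LIMSEQ_inverse_real_of_nat)
    moreover have "flat_exp 0 (real (Suc n) * t) = exp (- ((1/t) * inverse (real (Suc n))))" for n
      using that mult_pos_pos[of "real (Suc n)" t] by (simp add: flat_exp_def not_le field_simps del: of_nat_Suc)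
    ultimately show ?thesis by simp
  qed
  have "(\<lambda>n. \<Prod>i\<in>(UNIV::2 set). flat_exp 0 (real (Suc n) * (x $ i - a $ i)) *
      flat_exp 0 (real (Suc n) * (b $ i - x $ i))) \<longlonglongrightarrow> (\<Prod>i\<in>(UNIV::2 set). 1 * 1)"
    using True by (intro tendsto_intros *) (auto simp: mem_box_cart)
  moreover have "box_bump a b n x = (\<Prod>i\<in>UNIV. flat_exp 0 (real (Suc n) * (x $ i - a $ i)) *
      flat_exp 0 (real (Suc n) * (b $ i - x $ i)))" for n
    by (simp add: box_bump_def algebra_simps)
  ultimately show ?thesis using True by simp
qed (simp add: box_bump_eq_0)

lemma test_function_box_bump: "cbox a b \<subseteq> W \<Longrightarrow> test_function W (box_bump a b n)"
  using box_subset_cbox[of a b]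
  by (auto simp: test_function_def smooth_on_box_bump intro!: exI[of _ "cbox a b"] box_bump_eq_0)

section \<open>Test functions: supports, bounds, translates and integration along coordinate
  lines\<close>

lemma test_function_subset: "test_function V \<phi> \<Longrightarrow> V \<subseteq> W \<Longrightarrow> test_function W \<phi>"
  by (auto simp: test_function_def)

lemma test_function_continuous: "test_function W \<phi> \<Longrightarrow> continuous_on UNIV \<phi>"
  unfolding test_function_def smooth_on_def by (metis C_on.simps(1))

abbreviation pd :: "2 \<Rightarrow> (real^2 \<Rightarrow> real) \<Rightarrow> real^2 \<Rightarrow> real" where
  "pd i \<phi> x \<equiv> frechet_derivative \<phi> (at x) (axis i 1)"

lemma test_function_has_derivative:
  "test_function W \<phi> \<Longrightarrow> (\<phi> has_derivative frechet_derivative \<phi> (at x)) (at x)"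
  unfolding test_function_def smooth_on_def by (metis C_on_has_derivative)

lemma test_function_pd_continuous: "test_function W \<phi> \<Longrightarrow> continuous_on UNIV (pd i \<phi>)"
  unfolding test_function_def smooth_on_def by (metis C_on.simps)

text \<open>\<open>K\<close> is closed, so the function vanishes near each point outside
  \<open>K\<close>; one compact set thus serves the function and its derivatives.\<close>

lemma test_function_support:
  assumes "test_function W \<phi>"
  obtains K where "compact K" "K \<subseteq> W" "\<And>x. x \<notin> K \<Longrightarrow> \<phi> x = 0" "\<And>x i. x \<notin> K \<Longrightarrow> pd i \<phi> x = 0"
proof -
  obtain K where K: "compact K" "K \<subseteq> W" "\<And>x. x \<notin> K \<Longrightarrow> \<phi> x = 0"
    using assms by (auto simp: test_function_def)
  have "pd i \<phi> x = 0" if "x \<notin> K" for x i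
  proof -
    have "((\<lambda>x. 0) has_derivative (\<lambda>h. 0)) (at x)" by simp
    then have "(\<phi> has_derivative (\<lambda>h. 0)) (at x)"
      by (rule has_derivative_transform_within_open[where s="-K"])
         (use K that in \<open>auto simp: compact_imp_closed open_Compl\<close>)
    then show ?thesis using frechet_derivative_at by metis
  qed
  with K that show thesis by blast
qed

lemma continuous_compact_support_bounded:
  fixes \<phi> :: "'a::topological_space \<Rightarrow> 'b::real_normed_vector"
  assumes "continuous_on UNIV \<phi>" "compact K" "\<And>x. x \<notin> K \<Longrightarrow> \<phi> x = 0"
  obtains B where "B > 0" "\<And>x. norm (\<phi> x) \<le> B"
proof -
  have "bounded (\<phi> ` K)"
    using assms by (intro compact_imp_bounded compact_continuous_image) (auto intro: continuous_on_subset)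
  then obtain B where B: "\<And>x. x \<in> K \<Longrightarrow> norm (\<phi> x) \<le> B" by (auto simp: bounded_iff)
  have "norm (\<phi> x) \<le> max B 1" for x
    using B[of x] assms(3)[of x] by (cases "x \<in> K") auto
  then show thesis by (intro that[of "max B 1"]) auto
qed

lemma test_function_bounded:
  assumes "test_function W \<phi>"
  obtains B where "B > 0" "\<And>x. \<bar>\<phi> x\<bar> \<le> B" "\<And>x. \<bar>pd i \<phi> x\<bar> \<le> B"
proof -
  obtain K where K: "compact K" "\<And>x. x \<notin> K \<Longrightarrow> \<phi> x = 0" "\<And>x i. x \<notin> K \<Longrightarrow> pd i \<phi> x = 0"
    using test_function_support[OF assms] by metis
  obtain B1 where "B1 > 0" "\<And>x. norm (\<phi> x) \<le> B1"
    using continuous_compact_support_bounded[OF test_function_continuous[OF assms] K(1,2)] by metis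
  moreover obtain B2 where "B2 > 0" "\<And>x. norm (pd i \<phi> x) \<le> B2"
    using continuous_compact_support_bounded[OF test_function_pd_continuous[OF assms] K(1,3)] by metis
  ultimately show thesis
    by (intro that[of "max B1 B2"]) (auto simp: le_max_iff_disj)
qed

lemma pd_translate:
  assumes "test_function W \<phi>"
  shows "pd i (\<lambda>x. \<phi> (x - c)) x = pd i \<phi> (x - c)"
proof -
  have "((\<lambda>x. \<phi> (x - c)) has_derivative frechet_derivative \<phi> (at (x - c))) (at x)"
    by (intro has_derivative_translate test_function_has_derivative[OF assms])
  then show ?thesis using frechet_derivative_at by metis
qed

lemma test_function_translate:
  assumes "test_function V \<phi>" "\<And>x. x \<in> V \<Longrightarrow> x + c \<in> W"
  shows "test_function W (\<lambda>x. \<phi> (x - c))"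
proof -
  obtain K where K: "compact K" "K \<subseteq> V" "\<And>x. x \<notin> K \<Longrightarrow> \<phi> x = 0"
    using assms by (auto simp: test_function_def)
  have "compact ((+) c ` K)" by (intro compact_continuous_image continuous_intros K)
  moreover have "(+) c ` K \<subseteq> W" using K assms by (force simp: add.commute)
  moreover have "\<phi> (x - c) = 0" if "x \<notin> (+) c ` K" for x
    using that K(3)[of "x - c"] by (metis add.commute diff_add_cancel image_eqI)
  moreover have "smooth_on UNIV (\<lambda>x. \<phi> (x - c))"
    using assms(1) by (auto simp: test_function_def smooth_on_def intro: C_on_translate)
  ultimately show ?thesis unfolding test_function_def by blast
qed

text \<open>The path runs backwards from \<open>x\<close> because test functions get translated by
  subtracting from the argument. The indicator and \<open>lborel\<close> give the form to which
  Fubini is applied later.\<close>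

lemma test_function_FTC:
  assumes "test_function W \<phi>"  "0 \<le> t"
  shows "\<phi> x - \<phi> (x - t *\<^sub>R axis i 1) = (LINT s|lborel. indicator {0..t} s *\<^sub>R pd i \<phi> (x - s *\<^sub>R axis i 1))"
proof -
  have "((\<lambda>s. - \<phi> (x - s *\<^sub>R axis i 1)) has_vector_derivative pd i \<phi> (x - s *\<^sub>R axis i 1)) (at s within {0..t})" for s
  proof -
    have 1: "((\<lambda>s. x - s *\<^sub>R axis i 1) has_derivative (\<lambda>h. - (h *\<^sub>R axis i 1))) (at s within {0..t})"
      by (auto intro!: derivative_eq_intros)
    have "((\<lambda>s. \<phi> (x - s *\<^sub>R axis i 1)) has_derivative (\<lambda>h. frechet_derivative \<phi> (at (x - s *\<^sub>R axis i 1)) (- (h *\<^sub>R axis i 1)))) (at s within {0..t})"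
      by (rule has_derivative_compose[OF 1]) (rule test_function_has_derivative[OF assms(1)])
    moreover have "frechet_derivative \<phi> (at y) (- (h *\<^sub>R axis i 1)) = - (h * pd i \<phi> y)" for h y
      using linear_cmul[OF has_derivative_linear[OF test_function_has_derivative[OF assms(1)]], of y "-h"] by simp
    ultimately show ?thesis by (auto simp: has_vector_derivative_def dest: has_derivative_minus)
  qed
  moreover have "continuous_on {0..t} (\<lambda>s. pd i \<phi> (x - s *\<^sub>R axis i 1))"
    by (rule continuous_on_compose2[OF test_function_pd_continuous[OF assms(1)]]) (auto intro!: continuous_intros)
  ultimately show ?thesis
    using integral_FTC_atLeastAtMost[OF assms(2), of "\<lambda>s. - \<phi> (x - s *\<^sub>R axis i 1)" "\<lambda>s. pd i \<phi> (x - s *\<^sub>R axis i 1)"]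
    by simp
qed

section \<open>The fundamental lemma of the calculus of variations\<close>

text \<open>Fubini is used on products of \<open>lborel\<close>, which is not complete; Lebesgue
  measurable functions therefore enter through Borel representatives, built component by
  component.\<close>

lemma ex_borel_rep:
  fixes u :: "'a::euclidean_space \<Rightarrow> 'b::euclidean_space"
  assumes u: "u \<in> borel_measurable (lebesgue_on S)" and S: "S \<in> sets lebesgue"
  obtains v where "v \<in> borel_measurable borel" "AE x in lebesgue. x \<in> S \<longrightarrow> u x = v x"
proof -
  let ?u = "\<lambda>x. if x \<in> S then u x else 0"
  have "?u \<in> borel_measurable lebesgue" using borel_measurable_if[OF S] u by blast
  then have "(\<lambda>x. ?u x \<bullet> b) \<in> borel_measurable (completion lborel)" for b
    by (intro borel_measurable_inner) auto
  from completion_ex_borel_measurable_real[OF this]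
  obtain v where v: "\<And>b. v b \<in> borel_measurable lborel" "\<And>b. AE x in lborel. ?u x \<bullet> b = v b x"
    by metis
  have "AE x in lborel. \<forall>b\<in>Basis. ?u x \<bullet> b = v b x"
    using v(2) by (intro AE_finite_allI) auto
  then have "AE x in lebesgue. \<forall>b\<in>Basis. ?u x \<bullet> b = v b x"
    by (rule AE_completion)
  then have "AE x in lebesgue. x \<in> S \<longrightarrow> u x = (\<Sum>b\<in>Basis. v b x *\<^sub>R b)"
  proof eventually_elim
    case (elim x)
    have "u x = (\<Sum>b\<in>Basis. v b x *\<^sub>R b)" if "x \<in> S"
    proof -
      have "u x = (\<Sum>b\<in>Basis. (u x \<bullet> b) *\<^sub>R b)" by (rule euclidean_representation[symmetric])
      also have "\<dots> = (\<Sum>b\<in>Basis. v b x *\<^sub>R b)" using elim that by (intro sum.cong) auto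
      finally show ?thesis .
    qed
    then show ?case by simp
  qed
  moreover have "(\<lambda>x. \<Sum>b\<in>Basis. v b x *\<^sub>R b) \<in> borel_measurable borel"
    using v(1) by (intro borel_measurable_sum borel_measurable_scaleR) auto
  ultimately show thesis using that by blast
qed

lemma AE_lebesgue_on_iff:
  "S \<in> sets lebesgue \<Longrightarrow> (AE x in lebesgue_on S. P x) \<longleftrightarrow> (AE x in lebesgue. x \<in> S \<longrightarrow> P x)"
  by (simp add: AE_restrict_space_iff)

lemma AE_lebesgue_lborel: "(AE x in lebesgue. P x) \<longleftrightarrow> (AE x in lborel. P x)"
  by (rule AE_completion_iff)

text \<open>The factor \<open>\<psi>\<close> vanishes off \<open>S\<close>, so \<open>w\<close> has
  to agree with its representative on \<open>S\<close> only.\<close>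

lemma integral_lebesgue_on_eq_lborel:
  fixes w :: "'a::euclidean_space \<Rightarrow> 'b::euclidean_space"
  assumes W: "W \<in> sets lebesgue" and \<psi>: "\<psi> \<in> borel_measurable borel"
    and S: "S \<subseteq> W" "\<And>x. x \<notin> S \<Longrightarrow> \<psi> x = 0"
    and v: "v \<in> borel_measurable borel" "AE x in lebesgue. x \<in> S \<longrightarrow> w x = v x"
  shows "(LINT x|lebesgue_on W. \<psi> x *\<^sub>R w x) = (LINT x|lborel. \<psi> x *\<^sub>R v x)"
    and "integrable (lebesgue_on W) (\<lambda>x. \<psi> x *\<^sub>R w x) \<longleftrightarrow> integrable lborel (\<lambda>x. \<psi> x *\<^sub>R v x)"
proof -
  let ?f = "\<lambda>x. if x \<in> W then \<psi> x *\<^sub>R w x else 0"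
  have g: "(\<lambda>x. \<psi> x *\<^sub>R v x) \<in> borel_measurable borel" using \<psi> v by simp
  then have gm: "(\<lambda>x. \<psi> x *\<^sub>R v x) \<in> borel_measurable lebesgue"
    by (intro measurable_completion) simp
  have ae: "AE x in lebesgue. \<psi> x *\<^sub>R v x = ?f x"
    using v(2) by eventually_elim (use S in \<open>metis scaleR_zero_left subsetD\<close>)
  have fm: "?f \<in> borel_measurable lebesgue"
    using borel_measurable_AE[OF gm ae] .
  have "(LINT x|lebesgue_on W. \<psi> x *\<^sub>R w x) = (LINT x|lebesgue. ?f x)"
    by (rule Lebesgue_Measure.integral_restrict_UNIV[OF W, symmetric])
  also have "\<dots> = (LINT x|lebesgue. \<psi> x *\<^sub>R v x)"
    using ae by (intro integral_cong_AE fm gm) auto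
  also have "\<dots> = (LINT x|lborel. \<psi> x *\<^sub>R v x)"
    using g by (intro integral_completion) simp
  finally show "(LINT x|lebesgue_on W. \<psi> x *\<^sub>R w x) = (LINT x|lborel. \<psi> x *\<^sub>R v x)" .
  have "integrable (lebesgue_on W) (\<lambda>x. \<psi> x *\<^sub>R w x) \<longleftrightarrow> integrable lebesgue ?f"
    by (rule Lebesgue_Measure.integrable_restrict_UNIV[OF W, symmetric])
  also have "\<dots> \<longleftrightarrow> integrable lebesgue (\<lambda>x. \<psi> x *\<^sub>R v x)"
    using ae by (intro integrable_cong_AE fm gm) auto
  also have "\<dots> \<longleftrightarrow> integrable lborel (\<lambda>x. \<psi> x *\<^sub>R v x)"
    using g by (intro integrable_completion) simp
  finally show "integrable (lebesgue_on W) (\<lambda>x. \<psi> x *\<^sub>R w x) \<longleftrightarrow> integrable lborel (\<lambda>x. \<psi> x *\<^sub>R v x)" .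
qed

lemma integrable_borel_rep:
  fixes u :: "'a::euclidean_space \<Rightarrow> 'b::euclidean_space"
  assumes "integrable (lebesgue_on K) u" "K \<in> sets borel"
  obtains v where "v \<in> borel_measurable borel" "integrable lborel v" 
    "AE x in lebesgue. x \<in> K \<longrightarrow> u x = v x" "\<And>x. x \<notin> K \<Longrightarrow> v x = 0"
proof -
  have K: "K \<in> sets lebesgue" using assms(2) by (simp add: sets_completionI_sets)
  obtain v where v: "v \<in> borel_measurable borel" "AE x in lebesgue. x \<in> K \<longrightarrow> u x = v x"
    using ex_borel_rep[OF borel_measurable_integrable[OF assms(1)] K] .
  have "integrable (lebesgue_on K) (\<lambda>x. indicator K x *\<^sub>R u x) \<longleftrightarrow> integrable lborel (\<lambda>x. indicator K x *\<^sub>R v x)"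
    by (rule integral_lebesgue_on_eq_lborel(2)[OF K _ order_refl _ v]) (use assms(2) in auto)
  moreover have "integrable (lebesgue_on K) (\<lambda>x. indicator K x *\<^sub>R u x)"
    using assms(1) by (subst Bochner_Integration.integrable_cong[OF refl, where g=u]) (auto simp: space_restrict_space)
  ultimately have "integrable lborel (\<lambda>x. indicator K x *\<^sub>R v x)" by simp
  then show thesis
    using v assms(2) by (intro that[of "\<lambda>x. indicator K x *\<^sub>R v x"]) auto
qed

text \<open>An open set is a countable union of closed boxes, and countably many null sets may be
  united. This localizes almost everywhere statements to boxes.\<close>

lemma AE_open_if_cboxes:
  fixes W :: "'a::euclidean_space set"
  assumes "open W" "\<And>a b. cbox a b \<subseteq> W \<Longrightarrow> AE x in M. x \<in> cbox a b \<longrightarrow> P x"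
  shows "AE x in M. x \<in> W \<longrightarrow> P x"
proof -
  obtain D where D: "countable D" "\<And>X. X \<in> D \<Longrightarrow> \<exists>a b. X = cbox a b" "\<Union>D = W"
    using open_countable_Union_open_cbox[OF assms(1)] by metis
  have "AE x in M. \<forall>X\<in>D. x \<in> X \<longrightarrow> P x"
  proof (subst AE_ball_countable[OF D(1)], rule)
    fix X assume "X \<in> D"
    then show "AE x in M. x \<in> X \<longrightarrow> P x" using D assms(2) by (metis Union_upper)
  qed
  then show ?thesis by eventually_elim (use D(3) in auto)
qed

text \<open>The faces of a box are null. Test functions live on open boxes, local integrability on
  closed ones; this links the two.\<close>

lemma AE_box_cbox: "(AE x in lebesgue. x \<in> box a b \<longrightarrow> P x) \<longleftrightarrow> (AE x in lebesgue. x \<in> cbox a b \<longrightarrow> P x)"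
proof -
  have "negligible (cbox a b - box a b)" by (rule negligible_frontier_interval)
  then have "AE x in lebesgue. x \<notin> cbox a b - box a b"
    by (metis AE_not_in negligible_iff_null_sets)
  then have "AE x in lebesgue. (x \<in> box a b) = (x \<in> cbox a b)"
    by eventually_elim (use box_subset_cbox in auto)
  then show ?thesis by (auto elim!: eventually_elim2 eventually_mono[rotated])
qed

text \<open>Bump functions and dominated convergence turn the hypothesis into vanishing integrals
  over boxes. Boxes form an intersection-stable generator of the Borel sets, so all set integrals
  vanish.\<close>

lemma fundamental_lemma_lborel:
  fixes w :: "real^2 \<Rightarrow> 'b::euclidean_space"
  assumes w: "integrable lborel w" and V: "open V"
    and test: "\<And>\<phi>. test_function V \<phi> \<Longrightarrow> (LINT x|lborel. \<phi> x *\<^sub>R w x) = 0"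
  shows "AE x in lborel. x \<in> V \<longrightarrow> w x = 0"
proof (rule AE_open_if_cboxes[OF V])
  fix a b :: "real^2" assume ab: "cbox a b \<subseteq> V"
  have [measurable]: "w \<in> borel_measurable borel" using w by auto
  have box0: "(LINT x|lborel. indicator (box c d) x *\<^sub>R w x) = 0" if cd: "cbox c d \<subseteq> V" for c d
  proof -
    have [measurable]: "box_bump c d n \<in> borel_measurable borel" for n
      using test_function_continuous[OF test_function_box_bump[OF cd]]
      by (intro borel_measurable_continuous_onI)
    have "(\<lambda>n. LINT x|lborel. box_bump c d n x *\<^sub>R w x) \<longlonglongrightarrow> (LINT x|lborel. indicator (box c d) x *\<^sub>R w x)"
    proof (rule integral_dominated_convergence[where w="\<lambda>x. norm (w x)"])
      show "AE x in lborel. (\<lambda>n. box_bump c d n x *\<^sub>R w x) \<longlonglongrightarrow> indicator (box c d) x *\<^sub>R w x"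
        by (intro AE_I2 tendsto_intros box_bump_tendsto)
      show "AE x in lborel. norm (box_bump c d n x *\<^sub>R w x) \<le> norm (w x)" for n
        using box_bump_bounds[of c d n] by (auto intro!: mult_left_le_one_le)
    qed (use w in auto)
    then show ?thesis
      using test[OF test_function_box_bump[OF cd]] by (simp add: LIMSEQ_const_iff)
  qed
  \<comment> \<open>The function is cut off to one box with closure in \<open>V\<close>, so that its
    intersection with any generating box is still within reach of the bump functions.\<close>
  let ?B = "box a b" 
  let ?w = "\<lambda>x. indicator ?B x *\<^sub>R w x"
  have wB: "integrable lborel ?w" using w by (intro integrable_mult_indicator) auto
  have boxI: "\<exists>c d. box p q \<inter> ?B = box c d \<and> cbox c d \<subseteq> V" for p q
  proof (cases "box p q \<inter> ?B = {}")
    case True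
    \<comment> \<open>An empty open box may have corners whose closed box is nonempty and leaves
      \<open>V\<close>; a box that is empty in both senses is supplied instead.\<close>
    have "cbox (1::real^2) 0 = {}" by (simp add: interval_eq_empty_cart)
    then obtain c d :: "real^2" where cd: "cbox c d = {}" by blast
    then have "box c d = {}" using box_subset_cbox by blast
    then show ?thesis using cd True by (intro exI[of _ c] exI[of _ d]) auto
  next
    case False
    obtain c d where cd: "box p q \<inter> ?B = box c d" unfolding box_Int_box by blast
    have "closure (box c d) \<subseteq> closure ?B" using cd by (intro closure_mono) auto
    moreover have "closure ?B = cbox a b" "closure (box c d) = cbox c d"
      using False cd by (auto intro!: closure_box)
    ultimately show ?thesis using cd ab by blast
  qed
  have "(LINT x|lborel. indicator A x *\<^sub>R ?w x) = 0" if "A \<in> sets borel" for A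
  proof -
    have A: "A \<in> sigma_sets UNIV (range (\<lambda>(a, b). box a b :: (real^2) set))"
      using that by (simp add: borel_eq_box)
    have st: "Int_stable (range (\<lambda>(a, b). box a b :: (real^2) set))"
      by (auto simp: Int_stable_def box_Int_box)
    have "range (\<lambda>(a, b). box a b :: (real^2) set) \<subseteq> Pow UNIV" by simp
    from st this A show ?thesis
    proof (induction A rule: sigma_sets_induct_disjoint)
      case (basic A)
      then obtain p q where A: "A = box p q" by auto
      obtain c d where cd: "box p q \<inter> ?B = box c d" "cbox c d \<subseteq> V" using boxI by blast
      have "(\<lambda>x. indicator A x *\<^sub>R ?w x) = (\<lambda>x. indicator (box c d) x *\<^sub>R w x)"
        unfolding A cd(1)[symmetric] by (auto simp: indicator_def)
      then show ?case using box0[OF cd(2)] by metis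
    next
      case empty then show ?case by simp
    next
      case (compl A)
      have A: "A \<in> sets borel" using compl(1) by (simp add: borel_eq_box)
      have "(LINT x|lborel. indicator (UNIV - A) x *\<^sub>R ?w x) = (LINT x|lborel. ?w x - indicator A x *\<^sub>R ?w x)"
        by (intro Bochner_Integration.integral_cong) (auto simp: indicator_def)
      also have "\<dots> = (LINT x|lborel. ?w x) - (LINT x|lborel. indicator A x *\<^sub>R ?w x)"
        by (intro Bochner_Integration.integral_diff integrable_mult_indicator wB) (use A in auto)
      finally show ?case using compl box0[OF ab] by simp
    next
      case (union A)
      have A: "A i \<in> sets borel" for i using union(2) by (auto simp: borel_eq_box)
      have "(LINT x:(\<Union>i. A i)|lborel. ?w x) = (\<Sum>i. (LINT x:(A i)|lborel. ?w x))"
      proof (rule lebesgue_integral_countable_add)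
        show "set_integrable lborel (\<Union>i. A i) ?w"
          unfolding set_integrable_def using A by (intro integrable_mult_indicator wB) auto
      qed (use A union(1) in \<open>auto simp: disjoint_family_on_def\<close>)
      then show ?case using union(3) by (simp add: set_lebesgue_integral_def)
    qed
  qed
  then have "AE x in lborel. ?w x = 0"
    by (intro sigma_finite_measure.density_zero[OF sigma_finite_lborel] wB) (auto simp: set_lebesgue_integral_def)
  then have "AE x in lebesgue. x \<in> box a b \<longrightarrow> w x = 0"
    unfolding AE_lebesgue_lborel by eventually_elim (auto simp: indicator_def)
  then show "AE x in lborel. x \<in> cbox a b \<longrightarrow> w x = 0"
    unfolding AE_box_cbox unfolding AE_lebesgue_lborel .
qed

lemma test_integral_lborel:
  fixes w :: "real^2 \<Rightarrow> 'b::euclidean_space"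
  assumes W: "open W" "V \<subseteq> W" and \<phi>: "test_function V \<phi>"
    and v: "v \<in> borel_measurable borel" "AE x in lebesgue. x \<in> V \<longrightarrow> w x = v x"
  shows "(LINT x|lebesgue_on W. \<phi> x *\<^sub>R w x) = (LINT x|lborel. \<phi> x *\<^sub>R v x)"
    and "(LINT x|lebesgue_on W. pd i \<phi> x *\<^sub>R w x) = (LINT x|lborel. pd i \<phi> x *\<^sub>R v x)"
proof -
  obtain K where K: "K \<subseteq> V" "\<And>x. x \<notin> K \<Longrightarrow> \<phi> x = 0" "\<And>x i. x \<notin> K \<Longrightarrow> pd i \<phi> x = 0"
    using test_function_support[OF \<phi>] by metis
  have *: "W \<in> sets lebesgue" using W(1) by (simp add: sets_completionI_sets)
  have ae: "AE x in lebesgue. x \<in> K \<longrightarrow> w x = v x" using v(2) by eventually_elim (use K(1) in auto)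
  show "(LINT x|lebesgue_on W. \<phi> x *\<^sub>R w x) = (LINT x|lborel. \<phi> x *\<^sub>R v x)"
    using test_function_continuous[OF \<phi>] K W
    by (intro integral_lebesgue_on_eq_lborel(1)[OF * _ _ _ v(1) ae])
      (auto intro!: borel_measurable_continuous_onI)
  show "(LINT x|lebesgue_on W. pd i \<phi> x *\<^sub>R w x) = (LINT x|lborel. pd i \<phi> x *\<^sub>R v x)"
    using test_function_pd_continuous[OF \<phi>] K W
    by (intro integral_lebesgue_on_eq_lborel(1)[OF * _ _ _ v(1) ae])
      (auto intro!: borel_measurable_continuous_onI)
qed

text \<open>On each closed box the function has an integrable Borel representative, to which
  \<open>fundamental_lemma_lborel\<close> applies with the open box as domain.\<close>

lemma fundamental_lemma:
  fixes w :: "real^2 \<Rightarrow> 'b::euclidean_space"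
  assumes W: "open W" and w: "L1loc W w"
    and test: "\<And>\<phi>. test_function W \<phi> \<Longrightarrow> (LINT x|lebesgue_on W. \<phi> x *\<^sub>R w x) = 0"
  shows "AE x in lebesgue. x \<in> W \<longrightarrow> w x = 0"
proof (rule AE_open_if_cboxes[OF W])
  fix a b :: "real^2" assume ab: "cbox a b \<subseteq> W"
  have "integrable (lebesgue_on (cbox a b)) w" using w ab by (auto simp: L1loc_def)
  then obtain v where v: "v \<in> borel_measurable borel" "integrable lborel v" 
    "AE x in lebesgue. x \<in> cbox a b \<longrightarrow> w x = v x"
    using integrable_borel_rep[of "cbox a b" w] by auto
  have "AE x in lborel. x \<in> box a b \<longrightarrow> v x = 0"
  proof (rule fundamental_lemma_lborel[OF v(2)])
    fix \<phi> assume \<phi>: "test_function (box a b) \<phi>"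
    have sub: "box a b \<subseteq> W" using ab box_subset_cbox by blast
    have "AE x in lebesgue. x \<in> box a b \<longrightarrow> w x = v x" using v(3) unfolding AE_box_cbox .
    from test_integral_lborel(1)[OF W sub \<phi> v(1) this] test[OF test_function_subset[OF \<phi> sub]]
    show "(LINT x|lborel. \<phi> x *\<^sub>R v x) = 0" by simp
  qed auto
  then have "AE x in lebesgue. x \<in> cbox a b \<longrightarrow> v x = 0"
    unfolding AE_lebesgue_lborel[symmetric] AE_box_cbox .
  with v(3) show "AE x in lebesgue. x \<in> cbox a b \<longrightarrow> w x = 0" by eventually_elim auto
qed

section \<open>Differences and averages of weakly differentiable functions\<close>

text \<open>Squares are taken in \<open>ennreal\<close>, so that Tonelli, Fatou and monotonicity
  apply without prior integrability.\<close>

abbreviation sqnorm :: "'a::real_normed_vector \<Rightarrow> ennreal" where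
  "sqnorm v \<equiv> ennreal ((norm v)\<^sup>2)"

section \<open>Translations under the integral sign\<close>

lemma nn_integral_lborel_shift:
  fixes f :: "'a::euclidean_space \<Rightarrow> ennreal"
  assumes "f \<in> borel_measurable borel"
  shows "(\<integral>\<^sup>+x. f (x + c) \<partial>lborel) = (\<integral>\<^sup>+x. f x \<partial>lborel)"
  using nn_integral_distr[of "(+) c" lborel borel f] assms
  by (simp add: lborel_distr_plus add.commute)

lemma integral_lborel_shift:
  fixes f :: "'a::euclidean_space \<Rightarrow> 'b::{banach, second_countable_topology}"
  assumes "f \<in> borel_measurable borel"
  shows "(\<integral>x. f (x + c) \<partial>lborel) = (\<integral>x. f x \<partial>lborel)"
  using integral_distr[of "(+) c" lborel borel f] assms
  by (simp add: lborel_distr_plus add.commute)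

lemma integrable_lborel_shift:
  fixes f :: "'a::euclidean_space \<Rightarrow> 'b::{banach, second_countable_topology}"
  assumes "integrable lborel f"
  shows "integrable lborel (\<lambda>x. f (x + c))"
  using integrable_distr_eq[of "(+) c" lborel borel f] assms
  by (simp add: lborel_distr_plus add.commute)

text \<open>All translates of \<open>f\<close> have the same L^1 norm, so by Tonelli the double
  integral is the length of the interval times that norm. This licenses the exchanges of integrals
  below.\<close>

lemma integrable_translates:
  fixes f :: "'a::euclidean_space \<Rightarrow> 'b::{banach, second_countable_topology}"
  assumes f: "integrable lborel f"
  shows "integrable (lborel \<Otimes>\<^sub>M lborel) (\<lambda>(s, x). indicator {0..t::real} s *\<^sub>R f (x + s *\<^sub>R e))"
proof (rule integrableI_bounded)
  have [measurable]: "f \<in> borel_measurable borel" using f by auto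
  show "(\<lambda>(s, x). indicator {0..t::real} s *\<^sub>R f (x + s *\<^sub>R e)) \<in> borel_measurable (lborel \<Otimes>\<^sub>M lborel)"
    by measurable
  have "(\<integral>\<^sup>+p. norm (case p of (s, x) \<Rightarrow> indicator {0..t} s *\<^sub>R f (x + s *\<^sub>R e)) \<partial>(lborel \<Otimes>\<^sub>M lborel))
    = (\<integral>\<^sup>+s. \<integral>\<^sup>+x. norm (indicator {0..t} s *\<^sub>R f (x + s *\<^sub>R e)) \<partial>lborel \<partial>lborel)"
    by (subst lborel.nn_integral_fst[symmetric]) auto
  also have "\<dots> = (\<integral>\<^sup>+s. indicator {0..t} s * (\<integral>\<^sup>+x. norm (f x) \<partial>lborel) \<partial>lborel)"
  proof (rule nn_integral_cong)
    fix s :: real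
    have "(\<integral>\<^sup>+x. norm (indicator {0..t} s *\<^sub>R f (x + s *\<^sub>R e)) \<partial>lborel)
      = (\<integral>\<^sup>+x. indicator {0..t} s * ennreal (norm (f (x + s *\<^sub>R e))) \<partial>lborel)"
      by (intro nn_integral_cong) (auto simp: indicator_def)
    also have "\<dots> = indicator {0..t} s * (\<integral>\<^sup>+x. norm (f (x + s *\<^sub>R e)) \<partial>lborel)"
      by (intro nn_integral_cmult) auto
    also have "(\<integral>\<^sup>+x. norm (f (x + s *\<^sub>R e)) \<partial>lborel) = (\<integral>\<^sup>+x. norm (f x) \<partial>lborel)"
      by (rule nn_integral_lborel_shift) auto
    finally show "(\<integral>\<^sup>+x. norm (indicator {0..t} s *\<^sub>R f (x + s *\<^sub>R e)) \<partial>lborel)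
      = indicator {0..t} s * (\<integral>\<^sup>+x. norm (f x) \<partial>lborel)" .
  qed
  also have "\<dots> = emeasure lborel {0..t} * (\<integral>\<^sup>+x. norm (f x) \<partial>lborel)"
    by (subst nn_integral_multc) auto
  also have "\<dots> < \<infinity>"
    using f by (auto simp: integrable_iff_bounded ennreal_mult_less_top emeasure_lborel_Icc_eq)
  finally show "(\<integral>\<^sup>+p. norm (case p of (s, x) \<Rightarrow> indicator {0..t} s *\<^sub>R f (x + s *\<^sub>R e)) \<partial>(lborel \<Otimes>\<^sub>M lborel)) < \<infinity>" .
qed

lemma integrable_bounded_scaleR:
  fixes f :: "'a \<Rightarrow> 'b::{banach, second_countable_topology}"
  assumes f: "integrable M f" and g: "g \<in> borel_measurable M" "\<And>x. \<bar>g x\<bar> \<le> B"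
  shows "integrable M (\<lambda>x. g x *\<^sub>R f x)"
proof (rule Bochner_Integration.integrable_bound[where f="\<lambda>x. B *\<^sub>R f x"])
  have [measurable]: "f \<in> borel_measurable M" using f by auto
  show "(\<lambda>x. g x *\<^sub>R f x) \<in> borel_measurable M" using g by measurable
  show "AE x in M. norm (g x *\<^sub>R f x) \<le> norm (B *\<^sub>R f x)"
    using g(2) by (intro AE_I2) (auto intro!: mult_right_mono intro: order_trans[OF _ abs_ge_self])
qed (use f in auto)

text \<open>Weak differentiability for Borel representatives: both functions are integrable on the
  whole plane and can be translated freely, while the test functions stay confined to the
  box.\<close>

definition weak_partial_box :: "2 \<Rightarrow> real^2 \<Rightarrow> real^2 \<Rightarrow> (real^2 \<Rightarrow> 'b::euclidean_space) \<Rightarrow> (real^2 \<Rightarrow> 'b) \<Rightarrow> bool" where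
  "weak_partial_box i a b u v \<longleftrightarrow> integrable lborel u \<and> integrable lborel v \<and>
    (\<forall>\<phi>. test_function (box a b) \<phi> \<longrightarrow> (LINT x|lborel. pd i \<phi> x *\<^sub>R u x) = - (LINT x|lborel. \<phi> x *\<^sub>R v x))"

lemma box_segment:
  assumes "x \<in> box a b" "x + t *\<^sub>R axis i 1 \<in> box a b" "0 \<le> s" "s \<le> t"
  shows "x + s *\<^sub>R axis i 1 \<in> (box a b :: (real^2) set)"
proof -
  have "a $ j < x $ j + s * axis i 1 $ j \<and> x $ j + s * axis i 1 $ j < b $ j" for j
  proof (cases "j = i")
    case True
    then have "a $ i < x $ i" "x $ i + t < b $ i" using assms by (auto simp: mem_box_cart axis_def split: if_splits)
    then show ?thesis using assms(3,4) True by simp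
  next
    case False
    then show ?thesis using assms(1) by (simp add: mem_box_cart axis_def)
  qed
  then show ?thesis by (simp add: mem_box_cart)
qed

text \<open>The fundamental theorem for a weak derivative, by duality: both sides are tested against
  \<open>\<phi>\<close>, the derivative is moved onto translates of \<open>\<phi>\<close>, and the
  classical theorem is applied to \<open>\<phi>\<close>.\<close>

lemma weak_partial_box_diff:
  assumes wd: "weak_partial_box i a b u v" and t: "0 \<le> t"
  defines "e \<equiv> axis i 1"
  shows "AE x in lborel. x \<in> box a b \<and> x + t *\<^sub>R e \<in> box a b \<longrightarrow>
    u (x + t *\<^sub>R e) - u x = (LINT s|lborel. indicator {0..t} s *\<^sub>R v (x + s *\<^sub>R e))"
proof -
  have u: "integrable lborel u" and v: "integrable lborel v"
    and test: "\<And>\<phi>. test_function (box a b) \<phi> \<Longrightarrow> (LINT x|lborel. pd i \<phi> x *\<^sub>R u x) = - (LINT x|lborel. \<phi> x *\<^sub>R v x)"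
    using wd by (auto simp: weak_partial_box_def)
  have [measurable]: "u \<in> borel_measurable borel" "v \<in> borel_measurable borel" using u v by auto
  define I where "I = (\<lambda>x. LINT s|lborel. indicator {0..t} s *\<^sub>R v (x + s *\<^sub>R e))"
  have I: "integrable lborel I"
    unfolding I_def using lborel_pair.integrable_snd[OF integrable_translates[OF v, of t e]] by simp
  have ut: "integrable lborel (\<lambda>x. u (x + t *\<^sub>R e))" by (rule integrable_lborel_shift[OF u])
  \<comment> \<open>If a test function is supported in \<open>V\<close>, its translates by
    \<open>s *\<^sub>R e\<close> with s between 0 and t are supported in the box, since the box
    contains the segment between two of its points.\<close>
  define V where "V = box a b \<inter> ((\<lambda>x. x + t *\<^sub>R e) -` box a b)"
  have V: "open V" unfolding V_def
    by (intro open_Int open_box continuous_open_vimage) (auto intro!: continuous_intros)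
  have "AE x in lborel. x \<in> V \<longrightarrow> u (x + t *\<^sub>R e) - u x - I x = 0"
  proof (rule fundamental_lemma_lborel[OF _ V])
    show "integrable lborel (\<lambda>x. u (x + t *\<^sub>R e) - u x - I x)" using ut u I by simp
    fix \<phi> assume \<phi>: "test_function V \<phi>"
    have cont: "continuous_on UNIV \<phi>" "continuous_on UNIV (pd i \<phi>)"
      using test_function_continuous[OF \<phi>] test_function_pd_continuous[OF \<phi>] .
    then have [measurable]: "\<phi> \<in> borel_measurable borel" "pd i \<phi> \<in> borel_measurable borel"
      by (auto intro: borel_measurable_continuous_onI)
    obtain B where B: "\<And>x. \<bar>\<phi> x\<bar> \<le> B" "\<And>x. \<bar>pd i \<phi> x\<bar> \<le> B"
      using test_function_bounded[OF \<phi>] by metis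
    have tst: "(LINT x|lborel. pd i \<phi> (x - s *\<^sub>R e) *\<^sub>R u x) = - (LINT x|lborel. \<phi> x *\<^sub>R v (x + s *\<^sub>R e))"
      if s: "0 \<le> s" "s \<le> t" for s
    proof -
      have "test_function (box a b) (\<lambda>x. \<phi> (x - s *\<^sub>R e))"
        by (rule test_function_translate[OF \<phi>]) (use s in \<open>auto simp: V_def e_def intro: box_segment\<close>)
      from test[OF this] have "(LINT x|lborel. pd i \<phi> (x - s *\<^sub>R e) *\<^sub>R u x) = - (LINT x|lborel. \<phi> (x - s *\<^sub>R e) *\<^sub>R v x)"
        unfolding pd_translate[OF \<phi>] .
      also have "(LINT x|lborel. \<phi> (x - s *\<^sub>R e) *\<^sub>R v x) = (LINT x|lborel. \<phi> x *\<^sub>R v (x + s *\<^sub>R e))"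
        using integral_lborel_shift[of "\<lambda>x. \<phi> (x - s *\<^sub>R e) *\<^sub>R v x" "s *\<^sub>R e"] by simp
      finally show ?thesis .
    qed
    have "(LINT x|lborel. \<phi> x *\<^sub>R I x) = (LINT x|lborel. LINT s|lborel. indicator {0..t} s *\<^sub>R \<phi> x *\<^sub>R v (x + s *\<^sub>R e))"
      unfolding I_def
      by (subst integral_scaleR_right[symmetric], simp, rule Bochner_Integration.integral_cong, simp, rule Bochner_Integration.integral_cong) (auto simp: mult.commute)
    also have "\<dots> = (LINT s|lborel. LINT x|lborel. indicator {0..t} s *\<^sub>R \<phi> x *\<^sub>R v (x + s *\<^sub>R e))"
    proof (rule lborel_pair.Fubini_integral)
      have "integrable (lborel \<Otimes>\<^sub>M lborel) (\<lambda>p. \<phi> (snd p) *\<^sub>R (case p of (s, x) \<Rightarrow> indicator {0..t} s *\<^sub>R v (x + s *\<^sub>R e)))"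
        by (rule integrable_bounded_scaleR[OF integrable_translates[OF v]]) (use B in auto)
      then show "integrable (lborel \<Otimes>\<^sub>M lborel) (\<lambda>(s, x). indicator {0..t} s *\<^sub>R \<phi> x *\<^sub>R v (x + s *\<^sub>R e))"
        by (simp add: case_prod_unfold mult.commute)
    qed
    also have "\<dots> = (LINT s|lborel. indicator {0..t} s *\<^sub>R (LINT x|lborel. \<phi> x *\<^sub>R v (x + s *\<^sub>R e)))"
      by (simp only: integral_scaleR_right)
    also have "\<dots> = (LINT s|lborel. indicator {0..t} s *\<^sub>R - (LINT x|lborel. pd i \<phi> (x - s *\<^sub>R e) *\<^sub>R u x))"
      by (intro Bochner_Integration.integral_cong) (auto simp: tst indicator_def)
    also have "\<dots> = - (LINT s|lborel. LINT x|lborel. indicator {0..t} s *\<^sub>R pd i \<phi> (x - s *\<^sub>R e) *\<^sub>R u x)"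
      by (simp only: integral_scaleR_right scaleR_minus_right integral_minus)
    also have "(LINT s|lborel. LINT x|lborel. indicator {0..t} s *\<^sub>R pd i \<phi> (x - s *\<^sub>R e) *\<^sub>R u x)
      = (LINT x|lborel. LINT s|lborel. indicator {0..t} s *\<^sub>R pd i \<phi> (x - s *\<^sub>R e) *\<^sub>R u x)"
    proof (rule lborel_pair.Fubini_integral[symmetric])
      \<comment> \<open>Translation in the direction 0 makes the same integrability lemma cover the
        untranslated \<open>u\<close>.\<close>
      have "integrable (lborel \<Otimes>\<^sub>M lborel) (\<lambda>p. pd i \<phi> (snd p - fst p *\<^sub>R e) *\<^sub>R (case p of (s, x) \<Rightarrow> indicator {0..t} s *\<^sub>R u (x + s *\<^sub>R 0)))"
        by (rule integrable_bounded_scaleR[OF integrable_translates[OF u]]) (use B in auto)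
      then show "integrable (lborel \<Otimes>\<^sub>M lborel) (\<lambda>(s, x). indicator {0..t} s *\<^sub>R pd i \<phi> (x - s *\<^sub>R e) *\<^sub>R u x)"
        by (simp add: case_prod_unfold mult.commute)
    qed
    also have "\<dots> = (LINT x|lborel. (\<phi> x - \<phi> (x - t *\<^sub>R e)) *\<^sub>R u x)"
    proof (intro Bochner_Integration.integral_cong refl)
      fix x
      have "continuous_on {0..t} (\<lambda>s. pd i \<phi> (x - s *\<^sub>R e))"
        by (rule continuous_on_compose2[OF cont(2)]) (auto intro!: continuous_intros)
      then have "integrable lborel (\<lambda>s. indicator {0..t} s *\<^sub>R pd i \<phi> (x - s *\<^sub>R e))"
        using borel_integrable_atLeastAtMost'[of 0 t "\<lambda>s. pd i \<phi> (x - s *\<^sub>R e)"]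
        by (simp add: set_integrable_def)
      then have "(LINT s|lborel. indicator {0..t} s *\<^sub>R pd i \<phi> (x - s *\<^sub>R e) *\<^sub>R u x)
        = (LINT s|lborel. indicator {0..t} s *\<^sub>R pd i \<phi> (x - s *\<^sub>R e)) *\<^sub>R u x"
        by (subst integral_scaleR_left[symmetric]) (auto simp: scaleR_scaleR)
      then show "(LINT s|lborel. indicator {0..t} s *\<^sub>R pd i \<phi> (x - s *\<^sub>R e) *\<^sub>R u x) = (\<phi> x - \<phi> (x - t *\<^sub>R e)) *\<^sub>R u x"
        using test_function_FTC[OF \<phi> t, of x i] by (simp add: e_def)
    qed
    also have "\<dots> = (LINT x|lborel. \<phi> x *\<^sub>R u x) - (LINT x|lborel. \<phi> (x - t *\<^sub>R e) *\<^sub>R u x)"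
      unfolding scaleR_left_diff_distrib
      by (intro Bochner_Integration.integral_diff integrable_bounded_scaleR[where B=B] u) (use B in auto)
    also have "(LINT x|lborel. \<phi> (x - t *\<^sub>R e) *\<^sub>R u x) = (LINT x|lborel. \<phi> x *\<^sub>R u (x + t *\<^sub>R e))"
      using integral_lborel_shift[of "\<lambda>x. \<phi> (x - t *\<^sub>R e) *\<^sub>R u x" "t *\<^sub>R e"] by simp
    finally have *: "(LINT x|lborel. \<phi> x *\<^sub>R I x) = (LINT x|lborel. \<phi> x *\<^sub>R u (x + t *\<^sub>R e)) - (LINT x|lborel. \<phi> x *\<^sub>R u x)"
      by simp
    have int: "integrable lborel (\<lambda>x. \<phi> x *\<^sub>R f x)" if "integrable lborel f" for f :: "_ \<Rightarrow> 'a"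
      by (rule integrable_bounded_scaleR[where B=B]) (use B that in auto)
    show "(LINT x|lborel. \<phi> x *\<^sub>R (u (x + t *\<^sub>R e) - u x - I x)) = 0"
      using int[OF u] int[OF ut] int[OF I] * by (simp add: scaleR_diff_right)
  qed
  then show ?thesis
    by eventually_elim (auto simp: V_def I_def)
qed

lemma nn_integral_Cauchy_Schwarz_set:
  assumes [measurable]: "f \<in> borel_measurable M" "S \<in> sets M"
  shows "(\<integral>\<^sup>+x. indicator S x * f x \<partial>M)\<^sup>2 \<le> emeasure M S * (\<integral>\<^sup>+x. indicator S x * (f x)\<^sup>2 \<partial>M)"
proof -
  have "(\<integral>\<^sup>+x. indicator S x * f x \<partial>M) = (\<integral>\<^sup>+x. indicator S x * (indicator S x * f x) \<partial>M)"
    by (intro nn_integral_cong) (auto simp: indicator_def)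
  also have "\<dots>\<^sup>2 \<le> (\<integral>\<^sup>+x. (indicator S x)\<^sup>2 \<partial>M) * (\<integral>\<^sup>+x. (indicator S x * f x)\<^sup>2 \<partial>M)"
    by (rule Cauchy_Schwarz_nn_integral) auto
  also have "(\<integral>\<^sup>+x. (indicator S x)\<^sup>2 \<partial>M) = (\<integral>\<^sup>+x. indicator S x \<partial>M)"
    by (intro nn_integral_cong) (auto simp: indicator_def)
  also have "(\<integral>\<^sup>+x. (indicator S x * f x)\<^sup>2 \<partial>M) = (\<integral>\<^sup>+x. indicator S x * (f x)\<^sup>2 \<partial>M)"
    by (intro nn_integral_cong) (auto simp: indicator_def)
  finally show ?thesis by simp
qed

lemma norm_set_integral_square_le:
  fixes f :: "'a \<Rightarrow> 'b::{banach, second_countable_topology}"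
  assumes [measurable]: "f \<in> borel_measurable M" "S \<in> sets M"
  shows "sqnorm (LINT x|M. indicator S x *\<^sub>R f x) \<le> 
    emeasure M S * (\<integral>\<^sup>+x. indicator S x * sqnorm (f x) \<partial>M)"
proof -
  have "ennreal (norm (LINT x|M. indicator S x *\<^sub>R f x)) \<le> (\<integral>\<^sup>+x. indicator S x * ennreal (norm (f x)) \<partial>M)"
  proof (cases "integrable M (\<lambda>x. indicator S x *\<^sub>R f x)")
    case True
    have "ennreal (norm (LINT x|M. indicator S x *\<^sub>R f x)) \<le> (\<integral>\<^sup>+x. norm (indicator S x *\<^sub>R f x) \<partial>M)"
      by (rule integral_norm_bound_ennreal[OF True])
    also have "\<dots> = (\<integral>\<^sup>+x. indicator S x * ennreal (norm (f x)) \<partial>M)"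
      by (intro nn_integral_cong) (auto simp: indicator_def)
    finally show ?thesis .
  \<comment> \<open>A Bochner integral that does not exist is 0 by convention, so the bound is
    trivial.\<close>
  qed (simp add: not_integrable_integral_eq)
  then have "(ennreal (norm (LINT x|M. indicator S x *\<^sub>R f x)))\<^sup>2 \<le> (\<integral>\<^sup>+x. indicator S x * ennreal (norm (f x)) \<partial>M)\<^sup>2"
    by (intro power_mono) auto
  also have "\<dots> \<le> emeasure M S * (\<integral>\<^sup>+x. indicator S x * (ennreal (norm (f x)))\<^sup>2 \<partial>M)"
    by (rule nn_integral_Cauchy_Schwarz_set) auto
  finally show ?thesis by (simp add: ennreal_power)
qed

text \<open>Cauchy-Schwarz on the segment of length \<open>t\<close> gives one factor
  \<open>t\<close>; integrating over the shift \<open>s\<close> gives the other.\<close>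

lemma weak_partial_box_diff_L2_nonneg:
  assumes wd: "weak_partial_box i a b u v" and t: "0 \<le> t"
  defines "e \<equiv> axis i 1" and "Q \<equiv> box a b"
  shows "(\<integral>\<^sup>+x. indicator Q x * indicator Q (x + t *\<^sub>R e) * sqnorm (u (x + t *\<^sub>R e) - u x) \<partial>lborel)
    \<le> ennreal (t\<^sup>2) * (\<integral>\<^sup>+x. indicator Q x * sqnorm (v x) \<partial>lborel)"
proof -
  have [measurable]: "u \<in> borel_measurable borel" "v \<in> borel_measurable borel" "Q \<in> sets borel"
    using wd by (auto simp: weak_partial_box_def Q_def)
  let ?G = "\<integral>\<^sup>+x. indicator Q x * sqnorm (v x) \<partial>lborel"
  have "(\<integral>\<^sup>+x. indicator Q x * indicator Q (x + t *\<^sub>R e) * sqnorm (u (x + t *\<^sub>R e) - u x) \<partial>lborel)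
    \<le> (\<integral>\<^sup>+x. ennreal t * (\<integral>\<^sup>+s. indicator {0..t} s * (indicator Q (x + s *\<^sub>R e) * sqnorm (v (x + s *\<^sub>R e))) \<partial>lborel) \<partial>lborel)"
  proof (rule nn_integral_mono_AE)
    show "AE x in lborel. indicator Q x * indicator Q (x + t *\<^sub>R e) * sqnorm (u (x + t *\<^sub>R e) - u x)
      \<le> ennreal t * (\<integral>\<^sup>+s. indicator {0..t} s * (indicator Q (x + s *\<^sub>R e) * sqnorm (v (x + s *\<^sub>R e))) \<partial>lborel)"
      using weak_partial_box_diff[OF wd t]
    proof eventually_elim
      case (elim x)
      show ?case
      proof (cases "x \<in> Q \<and> x + t *\<^sub>R e \<in> Q")
        case True
        then have "sqnorm (u (x + t *\<^sub>R e) - u x) = sqnorm (LINT s|lborel. indicator {0..t} s *\<^sub>R v (x + s *\<^sub>R e))"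
          using elim by (simp add: Q_def e_def)
        also have "\<dots> \<le> emeasure lborel {0..t} * (\<integral>\<^sup>+s. indicator {0..t} s * sqnorm (v (x + s *\<^sub>R e)) \<partial>lborel)"
          by (rule norm_set_integral_square_le) auto
        also have "emeasure lborel {0..t} = ennreal t" using t by simp
        \<comment> \<open>The segment stays in the box by convexity. Recording this as an indicator
          turns each translated integral below into the integral over the box itself.\<close>
        also have "(\<integral>\<^sup>+s. indicator {0..t} s * sqnorm (v (x + s *\<^sub>R e)) \<partial>lborel)
          = (\<integral>\<^sup>+s. indicator {0..t} s * (indicator Q (x + s *\<^sub>R e) * sqnorm (v (x + s *\<^sub>R e))) \<partial>lborel)"
          using True by (intro nn_integral_cong) (auto simp: indicator_def Q_def e_def dest: box_segment)
        finally show ?thesis using True by simp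
      qed (auto simp: indicator_def)
    qed
  qed
  also have "\<dots> = ennreal t * (\<integral>\<^sup>+x. \<integral>\<^sup>+s. indicator {0..t} s * (indicator Q (x + s *\<^sub>R e) * sqnorm (v (x + s *\<^sub>R e))) \<partial>lborel \<partial>lborel)"
    by (rule nn_integral_cmult) measurable
  also have "(\<integral>\<^sup>+x. \<integral>\<^sup>+s. indicator {0..t} s * (indicator Q (x + s *\<^sub>R e) * sqnorm (v (x + s *\<^sub>R e))) \<partial>lborel \<partial>lborel)
    = (\<integral>\<^sup>+s. \<integral>\<^sup>+x. indicator {0..t} s * (indicator Q (x + s *\<^sub>R e) * sqnorm (v (x + s *\<^sub>R e))) \<partial>lborel \<partial>lborel)"
    by (rule lborel_pair.Fubini') measurable
  also have "\<dots> = (\<integral>\<^sup>+s. indicator {0..t} s * ?G \<partial>lborel)"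
  proof (rule nn_integral_cong)
    fix s :: real
    have "(\<integral>\<^sup>+x. indicator {0..t} s * (indicator Q (x + s *\<^sub>R e) * sqnorm (v (x + s *\<^sub>R e))) \<partial>lborel)
      = indicator {0..t} s * (\<integral>\<^sup>+x. indicator Q (x + s *\<^sub>R e) * sqnorm (v (x + s *\<^sub>R e)) \<partial>lborel)"
      by (rule nn_integral_cmult) auto
    also have "(\<integral>\<^sup>+x. indicator Q (x + s *\<^sub>R e) * sqnorm (v (x + s *\<^sub>R e)) \<partial>lborel) = ?G"
      by (rule nn_integral_lborel_shift) auto
    finally show "(\<integral>\<^sup>+x. indicator {0..t} s * (indicator Q (x + s *\<^sub>R e) * sqnorm (v (x + s *\<^sub>R e))) \<partial>lborel)
      = indicator {0..t} s * ?G" .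
  qed
  also have "\<dots> = ennreal t * ?G" using t by (subst nn_integral_multc) auto
  finally show ?thesis using t by (simp add: power2_eq_square ennreal_mult mult.assoc)
qed

text \<open>For negative \<open>t\<close>, moving \<open>x\<close> by
  \<open>- (t *\<^sub>R e)\<close> exchanges the two endpoints and reverses the sign of
  \<open>t\<close>.\<close>

lemma weak_partial_box_diff_L2:
  assumes wd: "weak_partial_box i a b u v"
  defines "e \<equiv> axis i 1" and "Q \<equiv> box a b"
  shows "(\<integral>\<^sup>+x. indicator Q x * indicator Q (x + t *\<^sub>R e) * sqnorm (u (x + t *\<^sub>R e) - u x) \<partial>lborel)
    \<le> ennreal (t\<^sup>2) * (\<integral>\<^sup>+x. indicator Q x * sqnorm (v x) \<partial>lborel)"
proof (cases "0 \<le> t")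
  case True
  then show ?thesis using weak_partial_box_diff_L2_nonneg[OF wd] by (simp add: e_def Q_def)
next
  case False
  have [measurable]: "u \<in> borel_measurable borel" "Q \<in> sets borel"
    using wd by (auto simp: weak_partial_box_def Q_def)
  let ?f = "\<lambda>x. indicator Q x * indicator Q (x + t *\<^sub>R e) * sqnorm (u (x + t *\<^sub>R e) - u x)"
  have "(\<integral>\<^sup>+x. ?f x \<partial>lborel) = (\<integral>\<^sup>+x. ?f (x + - (t *\<^sub>R e)) \<partial>lborel)"
    by (rule nn_integral_lborel_shift[symmetric]) measurable
  also have "\<dots> = (\<integral>\<^sup>+x. indicator Q x * indicator Q (x + (-t) *\<^sub>R e) * sqnorm (u (x + (-t) *\<^sub>R e) - u x) \<partial>lborel)"
    by (intro nn_integral_cong) (simp add: norm_minus_commute mult.commute)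
  also have "\<dots> \<le> ennreal ((-t)\<^sup>2) * (\<integral>\<^sup>+x. indicator Q x * sqnorm (v x) \<partial>lborel)"
    unfolding e_def Q_def by (rule weak_partial_box_diff_L2_nonneg[OF wd]) (use False in auto)
  finally show ?thesis by simp
qed

lemma vec2_decomp: "(z :: real^2) = z $ 1 *\<^sub>R axis 1 1 + z $ 2 *\<^sub>R axis 2 1"
  by (simp add: vec_eq_iff forall_2 axis_def)

lemma norm_add_square_le: "(norm (p + q))\<^sup>2 \<le> 2 * (norm p)\<^sup>2 + 2 * (norm (q::'a::real_normed_vector))\<^sup>2"
proof -
  have "(norm (p + q))\<^sup>2 \<le> (norm p + norm q)\<^sup>2" by (intro power_mono norm_triangle_ineq) auto
  also have "\<dots> \<le> 2 * (norm p)\<^sup>2 + 2 * (norm q)\<^sup>2"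
    using sum_squares_bound[of "norm p" "norm q"] by (simp add: power2_sum)
  finally show ?thesis .
qed

text \<open>The displacement is made in two steps parallel to the axes. The square of a sum costs
  the factor 2, each step the factor h^2.\<close>

lemma weak_gradient_box_diff_L2:
  fixes u :: "real^2 \<Rightarrow> 'b::euclidean_space"
  assumes wd: "\<And>i. weak_partial_box i a b u (v i)" and h: "\<And>i. \<bar>z $ i\<bar> \<le> h"
  defines "Q \<equiv> box a b"
  shows "(\<integral>\<^sup>+x. indicator Q x * indicator Q (x + z) * sqnorm (u (x + z) - u x) \<partial>lborel)
    \<le> ennreal (2 * h\<^sup>2) * (\<Sum>i\<in>UNIV. \<integral>\<^sup>+x. indicator Q x * sqnorm (v i x) \<partial>lborel)"
proof -
  have [measurable]: "u \<in> borel_measurable borel" "v i \<in> borel_measurable borel" "Q \<in> sets borel" for i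
    using wd[of i] by (auto simp: weak_partial_box_def Q_def)
  define e1 e2 :: "real^2" where "e1 = axis 1 1" "e2 = axis 2 1"
  let ?G = "\<lambda>i. \<integral>\<^sup>+x. indicator Q x * sqnorm (v i x) \<partial>lborel"
  let ?D = "\<lambda>s e x. indicator Q x * indicator Q (x + s *\<^sub>R e) * sqnorm (u (x + s *\<^sub>R e) - u x)"
  have h0: "0 \<le> h" using h[of 1] by linarith
  have z: "x + z = (x + z $ 1 *\<^sub>R e1) + z $ 2 *\<^sub>R e2" for x
    using vec2_decomp[of z] by (simp add: e1_e2_def)
  \<comment> \<open>The corner of the path takes one coordinate from each endpoint, and a box is a
    product.\<close>
  have mid: "x + z $ 1 *\<^sub>R e1 \<in> Q" if "x \<in> Q" "x + z \<in> Q" for x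
    using that by (auto simp: Q_def mem_box_cart forall_2 e1_e2_def axis_def)
  have "(\<integral>\<^sup>+x. indicator Q x * indicator Q (x + z) * sqnorm (u (x + z) - u x) \<partial>lborel)
    \<le> (\<integral>\<^sup>+x. ennreal 2 * ?D (z $ 2) e2 (x + z $ 1 *\<^sub>R e1) + ennreal 2 * ?D (z $ 1) e1 x \<partial>lborel)"
  proof (rule nn_integral_mono)
    fix x
    show "indicator Q x * indicator Q (x + z) * sqnorm (u (x + z) - u x)
      \<le> ennreal 2 * ?D (z $ 2) e2 (x + z $ 1 *\<^sub>R e1) + ennreal 2 * ?D (z $ 1) e1 x"
    proof (cases "x \<in> Q \<and> x + z \<in> Q")
      case True
      let ?p = "u (x + z) - u (x + z $ 1 *\<^sub>R e1)" and ?q = "u (x + z $ 1 *\<^sub>R e1) - u x"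
      have "sqnorm (u (x + z) - u x) \<le> ennreal (2 * (norm ?p)\<^sup>2 + 2 * (norm ?q)\<^sup>2)"
        using norm_add_square_le[of ?p ?q] by (intro ennreal_leI) simp
      also have "\<dots> = ennreal 2 * ennreal ((norm ?p)\<^sup>2) + ennreal 2 * ennreal ((norm ?q)\<^sup>2)"
        by (simp add: ennreal_mult)
      finally show ?thesis using True mid[of x] by (simp add: z[symmetric])
    qed (auto simp: indicator_def)
  qed
  also have "\<dots> = ennreal 2 * (\<integral>\<^sup>+x. ?D (z $ 2) e2 (x + z $ 1 *\<^sub>R e1) \<partial>lborel) + ennreal 2 * (\<integral>\<^sup>+x. ?D (z $ 1) e1 x \<partial>lborel)"
    by (subst nn_integral_add) (auto simp: nn_integral_cmult)
  also have "(\<integral>\<^sup>+x. ?D (z $ 2) e2 (x + z $ 1 *\<^sub>R e1) \<partial>lborel) = (\<integral>\<^sup>+x. ?D (z $ 2) e2 x \<partial>lborel)"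
    by (rule nn_integral_lborel_shift) measurable
  also have "ennreal 2 * (\<integral>\<^sup>+x. ?D (z $ 2) e2 x \<partial>lborel) + ennreal 2 * (\<integral>\<^sup>+x. ?D (z $ 1) e1 x \<partial>lborel)
    \<le> ennreal 2 * (ennreal ((z $ 2)\<^sup>2) * ?G 2) + ennreal 2 * (ennreal ((z $ 1)\<^sup>2) * ?G 1)"
    unfolding e1_e2_def Q_def by (intro add_mono mult_left_mono weak_partial_box_diff_L2 wd) auto
  also have "\<dots> \<le> ennreal 2 * (ennreal (h\<^sup>2) * ?G 2) + ennreal 2 * (ennreal (h\<^sup>2) * ?G 1)"
    using h by (intro add_mono mult_left_mono mult_right_mono ennreal_leI) (auto simp: abs_le_square_iff[symmetric] h0)
  also have "\<dots> = ennreal (2 * h\<^sup>2) * (\<Sum>i\<in>UNIV. ?G i)"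
    by (simp add: UNIV_2 ennreal_mult distrib_left mult.assoc)
  finally show ?thesis .
qed

text \<open>By Cauchy-Schwarz the squared deviation from the average over \<open>S x\<close> is at
  most 1/m times the integral of the squared differences. With y = x + z, all z lie in a square of
  area 4 h^2 and each contributes at most 2 h^2 times the gradient term, whence 8 h^4 / m. A
  constant \<open>S\<close> yields Poincare, grid cells yield Rellich.\<close>

lemma weak_gradient_box_average:
  fixes u :: "real^2 \<Rightarrow> 'b::euclidean_space"
  assumes wd: "\<And>i. weak_partial_box i a b u (v i)"
    and S[measurable]: "Measurable.pred (borel \<Otimes>\<^sub>M borel) (\<lambda>p. snd p \<in> S (fst p))"
    and P[measurable]: "P \<in> sets borel" and PQ: "P \<subseteq> box a b"
    and SQ: "\<And>x. x \<in> P \<Longrightarrow> S x \<subseteq> box a b"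
    and m: "\<And>x. x \<in> P \<Longrightarrow> emeasure lborel (S x) = ennreal m" "m > 0"
    and h: "\<And>x y i. x \<in> P \<Longrightarrow> y \<in> S x \<Longrightarrow> \<bar>y $ i - x $ i\<bar> \<le> h" "0 \<le> h"
  shows "(\<integral>\<^sup>+x. indicator P x * sqnorm (u x - (1/m) *\<^sub>R (LINT y|lborel. indicator (S x) y *\<^sub>R u y)) \<partial>lborel)
    \<le> ennreal (8 * h^4 / m) * (\<Sum>i\<in>UNIV. \<integral>\<^sup>+x. indicator (box a b) x * sqnorm (v i x) \<partial>lborel)"
proof -
  let ?Q = "box a b"
  have u: "integrable lborel u" using wd by (auto simp: weak_partial_box_def)
  then have [measurable]: "u \<in> borel_measurable borel" by auto
  have Sx[measurable]: "S x \<in> sets borel" for x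
  proof -
    have "(\<lambda>y. (x, y)) \<in> borel \<rightarrow>\<^sub>M borel \<Otimes>\<^sub>M borel" by simp
    from measurable_compose[OF this S] have "Measurable.pred borel (\<lambda>y. y \<in> S x)" by simp
    then show ?thesis by (simp add: pred_def)
  qed
  define Z :: "(real^2) set" where "Z = cbox (\<chi> i. - h) (\<chi> i. h)"
  have [measurable]: "Z \<in> sets borel" by (simp add: Z_def)
  let ?G = "\<Sum>i\<in>UNIV. \<integral>\<^sup>+x. indicator (box a b) x * sqnorm (v i x) \<partial>lborel"
  let ?K = "\<lambda>x z. indicator ?Q x * indicator ?Q (x + z) * sqnorm (u (x + z) - u x)"
  have "(\<integral>\<^sup>+x. indicator P x * sqnorm (u x - (1/m) *\<^sub>R (LINT y|lborel. indicator (S x) y *\<^sub>R u y)) \<partial>lborel)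
    \<le> (\<integral>\<^sup>+x. ennreal (1/m) * (\<integral>\<^sup>+z. indicator Z z * ?K x z \<partial>lborel) \<partial>lborel)"
  proof (rule nn_integral_mono)
    fix x
    show "indicator P x * sqnorm (u x - (1/m) *\<^sub>R (LINT y|lborel. indicator (S x) y *\<^sub>R u y))
      \<le> ennreal (1/m) * (\<integral>\<^sup>+z. indicator Z z * ?K x z \<partial>lborel)"
    proof (cases "x \<in> P")
      case x: True
      have "integrable lborel (\<lambda>y. indicator (S x) y *\<^sub>R u x)"
        using m(1)[OF x] by (intro integrable_scaleR_left integrable_real_indicator) auto
      moreover have "integrable lborel (\<lambda>y. indicator (S x) y *\<^sub>R u y)"
        by (intro integrable_mult_indicator u) auto
      ultimately have "(LINT y|lborel. indicator (S x) y *\<^sub>R (u y - u x)) = (LINT y|lborel. indicator (S x) y *\<^sub>R u y) - m *\<^sub>R u x"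
        using m(1)[OF x] m(2) by (simp add: scaleR_diff_right measure_def)
      then have "u x - (1/m) *\<^sub>R (LINT y|lborel. indicator (S x) y *\<^sub>R u y) = - ((1/m) *\<^sub>R (LINT y|lborel. indicator (S x) y *\<^sub>R (u y - u x)))"
        using m(2) by (simp add: scaleR_diff_right)
      then have "sqnorm (u x - (1/m) *\<^sub>R (LINT y|lborel. indicator (S x) y *\<^sub>R u y))
        = ennreal ((1/m)\<^sup>2) * sqnorm (LINT y|lborel. indicator (S x) y *\<^sub>R (u y - u x))"
        by (simp add: ennreal_mult[symmetric] power_mult_distrib[symmetric] power_divide)
      also have "\<dots> \<le> ennreal ((1/m)\<^sup>2) * (emeasure lborel (S x) * (\<integral>\<^sup>+y. indicator (S x) y * sqnorm (u y - u x) \<partial>lborel))"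
        by (intro mult_left_mono norm_set_integral_square_le) auto
      also have "\<dots> = ennreal (1/m) * (\<integral>\<^sup>+y. indicator (S x) y * sqnorm (u y - u x) \<partial>lborel)"
        using m(1)[OF x] m(2) by (simp add: mult.assoc[symmetric] ennreal_mult[symmetric] power2_eq_square)
      also have "(\<integral>\<^sup>+y. indicator (S x) y * sqnorm (u y - u x) \<partial>lborel)
        = (\<integral>\<^sup>+z. indicator (S x) (z + x) * sqnorm (u (z + x) - u x) \<partial>lborel)"
        by (rule nn_integral_lborel_shift[symmetric]) measurable
      also have "\<dots> \<le> (\<integral>\<^sup>+z. indicator Z z * ?K x z \<partial>lborel)"
      proof (rule nn_integral_mono)
        fix z
        show "indicator (S x) (z + x) * sqnorm (u (z + x) - u x) \<le> indicator Z z * ?K x z"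
        proof (cases "z + x \<in> S x")
          case True
          have "\<bar>z $ i\<bar> \<le> h" for i using h(1)[OF x True, of i] by simp
          then have "- h \<le> z $ i \<and> z $ i \<le> h" for i by (simp add: abs_le_iff minus_le_iff)
          then have "z \<in> Z" by (auto simp: Z_def mem_box_cart)
          moreover have "x + z \<in> ?Q" using SQ[OF x] True by (auto simp: add.commute)
          moreover have "x \<in> ?Q" using PQ x by blast
          ultimately show ?thesis by (simp add: indicator_def add.commute)
        qed (simp add: indicator_def)
      qed
      finally show ?thesis using x by (simp add: mult_left_mono)
    qed (simp add: indicator_def)
  qed
  also have "\<dots> = ennreal (1/m) * (\<integral>\<^sup>+x. \<integral>\<^sup>+z. indicator Z z * ?K x z \<partial>lborel \<partial>lborel)"
    by (rule nn_integral_cmult) measurable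
  also have "(\<integral>\<^sup>+x. \<integral>\<^sup>+z. indicator Z z * ?K x z \<partial>lborel \<partial>lborel) = (\<integral>\<^sup>+z. \<integral>\<^sup>+x. indicator Z z * ?K x z \<partial>lborel \<partial>lborel)"
    by (rule lborel_pair.Fubini') measurable
  also have "\<dots> \<le> (\<integral>\<^sup>+z. indicator Z z * (ennreal (2 * h\<^sup>2) * ?G) \<partial>lborel)"
  proof (rule nn_integral_mono)
    fix z
    have "(\<integral>\<^sup>+x. indicator Z z * ?K x z \<partial>lborel) = indicator Z z * (\<integral>\<^sup>+x. ?K x z \<partial>lborel)"
      by (rule nn_integral_cmult) measurable
    also have "\<dots> \<le> indicator Z z * (ennreal (2 * h\<^sup>2) * ?G)"
    proof (cases "z \<in> Z")
      case True
      then have "\<bar>z $ i\<bar> \<le> h" for i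
        unfolding Z_def mem_box_cart by (metis abs_le_iff minus_le_iff vec_lambda_beta)
      then show ?thesis by (intro mult_left_mono weak_gradient_box_diff_L2 wd) auto
    qed simp
    finally show "(\<integral>\<^sup>+x. indicator Z z * ?K x z \<partial>lborel) \<le> indicator Z z * (ennreal (2 * h\<^sup>2) * ?G)" .
  qed
  also have "\<dots> = emeasure lborel Z * (ennreal (2 * h\<^sup>2) * ?G)"
    by (subst nn_integral_multc) auto
  also have "emeasure lborel Z = ennreal (4 * h\<^sup>2)"
  proof -
    have "measure lborel Z = (2 * h)\<^sup>2"
      using h(2) unfolding Z_def by (subst content_cbox_cart) (auto simp: interval_eq_empty_cart not_less UNIV_2 power2_eq_square)
    moreover have "emeasure lborel Z = ennreal (measure lborel Z)"
      unfolding Z_def using emeasure_eq_ennreal_measure emeasure_lborel_cbox_finite by (metis infinity_ennreal_def less_top)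
    ultimately show ?thesis by (simp add: power_mult_distrib)
  qed
  finally show ?thesis using h(2) m(2)
    by (simp add: mult_left_mono mult.assoc[symmetric] ennreal_mult[symmetric] power2_eq_square power4_eq_xxxx)
qed

section \<open>Sequences in $L^2$\<close>

lemma ex_strict_mono_ge:
  fixes N :: "nat \<Rightarrow> nat"
  obtains s :: "nat \<Rightarrow> nat" where "strict_mono s" "\<And>k. N k \<le> s k"
proof (rule that)
  show "strict_mono (\<lambda>k. \<Sum>j\<le>k. Suc (N j))" by (rule strict_monoI_Suc) auto
  show "N k \<le> (\<Sum>j\<le>k. Suc (N j))" for k
    by (cases k) auto
qed

definition L2sq :: "'a measure \<Rightarrow> ('a \<Rightarrow> 'b::real_normed_vector) \<Rightarrow> ennreal" where
  "L2sq M f = (\<integral>\<^sup>+x. sqnorm (f x) \<partial>M)"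

lemma L2sq_add_le:
  fixes f g :: "'a \<Rightarrow> 'b::{banach, second_countable_topology}"
  assumes [measurable]: "f \<in> borel_measurable M" "g \<in> borel_measurable M"
  shows "L2sq M (\<lambda>x. f x + g x) \<le> 2 * L2sq M f + 2 * L2sq M g"
proof -
  have "L2sq M (\<lambda>x. f x + g x) \<le> (\<integral>\<^sup>+x. 2 * sqnorm (f x) + 2 * sqnorm (g x) \<partial>M)"
    unfolding L2sq_def
  proof (rule nn_integral_mono)
    fix x
    have "sqnorm (f x + g x) \<le> ennreal (2 * (norm (f x))\<^sup>2 + 2 * (norm (g x))\<^sup>2)"
      by (intro ennreal_leI norm_add_square_le)
    then show "sqnorm (f x + g x) \<le> 2 * sqnorm (f x) + 2 * sqnorm (g x)"
      by (simp add: ennreal_mult)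
  qed
  also have "\<dots> = 2 * L2sq M f + 2 * L2sq M g"
    unfolding L2sq_def by (subst nn_integral_add) (auto simp: nn_integral_cmult)
  finally show ?thesis .
qed

lemma L2sq_Fatou:
  fixes f :: "nat \<Rightarrow> 'a \<Rightarrow> 'b::{banach, second_countable_topology}"
  assumes [measurable]: "\<And>n. f n \<in> borel_measurable M" "g \<in> borel_measurable M"
    and lim: "AE x in M. (\<lambda>n. f n x) \<longlonglongrightarrow> g x" and bnd: "\<And>n. n \<ge> N \<Longrightarrow> L2sq M (f n) \<le> C"
  shows "L2sq M g \<le> C"
proof -
  have "L2sq M g = (\<integral>\<^sup>+x. liminf (\<lambda>n. sqnorm (f n x)) \<partial>M)"
    unfolding L2sq_def
  proof (rule nn_integral_cong_AE)
    show "AE x in M. sqnorm (g x) = liminf (\<lambda>n. sqnorm (f n x))"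
      using lim
    proof eventually_elim
      case (elim x)
      then have "(\<lambda>n. sqnorm (f n x)) \<longlonglongrightarrow> sqnorm (g x)"
        by (intro tendsto_intros)
      then show ?case by (intro lim_imp_Liminf[symmetric]) auto
    qed
  qed
  also have "\<dots> \<le> liminf (\<lambda>n. L2sq M (f n))"
    unfolding L2sq_def by (rule nn_integral_liminf) measurable
  also have "\<dots> \<le> C"
    using bnd by (intro Liminf_le) (auto simp: eventually_sequentially)
  finally show ?thesis .
qed

text \<open>Riesz-Fischer, for an arbitrary measure because a weighted one occurs later. The almost
  everywhere convergent subsequence from its proof is kept for use in Rellich's theorem.\<close>

lemma L2_Cauchy_limit:
  fixes g :: "nat \<Rightarrow> 'a \<Rightarrow> 'b::{banach, second_countable_topology}"
  assumes g[measurable]: "\<And>n. g n \<in> borel_measurable M"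
    and Cauchy: "\<And>e. e > 0 \<Longrightarrow> \<exists>N. \<forall>m\<ge>N. \<forall>n\<ge>N. L2sq M (\<lambda>x. g m x - g n x) \<le> ennreal e"
  obtains s w where "strict_mono s" "w \<in> borel_measurable M" "AE x in M. (\<lambda>n. g (s n) x) \<longlonglongrightarrow> w x"
    "(\<lambda>n. L2sq M (\<lambda>x. g n x - w x)) \<longlonglongrightarrow> 0"
proof -
  \<comment> \<open>Squared norms at most 16^(-k) stay summable under the weight 4^k. Pointwise this
    leaves squared increments of order 4^(-k), hence increments of order 2^(-k).\<close>
  have "\<exists>N. \<forall>m\<ge>N. \<forall>n\<ge>N. L2sq M (\<lambda>x. g m x - g n x) \<le> ennreal ((1/16)^k)" for k :: nat
    by (rule Cauchy) simp
  then obtain N where N: "\<And>k m n. m \<ge> N k \<Longrightarrow> n \<ge> N k \<Longrightarrow> L2sq M (\<lambda>x. g m x - g n x) \<le> ennreal ((1/16)^k)"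
    by metis
  obtain s where s: "strict_mono s" "\<And>k. N k \<le> s k" using ex_strict_mono_ge[of N] by blast
  define d where "d k x = (norm (g (s (Suc k)) x - g (s k) x))\<^sup>2" for k x
  have [measurable]: "d k \<in> borel_measurable M" for k unfolding d_def by measurable
  have d: "(\<integral>\<^sup>+x. ennreal (d k x) \<partial>M) \<le> ennreal ((1/16)^k)" for k
    using N[of k "s (Suc k)" "s k"] unfolding d_def L2sq_def using s(2)[of k] strict_monoD[OF s(1), of k "Suc k"] by auto
  have "(\<integral>\<^sup>+x. (\<Sum>k. ennreal (4^k) * ennreal (d k x)) \<partial>M) = (\<Sum>k. ennreal (4^k) * (\<integral>\<^sup>+x. ennreal (d k x) \<partial>M))"
    by (simp add: nn_integral_suminf nn_integral_cmult)
  also have "\<dots> \<le> (\<Sum>k. ennreal ((1/4)^k))"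
  proof (intro suminf_le)
    fix k :: nat
    have "ennreal (4^k) * (\<integral>\<^sup>+x. ennreal (d k x) \<partial>M) \<le> ennreal (4^k) * ennreal ((1/16)^k)"
      by (intro mult_left_mono d) auto
    also have "\<dots> = ennreal ((1/4)^k)"
      by (simp add: ennreal_mult[symmetric] power_mult_distrib[symmetric])
    finally show "ennreal (4^k) * (\<integral>\<^sup>+x. ennreal (d k x) \<partial>M) \<le> ennreal ((1/4)^k)" .
  qed auto
  also have "\<dots> = ennreal (\<Sum>k. (1/4)^k)"
    by (intro suminf_ennreal2) (auto intro: summable_geometric)
  finally have "(\<integral>\<^sup>+x. (\<Sum>k. ennreal (4^k) * ennreal (d k x)) \<partial>M) \<noteq> \<infinity>"
    by (auto simp: top_unique)
  then have "AE x in M. (\<Sum>k. ennreal (4^k) * ennreal (d k x)) \<noteq> \<infinity>"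
    by (intro nn_integral_PInf_AE) auto
  then have conv: "AE x in M. convergent (\<lambda>n. g (s n) x)"
  proof eventually_elim
    case (elim x)
    then obtain C where C: "(\<Sum>k. ennreal (4^k) * ennreal (d k x)) = ennreal C" "C \<ge> 0"
      by (metis ennreal_cases infinity_ennreal_def)
    have "norm (g (s (Suc k)) x - g (s k) x) \<le> sqrt C * (1/2)^k" for k
    proof -
      have "ennreal (4^k) * ennreal (d k x) \<le> ennreal C"
        unfolding C(1)[symmetric] using sum_le_suminf[of "\<lambda>k. ennreal (4^k) * ennreal (d k x)" "{k}"] by simp
      then have "4^k * d k x \<le> C" using C(2) by (simp add: ennreal_mult[symmetric] d_def)
      then have "sqrt (4^k * d k x) \<le> sqrt C" by (rule real_sqrt_le_mono)
      moreover have "sqrt (4^k * d k x) = 2^k * norm (g (s (Suc k)) x - g (s k) x)"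
        by (simp add: d_def real_sqrt_mult real_sqrt_power)
      ultimately have "2^k * norm (g (s (Suc k)) x - g (s k) x) \<le> sqrt C" by simp
      then show ?thesis by (simp add: field_simps power_divide)
    qed
    then have "summable (\<lambda>k. g (s (Suc k)) x - g (s k) x)"
      by (intro summable_comparison_test[OF _ summable_mult[OF summable_geometric[of "1/2::real"]]]) auto
    then have "convergent (\<lambda>n. g (s n) x - g (s 0) x)"
      unfolding summable_iff_convergent sum_lessThan_telescope[of "\<lambda>n. g (s n) x"] .
    then have "convergent (\<lambda>n. (g (s n) x - g (s 0) x) + g (s 0) x)"
      by (intro convergent_add convergent_const)
    then show ?case by simp
  qed
  define w where "w x = lim (\<lambda>n. g (s n) x)" for x
  have w[measurable]: "w \<in> borel_measurable M" unfolding w_def by measurable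
  have lim: "AE x in M. (\<lambda>n. g (s n) x) \<longlonglongrightarrow> w x"
    using conv by eventually_elim (simp add: w_def convergent_LIMSEQ_iff)
  have "(\<lambda>n. L2sq M (\<lambda>x. g n x - w x)) \<longlonglongrightarrow> 0"
  proof (rule tendsto_zero_ennreal)
    fix r :: real assume r: "0 < r"
    then obtain N where N: "\<And>m n. m \<ge> N \<Longrightarrow> n \<ge> N \<Longrightarrow> L2sq M (\<lambda>x. g m x - g n x) \<le> ennreal (r/2)"
      using Cauchy[of "r/2"] by auto
    \<comment> \<open>Fatou in the second index: the Cauchy estimate passes to the limit along the
      subsequence, so the whole sequence converges in norm.\<close>
    have "L2sq M (\<lambda>x. g n x - w x) \<le> ennreal (r/2)" if n: "n \<ge> N" for n
    proof (rule L2sq_Fatou[where f="\<lambda>k x. g n x - g (s k) x" and N=N])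
      show "AE x in M. (\<lambda>k. g n x - g (s k) x) \<longlonglongrightarrow> g n x - w x"
        using lim by eventually_elim (intro tendsto_intros)
      show "L2sq M (\<lambda>x. g n x - g (s k) x) \<le> ennreal (r/2)" if "k \<ge> N" for k
        using n that seq_suble[OF s(1), of k] by (intro N) auto
    qed measurable
    moreover have "ennreal (r/2) < ennreal r" using r by (simp add: ennreal_less_iff)
    ultimately show "\<forall>\<^sub>F n in sequentially. L2sq M (\<lambda>x. g n x - w x) < ennreal r"
      unfolding eventually_sequentially by (meson order_le_less_trans)
  qed
  with s(1) w lim show thesis by (rule that)
qed

section \<open>Pairings of square integrable functions\<close>

lemma integrable_inner_L2:
  fixes u h :: "'a \<Rightarrow> 'b::euclidean_space"
  assumes [measurable]: "u \<in> borel_measurable M" "h \<in> borel_measurable M"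
    and i: "integrable M (\<lambda>x. (norm (u x))\<^sup>2)" "integrable M (\<lambda>x. (norm (h x))\<^sup>2)"
  shows "integrable M (\<lambda>x. norm (u x) * norm (h x))" "integrable M (\<lambda>x. u x \<bullet> h x)"
proof -
  have "norm (u x) * norm (h x) \<le> (norm (u x))\<^sup>2 + (norm (h x))\<^sup>2" for x
  proof -
    have "0 \<le> norm (u x) * norm (h x)" by simp
    with sum_squares_bound[of "norm (u x)" "norm (h x)"] show ?thesis by linarith
  qed
  then show 1: "integrable M (\<lambda>x. norm (u x) * norm (h x))"
    by (intro Bochner_Integration.integrable_bound[OF Bochner_Integration.integrable_add[OF i]] AE_I2) auto
  show "integrable M (\<lambda>x. u x \<bullet> h x)"
    by (rule Bochner_Integration.integrable_bound[OF 1]) (auto simp: Cauchy_Schwarz_ineq2)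
qed

lemma inner_integral_square_le:
  fixes u h :: "'a \<Rightarrow> 'b::euclidean_space"
  assumes [measurable]: "u \<in> borel_measurable M" "h \<in> borel_measurable M"
  shows "ennreal ((LINT x|M. u x \<bullet> h x)\<^sup>2) \<le> L2sq M u * L2sq M h"
proof -
  have "ennreal \<bar>LINT x|M. u x \<bullet> h x\<bar> \<le> (\<integral>\<^sup>+x. ennreal (norm (u x)) * ennreal (norm (h x)) \<partial>M)"
  proof (cases "integrable M (\<lambda>x. u x \<bullet> h x)")
    case True
    have "ennreal \<bar>LINT x|M. u x \<bullet> h x\<bar> \<le> (\<integral>\<^sup>+x. norm (u x \<bullet> h x) \<partial>M)"
      using integral_norm_bound_ennreal[OF True] by simp
    also have "\<dots> \<le> (\<integral>\<^sup>+x. ennreal (norm (u x)) * ennreal (norm (h x)) \<partial>M)"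
      by (intro nn_integral_mono) (auto simp: ennreal_mult[symmetric] Cauchy_Schwarz_ineq2 intro!: ennreal_leI)
    finally show ?thesis .
  qed (simp add: not_integrable_integral_eq)
  then have "(ennreal \<bar>LINT x|M. u x \<bullet> h x\<bar>)\<^sup>2 \<le> (\<integral>\<^sup>+x. ennreal (norm (u x)) * ennreal (norm (h x)) \<partial>M)\<^sup>2"
    by (intro power_mono) auto
  also have "\<dots> \<le> L2sq M u * L2sq M h"
    using Cauchy_Schwarz_nn_integral[of "\<lambda>x. ennreal (norm (u x))" M "\<lambda>x. ennreal (norm (h x))"]
    by (simp add: L2sq_def ennreal_power)
  finally show ?thesis by (simp add: ennreal_power)
qed

lemma tendsto_inner_integral_strong:
  fixes u :: "nat \<Rightarrow> 'a \<Rightarrow> 'b::euclidean_space"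
  assumes [measurable]: "\<And>n. u n \<in> borel_measurable M" "h \<in> borel_measurable M"
    and h: "L2sq M h < \<infinity>" and lim: "(\<lambda>n. L2sq M (u n)) \<longlonglongrightarrow> 0"
  shows "(\<lambda>n. LINT x|M. u n x \<bullet> h x) \<longlonglongrightarrow> 0"
proof -
  have lim': "(\<lambda>n. L2sq M h * L2sq M (u n)) \<longlonglongrightarrow> 0"
    using h ennreal_tendsto_cmult[OF _ lim, of "L2sq M h"] by simp
  have "(\<lambda>n. ennreal ((LINT x|M. u n x \<bullet> h x)\<^sup>2)) \<longlonglongrightarrow> 0"
  proof (rule tendsto_sandwich[OF _ _ tendsto_const lim'])
    show "\<forall>\<^sub>F n in sequentially. ennreal ((LINT x|M. u n x \<bullet> h x)\<^sup>2) \<le> L2sq M h * L2sq M (u n)"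
      using inner_integral_square_le[of "u _" M h] by (intro always_eventually allI) (simp add: mult.commute)
  qed auto
  then have "(\<lambda>n. (LINT x|M. u n x \<bullet> h x)\<^sup>2) \<longlonglongrightarrow> 0" by (simp add: ennreal_tendsto_0_iff)
  then have "(\<lambda>n. sqrt ((LINT x|M. u n x \<bullet> h x)\<^sup>2)) \<longlonglongrightarrow> sqrt 0" by (rule tendsto_real_sqrt)
  then show ?thesis by (simp add: tendsto_rabs_zero_iff)
qed

text \<open>The pairing is split where the norm of \<open>z n x\<close> equals k times that of
  \<open>h x\<close>. Below this threshold k |h|^2 dominates; above it the product is at most |z|^2
  / k, small by the uniform bound.\<close>

lemma tendsto_inner_integral_AE:
  fixes z :: "nat \<Rightarrow> 'a \<Rightarrow> 'b::euclidean_space"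
  assumes [measurable]: "\<And>n. z n \<in> borel_measurable M" "h \<in> borel_measurable M"
    and z: "\<And>n. integrable M (\<lambda>x. (norm (z n x))\<^sup>2)" "\<And>n. (LINT x|M. (norm (z n x))\<^sup>2) \<le> C"
    and h: "integrable M (\<lambda>x. (norm (h x))\<^sup>2)"
    and lim: "AE x in M. (\<lambda>n. z n x) \<longlonglongrightarrow> 0"
  shows "(\<lambda>n. LINT x|M. z n x \<bullet> h x) \<longlonglongrightarrow> 0"
proof (rule LIMSEQ_I)
  fix e :: real assume e: "0 < e"
  have "0 \<le> (LINT x|M. (norm (z 0 x))\<^sup>2)" by (rule Bochner_Integration.integral_nonneg) simp
  then have C: "0 \<le> C" using z(2)[of 0] by linarith
  \<comment> \<open>The part above the threshold then costs at most (C + 1) / k = e/2; the added 1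
    keeps \<open>k\<close> positive.\<close>
  define k where "k = 2 * (C + 1) / e"
  have k: "k > 0" using C e by (simp add: k_def)
  let ?m = "\<lambda>n x. min (norm (z n x)) (k * norm (h x)) * norm (h x)"
  have dom: "norm (?m n x) \<le> k * (norm (h x))\<^sup>2" for n x
    using k by (auto simp: power2_eq_square abs_mult mult.assoc[symmetric] intro!: mult_right_mono)
  have kh: "integrable M (\<lambda>x. k * (norm (h x))\<^sup>2)" using h by simp
  have im: "integrable M (?m n)" for n
  proof (rule Bochner_Integration.integrable_bound[OF kh])
    show "AE x in M. norm (?m n x) \<le> norm (k * (norm (h x))\<^sup>2)"
      using order_trans[OF dom abs_ge_self] by (intro AE_I2) simp
  qed measurable
  have "(\<lambda>n. LINT x|M. ?m n x) \<longlonglongrightarrow> (LINT x|M. 0)"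
  proof (rule integral_dominated_convergence[OF _ _ kh])
    show "AE x in M. (\<lambda>n. ?m n x) \<longlonglongrightarrow> 0"
      using lim
    proof eventually_elim
      case (elim x)
      have "(\<lambda>n. ?m n x) \<longlonglongrightarrow> min (norm (0::'b)) (k * norm (h x)) * norm (h x)"
        by (intro tendsto_intros elim)
      then show ?case using k by simp
    qed
  qed (use dom in auto)
  then have "(\<lambda>n. LINT x|M. ?m n x) \<longlonglongrightarrow> 0" by simp
  from LIMSEQ_D[OF this, of "e/2"] e obtain N where N: "\<And>n. n \<ge> N \<Longrightarrow> \<bar>LINT x|M. ?m n x\<bar> < e/2" by auto
  have "norm ((LINT x|M. z n x \<bullet> h x) - 0) < e" if n: "n \<ge> N" for n
  proof -
    have pt: "\<bar>z n x \<bullet> h x\<bar> \<le> ?m n x + (1/k) * (norm (z n x))\<^sup>2" for x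
    proof -
      have "\<bar>z n x \<bullet> h x\<bar> \<le> norm (z n x) * norm (h x)" by (rule Cauchy_Schwarz_ineq2)
      also have "\<dots> \<le> ?m n x + (1/k) * (norm (z n x))\<^sup>2"
      proof (cases "norm (z n x) \<le> k * norm (h x)")
        case False
        then have "norm (z n x) * (k * norm (h x)) \<le> norm (z n x) * norm (z n x)"
          by (intro mult_left_mono) auto
        then have "norm (z n x) * norm (h x) \<le> (1/k) * (norm (z n x))\<^sup>2"
          using k by (simp add: field_simps power2_eq_square)
        moreover have "0 \<le> ?m n x" using k by auto
        ultimately show ?thesis by linarith
      qed (use k in auto)
      finally show ?thesis .
    qed
    have "\<bar>LINT x|M. z n x \<bullet> h x\<bar> \<le> (LINT x|M. \<bar>z n x \<bullet> h x\<bar>)"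
      using integral_norm_bound[of M "\<lambda>x. z n x \<bullet> h x"] by simp
    also have "\<dots> \<le> (LINT x|M. ?m n x + (1/k) * (norm (z n x))\<^sup>2)"
      using integrable_inner_L2(2)[OF _ _ z(1)[of n] h] im[of n] z(1)[of n] pt by (intro integral_mono) auto
    also have "\<dots> = (LINT x|M. ?m n x) + (1/k) * (LINT x|M. (norm (z n x))\<^sup>2)"
      using im[of n] z(1)[of n] by simp
    also have "\<dots> < e/2 + (1/k) * (C + 1)"
      using N[OF n] z(2)[of n] k by (intro add_less_le_mono mult_left_mono) auto
    also have "(1/k) * (C + 1) = e/2" using C e by (simp add: k_def field_simps)
    finally show ?thesis by simp
  qed
  then show "\<exists>N. \<forall>n\<ge>N. norm ((LINT x|M. z n x \<bullet> h x) - 0) < e" by blast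
qed

text \<open>Convex combinations of the tails of a sequence; midpoints are enough.\<close>

inductive_set midpoint_tail :: "(nat \<Rightarrow> 'a \<Rightarrow> 'b::real_vector) \<Rightarrow> nat \<Rightarrow> ('a \<Rightarrow> 'b) set"
  for w n where
  base: "n \<le> k \<Longrightarrow> w k \<in> midpoint_tail w n"
| midpoint: "g \<in> midpoint_tail w n \<Longrightarrow> h \<in> midpoint_tail w n \<Longrightarrow> (\<lambda>x. (1/2) *\<^sub>R (g x + h x)) \<in> midpoint_tail w n"

lemma midpoint_tail_mono: "g \<in> midpoint_tail w n \<Longrightarrow> m \<le> n \<Longrightarrow> g \<in> midpoint_tail w m"
  by (induction rule: midpoint_tail.induct) (auto intro: midpoint_tail.intros)

lemma midpoint_tail_measurable:
  fixes w :: "nat \<Rightarrow> 'a \<Rightarrow> 'b::{banach, second_countable_topology}"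
  assumes "g \<in> midpoint_tail w n" "\<And>n. w n \<in> borel_measurable M"
  shows "g \<in> borel_measurable M"
  using assms by (induction rule: midpoint_tail.induct) auto

text \<open>Arranged without differences of norms, since subtraction in \<open>ennreal\<close> is
  truncated.\<close>

lemma L2sq_parallelogram:
  fixes f g :: "'a \<Rightarrow> 'b::euclidean_space"
  assumes [measurable]: "f \<in> borel_measurable M" "g \<in> borel_measurable M"
  shows "L2sq M (\<lambda>x. f x - g x) + 4 * L2sq M (\<lambda>x. (1/2) *\<^sub>R (f x + g x)) = 2 * L2sq M f + 2 * L2sq M g"
proof -
  have eq: "(norm (f x - g x))\<^sup>2 + 4 * (norm ((1/2) *\<^sub>R (f x + g x)))\<^sup>2 = 2 * (norm (f x))\<^sup>2 + 2 * (norm (g x))\<^sup>2" for x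
    by (simp add: power2_norm_eq_inner algebra_simps inner_commute)
  have "L2sq M (\<lambda>x. f x - g x) + 4 * L2sq M (\<lambda>x. (1/2) *\<^sub>R (f x + g x))
     = (\<integral>\<^sup>+x. sqnorm (f x - g x) + 4 * sqnorm ((1/2) *\<^sub>R (f x + g x)) \<partial>M)"
    unfolding L2sq_def by (subst nn_integral_add) (auto simp: nn_integral_cmult)
  also have "\<dots> = (\<integral>\<^sup>+x. 2 * sqnorm (f x) + 2 * sqnorm (g x) \<partial>M)"
  proof (rule nn_integral_cong)
    fix x
    have "ennreal ((norm (f x - g x))\<^sup>2 + 4 * (norm ((1/2) *\<^sub>R (f x + g x)))\<^sup>2) = ennreal (2 * (norm (f x))\<^sup>2 + 2 * (norm (g x))\<^sup>2)"
      by (simp only: eq)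
    then show "sqnorm (f x - g x) + 4 * sqnorm ((1/2) *\<^sub>R (f x + g x)) = 2 * sqnorm (f x) + 2 * sqnorm (g x)"
      by (simp add: ennreal_mult del: norm_scaleR)
  qed
  also have "\<dots> = 2 * L2sq M f + 2 * L2sq M g"
    unfolding L2sq_def by (subst nn_integral_add) (auto simp: nn_integral_cmult)
  finally show ?thesis .
qed

lemma midpoint_tail_L2sq_le:
  fixes w :: "nat \<Rightarrow> 'a \<Rightarrow> 'b::euclidean_space"
  assumes "g \<in> midpoint_tail w n" and w: "\<And>n. w n \<in> borel_measurable M" "\<And>n. L2sq M (w n) \<le> ennreal C"
    and C: "0 \<le> C"
  shows "L2sq M g \<le> ennreal C"
  using assms(1)
proof (induction rule: midpoint_tail.induct)
  case (midpoint g h)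
  have [measurable]: "g \<in> borel_measurable M" "h \<in> borel_measurable M"
    using midpoint_tail_measurable midpoint.hyps w(1) by blast+
  have "4 * L2sq M (\<lambda>x. (1/2) *\<^sub>R (g x + h x)) \<le> L2sq M (\<lambda>x. g x - h x) + 4 * L2sq M (\<lambda>x. (1/2) *\<^sub>R (g x + h x))"
    by (simp add: add_increasing)
  also have "\<dots> = 2 * L2sq M g + 2 * L2sq M h" by (rule L2sq_parallelogram) measurable
  also have "\<dots> \<le> 2 * ennreal C + 2 * ennreal C"
    by (intro add_mono mult_left_mono midpoint.IH) auto
  also have "\<dots> = 4 * ennreal C" by (simp add: mult_2[symmetric] mult.assoc[symmetric])
  finally have "4 * L2sq M (\<lambda>x. (1/2) *\<^sub>R (g x + h x)) \<le> 4 * ennreal C" .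
  then show ?case by (subst (asm) ennreal_mult_le_mult_iff) auto
qed (use w in auto)

lemma two_ennreal_add: "2 * ennreal X + 2 * ennreal X = ennreal (4 * X)"
proof -
  have "2 * ennreal X + 2 * ennreal X = (2 + 2) * ennreal X" by (rule distrib_right[symmetric])
  also have "(2 + 2 :: ennreal) = ennreal 4" by simp
  also have "ennreal 4 * ennreal X = ennreal (4 * X)" by (rule ennreal_mult'[symmetric]) simp
  finally show ?thesis .
qed

text \<open>The projection argument: \<open>g n\<close> nearly minimizes the norm over
  \<open>midpoint_tail w n\<close>. The infima increase to a finite limit and a midpoint cannot lie
  below the infimum of its tail, so the parallelogram law makes \<open>g\<close> a Cauchy
  sequence.\<close>

lemma Mazur:
  fixes w :: "nat \<Rightarrow> 'a \<Rightarrow> 'b::euclidean_space"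
  assumes w: "\<And>n. w n \<in> borel_measurable M" "\<And>n. L2sq M (w n) \<le> ennreal C"
  obtains g v where "\<And>n. g n \<in> midpoint_tail w n" "v \<in> borel_measurable M" "L2sq M v < \<infinity>"
    "(\<lambda>n. L2sq M (\<lambda>x. g n x - v x)) \<longlonglongrightarrow> 0"
proof -
  \<comment> \<open>\<open>ennreal\<close> reads a negative bound as 0; taking the maximum with 0
    allows real arithmetic without loss.\<close>
  define C' where "C' = max C 0"
  have wC: "L2sq M (w n) \<le> ennreal C'" for n using w(2)[of n] by (auto simp: C'_def max_def ennreal_neg)
  note le = midpoint_tail_L2sq_le[OF _ w(1) wC, simplified C'_def, simplified, folded C'_def]
  define s where "s n = (INF g\<in>midpoint_tail w n. L2sq M g)" for n
  have s_le: "s n \<le> L2sq M g" if "g \<in> midpoint_tail w n" for n g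
    unfolding s_def using that by (rule INF_lower)
  have sC: "s n \<le> ennreal C'" for n
    using s_le[OF midpoint_tail.base[of n n]] wC[of n] by (meson order_refl order_trans)
  then have "\<exists>r. s n = ennreal r \<and> 0 \<le> r" for n
    by (metis ennreal_cases ennreal_less_top leD top.not_eq_extremum)
  then obtain t where t: "\<And>n. s n = ennreal (t n)" "\<And>n. 0 \<le> t n" by metis
  have tC: "t n \<le> C'" for n using sC[of n] t by (simp add: C'_def)
  have "incseq t"
  proof (rule incseq_SucI)
    fix n
    have "s n \<le> s (Suc n)" unfolding s_def
      by (rule INF_superset_mono) (auto intro: midpoint_tail_mono)
    then show "t n \<le> t (Suc n)" using t by simp
  qed
  then obtain T where T: "t \<longlonglongrightarrow> T" "\<And>n. t n \<le> T"
    using incseq_convergent[of t C'] tC by metis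
  have "\<exists>g\<in>midpoint_tail w n. L2sq M g < s n + ennreal (1 / real (Suc n))" for n
    by (rule INF_approx_ennreal) (use t in \<open>auto simp: s_def\<close>)
  then obtain g where g: "\<And>n. g n \<in> midpoint_tail w n" "\<And>n. L2sq M (g n) < s n + ennreal (1 / real (Suc n))"
    by metis
  have gm[measurable]: "g n \<in> borel_measurable M" for n
    using midpoint_tail_measurable[OF g(1) w(1)] .
  \<comment> \<open>The midpoint contributes at least 4 t k to the parallelogram law, the two
    near-minimizers at most 4 (T + 1/(k+1)); the bound is the difference.\<close>
  have key: "L2sq M (\<lambda>x. g m x - g n x) \<le> ennreal (4 * (T - t k) + 4 / real (Suc k))"
    if "k \<le> m" "k \<le> n" for k m n
  proof -
    have "(\<lambda>x. (1/2) *\<^sub>R (g m x + g n x)) \<in> midpoint_tail w k"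
      using g(1) that by (intro midpoint_tail.midpoint) (auto intro: midpoint_tail_mono)
    then have "ennreal (t k) \<le> L2sq M (\<lambda>x. (1/2) *\<^sub>R (g m x + g n x))" using s_le t by metis
    then have "L2sq M (\<lambda>x. g m x - g n x) + 4 * ennreal (t k)
      \<le> L2sq M (\<lambda>x. g m x - g n x) + 4 * L2sq M (\<lambda>x. (1/2) *\<^sub>R (g m x + g n x))"
      by (intro add_left_mono mult_left_mono) auto
    also have "\<dots> = 2 * L2sq M (g m) + 2 * L2sq M (g n)" by (rule L2sq_parallelogram) measurable
    also have "\<dots> \<le> 2 * ennreal (T + 1 / real (Suc k)) + 2 * ennreal (T + 1 / real (Suc k))"
    proof -
      have "L2sq M (g j) \<le> ennreal (T + 1 / real (Suc k))" if "k \<le> j" for j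
      proof -
        have "1 / real (Suc j) \<le> 1 / real (Suc k)" using that by (intro divide_left_mono) auto
        then have "ennreal (t j + 1 / real (Suc j)) \<le> ennreal (T + 1 / real (Suc k))"
          using T(2)[of j] by (intro ennreal_leI) linarith
        moreover have "L2sq M (g j) < ennreal (t j + 1 / real (Suc j))"
          using g(2)[of j] t by (simp add: ennreal_plus)
        ultimately show ?thesis by simp
      qed
      then show ?thesis using that by (intro add_mono mult_left_mono) auto
    qed
    also have "\<dots> = ennreal (4 * (T + 1 / real (Suc k)))"
      by (rule two_ennreal_add)
    finally have *: "L2sq M (\<lambda>x. g m x - g n x) + 4 * ennreal (t k) \<le> ennreal (4 * (T + 1 / real (Suc k)))" .
    \<comment> \<open>Finiteness has to be known before the term with \<open>t k\<close> can be
      cancelled.\<close>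
    have "L2sq M (\<lambda>x. g m x - g n x) \<le> L2sq M (\<lambda>x. g m x - g n x) + 4 * ennreal (t k)"
      by (simp add: add_increasing2)
    also note *
    also have "ennreal (4 * (T + 1 / real (Suc k))) < top" by simp
    finally have "L2sq M (\<lambda>x. g m x - g n x) < top" .
    then obtain d where d: "L2sq M (\<lambda>x. g m x - g n x) = ennreal d" "0 \<le> d"
      by (cases "L2sq M (\<lambda>x. g m x - g n x)") auto
    have "ennreal (d + 4 * t k) \<le> ennreal (4 * (T + 1 / real (Suc k)))"
      using * d t(2)[of k] by (simp add: ennreal_mult)
    moreover have "0 \<le> 4 * (T + 1 / real (Suc k))" using T(2)[of 0] t(2)[of 0] by (auto intro!: add_nonneg_nonneg)
    ultimately have "d \<le> 4 * (T - t k) + 4 / real (Suc k)" by (simp add: ennreal_le_iff)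
    then show ?thesis unfolding d(1) by (rule ennreal_leI)
  qed
  have lim0: "(\<lambda>k. 4 * (T - t k) + 4 * inverse (real (Suc k))) \<longlonglongrightarrow> 4 * (T - T) + 4 * 0"
    by (intro tendsto_add tendsto_mult tendsto_diff tendsto_const T(1) LIMSEQ_inverse_real_of_nat)
  have Cauchy: "\<exists>N. \<forall>m\<ge>N. \<forall>n\<ge>N. L2sq M (\<lambda>x. g m x - g n x) \<le> ennreal e" if e: "e > 0" for e
  proof -
    have "\<forall>\<^sub>F k in sequentially. 4 * (T - t k) + 4 * inverse (real (Suc k)) < e"
      using e by (intro order_tendstoD(2)[OF lim0]) simp
    then obtain k where "4 * (T - t k) + 4 / real (Suc k) < e"
      unfolding eventually_sequentially divide_inverse by blast
    then have "ennreal (4 * (T - t k) + 4 / real (Suc k)) \<le> ennreal e" by (intro ennreal_leI) simp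
    with key[of k] show ?thesis by (intro exI[of _ k] allI impI) (rule order_trans)
  qed
  obtain v where v[measurable]: "v \<in> borel_measurable M" "(\<lambda>n. L2sq M (\<lambda>x. g n x - v x)) \<longlonglongrightarrow> 0"
    by (rule L2_Cauchy_limit[OF gm Cauchy])
  have "\<forall>\<^sub>F n in sequentially. L2sq M (\<lambda>x. g n x - v x) < 1"
    by (rule order_tendstoD(2)[OF v(2)]) simp
  then obtain n where n: "L2sq M (\<lambda>x. g n x - v x) < 1" by (auto simp: eventually_sequentially)
  have "L2sq M v = L2sq M (\<lambda>x. (v x - g n x) + g n x)" by simp
  also have "\<dots> \<le> 2 * L2sq M (\<lambda>x. v x - g n x) + 2 * L2sq M (g n)" by (rule L2sq_add_le) measurable
  also have "L2sq M (\<lambda>x. v x - g n x) = L2sq M (\<lambda>x. g n x - v x)" by (simp add: L2sq_def norm_minus_commute)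
  also have "2 * L2sq M (\<lambda>x. g n x - v x) + 2 * L2sq M (g n) < \<infinity>"
  proof -
    have "L2sq M (\<lambda>x. g n x - v x) < \<infinity>" using n by (rule order_less_trans) simp
    moreover have "L2sq M (g n) < \<infinity>" using le[OF g(1), of n] by (rule order_le_less_trans) simp
    ultimately show ?thesis by (simp add: ennreal_mult_less_top)
  qed
  finally show thesis using g(1) v that by blast
qed

text \<open>An interval around \<open>l\<close> is convex, so a functional respecting midpoints
  cannot leave it. Compatibility is required on tail elements only, where integrability is
  available.\<close>

lemma midpoint_tail_functional:
  fixes L :: "('a \<Rightarrow> 'b::real_vector) \<Rightarrow> real"
  assumes "g \<in> midpoint_tail w n" and "\<And>k. n \<le> k \<Longrightarrow> \<bar>L (w k) - l\<bar> \<le> e"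
    and "\<And>g h. g \<in> midpoint_tail w n \<Longrightarrow> h \<in> midpoint_tail w n \<Longrightarrow> L (\<lambda>x. (1/2) *\<^sub>R (g x + h x)) = (L g + L h) / 2"
  shows "\<bar>L g - l\<bar> \<le> e"
  using assms(1)
proof (induction rule: midpoint_tail.induct)
  case (midpoint g h)
  have "\<bar>(p + q) / 2 - l\<bar> \<le> e" if "\<bar>p - l\<bar> \<le> e" "\<bar>q - l\<bar> \<le> e" for p q :: real
    using that by (intro abs_leI) (simp_all add: abs_le_iff field_simps)
  from this[OF midpoint.IH] show ?case unfolding assms(3)[OF midpoint.hyps] .
qed (use assms in auto)

section \<open>Weak convergence in $L^2_{\mathrm{loc}}$\<close>

lemma compact_lebesgue: "compact K \<Longrightarrow> K \<in> sets lebesgue"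
  by (simp add: compact_imp_closed sets_completionI_sets)

lemma open_lebesgue: "open W \<Longrightarrow> W \<in> sets lebesgue"
  by (simp add: sets_completionI_sets)

lemma finite_measure_compact: "compact K \<Longrightarrow> finite_measure (lebesgue_on K)"
  by (intro finite_measure_lebesgue_on lmeasurable_compact)

lemma borel_measurable_lebesgue_on_AE:
  fixes f g :: "'a::euclidean_space \<Rightarrow> 'b::euclidean_space"
  assumes f: "f \<in> borel_measurable (lebesgue_on S)" and S: "S \<in> sets lebesgue"
    and ae: "AE x in lebesgue_on S. f x = g x"
  shows "g \<in> borel_measurable (lebesgue_on S)"
proof -
  have "(\<lambda>x. if x \<in> S then f x else 0) \<in> borel_measurable lebesgue" using f borel_measurable_if[OF S] by blast
  moreover have "AE x in lebesgue. (if x \<in> S then f x else 0) = (if x \<in> S then g x else 0)"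
    using ae unfolding AE_lebesgue_on_iff[OF S] by eventually_elim auto
  ultimately have "(\<lambda>x. if x \<in> S then g x else 0) \<in> borel_measurable lebesgue"
    by (rule borel_measurable_AE)
  then show ?thesis by (rule borel_measurable_if_D)
qed

lemma borel_measurable_lebesgue_on_AE_limit:
  fixes f :: "nat \<Rightarrow> 'a::euclidean_space \<Rightarrow> 'b::euclidean_space"
  assumes [measurable]: "\<And>n. f n \<in> borel_measurable (lebesgue_on S)" and S: "S \<in> sets lebesgue"
    and lim: "AE x in lebesgue_on S. (\<lambda>n. f n x) \<longlonglongrightarrow> g x"
  shows "g \<in> borel_measurable (lebesgue_on S)"
proof (rule borel_measurable_lebesgue_on_AE[OF _ S])
  show "(\<lambda>x. lim (\<lambda>n. f n x)) \<in> borel_measurable (lebesgue_on S)" by measurable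
  show "AE x in lebesgue_on S. lim (\<lambda>n. f n x) = g x"
    using lim by eventually_elim (rule limI)
qed

lemma L2_on_iff:
  "L2_on S u \<longleftrightarrow> u \<in> borel_measurable (lebesgue_on S) \<and> L2sq (lebesgue_on S) u < \<infinity>"
  unfolding L2_on_def L2sq_def by (auto simp: integrable_iff_bounded)

lemma L2_on_measurable: "L2_on S u \<Longrightarrow> u \<in> borel_measurable (lebesgue_on S)"
  by (simp add: L2_on_def)

lemma L2_on_L2sq: "L2_on S u \<Longrightarrow> L2sq (lebesgue_on S) u = ennreal (LINT x|lebesgue_on S. (norm (u x))\<^sup>2)"
  unfolding L2_on_def L2sq_def by (intro nn_integral_eq_integral) auto

lemma L2_on_AE:
  assumes "L2_on S u" "S \<in> sets lebesgue" "AE x in lebesgue_on S. u x = v x"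
  shows "L2_on S v"
proof -
  have v: "v \<in> borel_measurable (lebesgue_on S)"
    using borel_measurable_lebesgue_on_AE[OF L2_on_measurable] assms by blast
  have "L2sq (lebesgue_on S) u = L2sq (lebesgue_on S) v"
    unfolding L2sq_def using assms(3) by (intro nn_integral_cong_AE) (auto elim: eventually_mono)
  then show ?thesis using assms(1) v by (simp add: L2_on_iff)
qed

lemma L2_on_add: "L2_on S u \<Longrightarrow> L2_on S v \<Longrightarrow> L2_on S (\<lambda>x. u x + v x)"
  unfolding L2_on_iff
  by (auto simp: ennreal_mult_less_top intro!: order_le_less_trans[OF L2sq_add_le])

lemma L2_on_uminus: "L2_on S u \<Longrightarrow> L2_on S (\<lambda>x. - u x)"
  unfolding L2_on_def by auto

lemma L2_on_diff: "L2_on S u \<Longrightarrow> L2_on S v \<Longrightarrow> L2_on S (\<lambda>x. u x - v x)"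
  using L2_on_add[of S u "\<lambda>x. - v x"] L2_on_uminus[of S v] by simp

lemma L2_on_const:
  assumes "compact K" shows "L2_on K (\<lambda>x. c)"
proof -
  interpret finite_measure "lebesgue_on K" using assms by (rule finite_measure_compact)
  show ?thesis unfolding L2_on_def by auto
qed

lemma integral_norm_square_add_le:
  assumes "L2_on S u" "L2_on S v"
  shows "(LINT x|lebesgue_on S. (norm (u x + v x))\<^sup>2) \<le>
    2 * (LINT x|lebesgue_on S. (norm (u x))\<^sup>2) + 2 * (LINT x|lebesgue_on S. (norm (v x))\<^sup>2)"
proof -
  have "(LINT x|lebesgue_on S. (norm (u x + v x))\<^sup>2) \<le> (LINT x|lebesgue_on S. 2 * (norm (u x))\<^sup>2 + 2 * (norm (v x))\<^sup>2)"
    using assms L2_on_add[OF assms] by (intro integral_mono norm_add_square_le) (auto simp: L2_on_def)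
  also have "\<dots> = 2 * (LINT x|lebesgue_on S. (norm (u x))\<^sup>2) + 2 * (LINT x|lebesgue_on S. (norm (v x))\<^sup>2)"
    using assms by (auto simp: L2_on_def)
  finally show ?thesis .
qed

lemma L2_on_subset:
  assumes "L2_on S u" "T \<subseteq> S" "S \<in> sets lebesgue" "T \<in> sets lebesgue"
  shows "L2_on T u"
proof -
  have m: "u \<in> borel_measurable (lebesgue_on T)"
    using measurable_restrict_mono[OF L2_on_measurable[OF assms(1)] assms(2)] .
  have "L2sq (lebesgue_on T) u \<le> L2sq (lebesgue_on S) u"
    unfolding L2sq_def using assms(2-4)
    by (subst (1 2) nn_integral_restrict_space) (auto intro!: nn_integral_mono simp: indicator_def)
  with m assms(1) show ?thesis by (auto simp: L2_on_iff)
qed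

lemma L2_on_integrable:
  assumes "L2_on K u" "compact K"
  shows "integrable (lebesgue_on K) u"
proof -
  interpret finite_measure "lebesgue_on K" using assms(2) by (rule finite_measure_compact)
  have 1: "integrable (lebesgue_on K) (\<lambda>x. 1 + (norm (u x))\<^sup>2)"
    using assms(1) by (auto simp: L2_on_def)
  show ?thesis
  proof (rule Bochner_Integration.integrable_bound[OF 1 L2_on_measurable[OF assms(1)] AE_I2])
    fix x
    have "norm (u x) \<le> 1 + (norm (u x))\<^sup>2"
      using sum_squares_bound[of "norm (u x)" 1] norm_ge_zero[of "u x"] unfolding mult_1_right one_power2 by linarith
    then show "norm (u x) \<le> norm (1 + (norm (u x))\<^sup>2)" by simp
  qed
qed

lemma L2_on_bounded_scaleR:
  fixes u :: "real^2 \<Rightarrow> 'b::euclidean_space"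
  assumes u: "L2_on K u" and f: "f \<in> borel_measurable (lebesgue_on K)" "\<And>x. \<bar>f x\<bar> \<le> B"
  shows "L2_on K (\<lambda>x. f x *\<^sub>R u x)"
proof -
  have um[measurable]: "u \<in> borel_measurable (lebesgue_on K)" "f \<in> borel_measurable (lebesgue_on K)"
    using L2_on_measurable[OF u] f(1) .
  have "integrable (lebesgue_on K) (\<lambda>x. (f x)\<^sup>2 *\<^sub>R (norm (u x))\<^sup>2)"
  proof (rule integrable_bounded_scaleR[where B="B\<^sup>2"])
    show "\<bar>(f x)\<^sup>2\<bar> \<le> B\<^sup>2" for x using power_mono[OF f(2)[of x], of 2] by simp
  qed (use u in \<open>auto simp: L2_on_def\<close>)
  then show ?thesis unfolding L2_on_def by (simp add: power_mult_distrib)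
qed

lemma L2_boundedD:
  assumes "L2_bounded W u" "compact K" "K \<subseteq> W"
  obtains C where "\<And>n. L2_on K (u n)" "\<And>n. (LINT x|lebesgue_on K. (norm (u n x))\<^sup>2) \<le> C"
  using assms unfolding L2_bounded_def by meson

lemma L2_bounded_L2loc: "L2_bounded W u \<Longrightarrow> L2loc W (u n)"
  by (force simp: L2_bounded_def L2loc_def)

lemma L2_bounded_subseq: "L2_bounded W u \<Longrightarrow> L2_bounded W (\<lambda>n. u (r n))"
  unfolding L2_bounded_def by meson

lemma L2loc_L1loc: "L2loc W u \<Longrightarrow> L1loc W u"
  by (auto simp: L2loc_def L1loc_def intro: L2_on_integrable)

lemma AE_lebesgue_on_subset:
  assumes "AE x in lebesgue_on W. P x" "K \<subseteq> W" "K \<in> sets lebesgue" "W \<in> sets lebesgue"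
  shows "AE x in lebesgue_on K. P x"
  using assms(1) unfolding AE_lebesgue_on_iff[OF assms(3)] AE_lebesgue_on_iff[OF assms(4)]
  by eventually_elim (use assms(2) in auto)

lemma L2loc_AE:
  assumes "L2loc W u" "open W" "AE x in lebesgue_on W. u x = v x"
  shows "L2loc W v"
  unfolding L2loc_def
proof (intro allI impI, elim conjE)
  fix K assume K: "compact K" "K \<subseteq> W"
  have "L2_on K u" using assms(1) K by (auto simp: L2loc_def)
  then show "L2_on K v"
    using compact_lebesgue[OF K(1)]
      AE_lebesgue_on_subset[OF assms(3) K(2) compact_lebesgue[OF K(1)] open_lebesgue[OF assms(2)]]
    by (rule L2_on_AE)
qed

lemma L2loc_diff: "L2loc W u \<Longrightarrow> L2loc W v \<Longrightarrow> L2loc W (\<lambda>x. u x - v x)"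
  by (auto simp: L2loc_def intro: L2_on_diff)

lemma L2loc_const: "L2loc W (\<lambda>x. c)"
  by (auto simp: L2loc_def intro: L2_on_const)

lemma ex_compact_exhaustion:
  fixes W :: "'a::euclidean_space set"
  assumes "open W"
  shows "\<exists>C :: nat \<Rightarrow> 'a set. (\<forall>n. compact (C n)) \<and> (\<forall>n. C n \<subseteq> W) \<and> (\<forall>n. C n \<subseteq> interior (C (Suc n))) \<and>
    \<Union>(range C) = W \<and> (\<forall>K. compact K \<longrightarrow> K \<subseteq> W \<longrightarrow> (\<exists>N. \<forall>n\<ge>N. K \<subseteq> C n))"
proof (rule open_Union_compact_subsets[OF assms])
  fix C :: "nat \<Rightarrow> 'a set"
  assume "\<And>n. compact (C n)" "\<And>n. C n \<subseteq> W" "\<And>n. C n \<subseteq> interior (C (Suc n))" "\<Union>(range C) = W"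
    "\<And>K. compact K \<Longrightarrow> K \<subseteq> W \<Longrightarrow> \<exists>N. \<forall>n\<ge>N. K \<subseteq> C n"
  then show ?thesis by (intro exI[of _ C]) simp
qed

text \<open>The truncations to an exhaustion by compact sets converge pointwise.\<close>

lemma L2loc_measurable:
  fixes u :: "real^2 \<Rightarrow> 'b::euclidean_space"
  assumes u: "L2loc W u" and W: "open W"
  shows "u \<in> borel_measurable (lebesgue_on W)"
proof -
  obtain C where C: "\<And>n. compact (C n)" "\<And>n. C n \<subseteq> W" "\<And>n. C n \<subseteq> interior (C (Suc n))" "\<Union>(range C) = W"
    "\<And>K. compact K \<Longrightarrow> K \<subseteq> W \<Longrightarrow> \<exists>N. \<forall>n\<ge>N. K \<subseteq> C n"
    using ex_compact_exhaustion[OF W] by blast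
  have "C n \<subseteq> C (Suc n)" for n using C(3)[of n] interior_subset by (rule subset_trans)
  then have mono: "C m \<subseteq> C n" if "m \<le> n" for m n
    using that by (rule lift_Suc_mono_le)
  have "(\<lambda>x. if x \<in> W then u x else 0) \<in> borel_measurable lebesgue"
  proof (rule borel_measurable_LIMSEQ_metric)
    show "(\<lambda>x. if x \<in> C n then u x else 0) \<in> borel_measurable lebesgue" for n
      using u C by (intro borel_measurable_if_I) (auto simp: compact_lebesgue L2loc_def L2_on_def)
    fix x
    show "(\<lambda>n. if x \<in> C n then u x else 0) \<longlonglongrightarrow> (if x \<in> W then u x else 0)"
    proof (cases "x \<in> W")
      case True
      then obtain m where "x \<in> C m" using C(4) by auto
      then have "\<forall>n\<ge>m. x \<in> C n" using mono by blast
      then show ?thesis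
        using True by (intro tendsto_eventually) (auto simp: eventually_sequentially)
    next
      case False
      then have "x \<notin> C n" for n using C(2) by blast
      then show ?thesis using False by simp
    qed
  qed
  then show ?thesis using borel_measurable_if[OF open_lebesgue[OF W]] by blast
qed

lemma L2sq_lebesgue_on:
  assumes "K \<in> sets lebesgue" "W \<in> sets lebesgue" "K \<subseteq> W"
  shows "L2sq (lebesgue_on K) u = (\<integral>\<^sup>+x. indicator K x * sqnorm (u x) \<partial>lebesgue_on W)"
proof -
  have "K \<in> sets (lebesgue_on W)" using assms by (simp add: sets_restrict_space_iff)
  then have "L2sq (restrict_space (lebesgue_on W) K) u = (\<integral>\<^sup>+x. indicator K x * sqnorm (u x) \<partial>lebesgue_on W)"
    unfolding L2sq_def by (subst nn_integral_restrict_space) (auto simp: mult.commute)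
  moreover have "restrict_space (lebesgue_on W) K = lebesgue_on K"
    using assms by (subst restrict_restrict_space) (auto simp: Int_absorb1)
  ultimately show ?thesis by simp
qed

text \<open>The seminorms on an exhaustion by compact sets are combined into one weighted $L^2$ norm,
  in which the sequence is bounded.\<close>

lemma L2_bounded_weak_cluster:
  fixes w :: "nat \<Rightarrow> real^2 \<Rightarrow> 'b::euclidean_space"
  assumes W: "open W" and w: "L2_bounded W w"
  obtains v where "L2loc W v"
    "\<And>K h l. compact K \<Longrightarrow> K \<subseteq> W \<Longrightarrow> L2_on K h \<Longrightarrow>
      (\<lambda>n. LINT x|lebesgue_on K. w n x \<bullet> h x) \<longlonglongrightarrow> l \<Longrightarrow> (LINT x|lebesgue_on K. v x \<bullet> h x) = l"
proof -
  obtain C where C: "\<And>n. compact (C n)" "\<And>n. C n \<subseteq> W" "\<And>n. C n \<subseteq> interior (C (Suc n))" "\<Union>(range C) = W"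
    "\<And>K. compact K \<Longrightarrow> K \<subseteq> W \<Longrightarrow> \<exists>N. \<forall>n\<ge>N. K \<subseteq> C n"
    using ex_compact_exhaustion[OF W] by blast
  note Wl = open_lebesgue[OF W] and Cl = compact_lebesgue[OF C(1)]
  have "\<exists>B. \<forall>n. L2_on (C m) (w n) \<and> (LINT x|lebesgue_on (C m). (norm (w n x))\<^sup>2) \<le> B" for m
    using w C by (auto simp: L2_bounded_def)
  then obtain B where B: "\<And>m n. L2_on (C m) (w n)" "\<And>m n. (LINT x|lebesgue_on (C m). (norm (w n x))\<^sup>2) \<le> B m"
    by metis
  have B0: "0 \<le> B m" for m
    using B(2)[of m 0] by (rule order_trans[rotated]) simp
  \<comment> \<open>The weight offsets the bound \<open>B m\<close> on the m-th compact set, so the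
    weighted squares sum to at most the geometric series with value 2.\<close>
  define c where "c m = (1/2)^m / (1 + B m)" for m
  have c: "0 < c m" for m using B0[of m] by (simp add: c_def)
  have Cs[measurable]: "C m \<in> sets (lebesgue_on W)" for m
    using C(2) Cl Wl by (simp add: sets_restrict_space_iff)
  \<comment> \<open>As a density this carries all seminorms at once, so Mazur's lemma is applied
    only once and one \<open>v\<close> serves all compact sets.\<close>
  define \<rho> where "\<rho> x = (\<Sum>m. ennreal (c m) * indicator (C m) x)" for x
  have [measurable]: "\<rho> \<in> borel_measurable (lebesgue_on W)" unfolding \<rho>_def by measurable
  define N where "N = density (lebesgue_on W) \<rho>"
  have N: "L2sq N u = (\<Sum>m. ennreal (c m) * L2sq (lebesgue_on (C m)) u)"
    if [measurable]: "u \<in> borel_measurable (lebesgue_on W)" for u :: "real^2 \<Rightarrow> 'b"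
  proof -
    have "L2sq N u = (\<integral>\<^sup>+x. (\<Sum>m. ennreal (c m) * (indicator (C m) x * sqnorm (u x))) \<partial>lebesgue_on W)"
      unfolding L2sq_def N_def
      by (subst nn_integral_density) (auto simp: \<rho>_def ennreal_suminf_multc[symmetric] mult.assoc)
    also have "\<dots> = (\<Sum>m. ennreal (c m) * L2sq (lebesgue_on (C m)) u)"
      by (subst nn_integral_suminf) (auto simp: nn_integral_cmult L2sq_lebesgue_on[OF Cl Wl C(2)])
    finally show ?thesis .
  qed
  have Nm: "borel_measurable N = (borel_measurable (lebesgue_on W) :: (_ \<Rightarrow> 'b) set)"
    unfolding N_def by (intro measurable_cong_sets) simp_all
  have wm: "w n \<in> borel_measurable N" for n
    unfolding Nm using L2loc_measurable[OF L2_bounded_L2loc[OF w] W] .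
  have w2: "L2sq N (w n) \<le> ennreal 2" for n
  proof -
    have "L2sq N (w n) = (\<Sum>m. ennreal (c m) * L2sq (lebesgue_on (C m)) (w n))"
      using wm N unfolding Nm by blast
    also have "\<dots> \<le> (\<Sum>m. ennreal ((1/2)^m))"
    proof (intro suminf_le)
      fix m
      have "ennreal (c m) * L2sq (lebesgue_on (C m)) (w n) \<le> ennreal (c m) * ennreal (1 + B m)"
        unfolding L2_on_L2sq[OF B(1)] using B(2)[of m n] by (intro mult_left_mono ennreal_leI) auto
      also have "\<dots> = ennreal (c m * (1 + B m))" using c[of m] B0[of m] by (intro ennreal_mult[symmetric]) auto
      also have "c m * (1 + B m) = (1/2)^m" using B0[of m] by (simp add: c_def)
      finally show "ennreal (c m) * L2sq (lebesgue_on (C m)) (w n) \<le> ennreal ((1/2)^m)" .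
    qed auto
    also have "\<dots> = ennreal (\<Sum>m. (1/2)^m)" by (intro suminf_ennreal2) (auto intro: summable_geometric)
    also have "(\<Sum>m. (1/2::real)^m) = 2" by (subst suminf_geometric) auto
    finally show ?thesis .
  qed
  obtain g v where g: "\<And>n. g n \<in> midpoint_tail w n"
    and v: "v \<in> borel_measurable N" "L2sq N v < \<infinity>" and gv: "(\<lambda>n. L2sq N (\<lambda>x. g n x - v x)) \<longlonglongrightarrow> 0" by (rule Mazur[of w N 2, OF wm w2], rule that)
  have vm: "v \<in> borel_measurable (lebesgue_on W)" using v(1) unfolding Nm .
  have gm: "g n \<in> borel_measurable (lebesgue_on W)" for n
    using midpoint_tail_measurable[OF g wm] unfolding Nm .
  \<comment> \<open>Conversely the weighted norm controls each local one: a compact set lies in some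
    \<open>C m\<close>, at the price of the factor 1 / c m.\<close>
  have KN: "\<exists>a>0. \<forall>u \<in> borel_measurable (lebesgue_on W). L2sq (lebesgue_on K) u \<le> ennreal a * L2sq N (u :: _ \<Rightarrow> 'b)"
    if K: "compact K" "K \<subseteq> W" for K
  proof -
    obtain m where m: "K \<subseteq> C m" using C(5)[OF K] by blast
    have "L2sq (lebesgue_on K) u \<le> ennreal (1 / c m) * L2sq N u" if u: "u \<in> borel_measurable (lebesgue_on W)" for u :: "_ \<Rightarrow> 'b"
    proof -
      have "L2sq (lebesgue_on K) u \<le> L2sq (lebesgue_on (C m)) u"
        unfolding L2sq_lebesgue_on[OF Cl Wl C(2)] L2sq_lebesgue_on[OF compact_lebesgue[OF K(1)] Wl K(2)]
        using m by (intro nn_integral_mono) (auto simp: indicator_def)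
      also have "\<dots> = ennreal (1 / c m) * (ennreal (c m) * L2sq (lebesgue_on (C m)) u)"
        using c[of m] by (simp add: mult.assoc[symmetric] ennreal_mult[symmetric])
      also have "ennreal (c m) * L2sq (lebesgue_on (C m)) u \<le> L2sq N u"
        unfolding N[OF u] using sum_le_suminf[of "\<lambda>m. ennreal (c m) * L2sq (lebesgue_on (C m)) u" "{m}"] by simp
      finally show ?thesis by (simp add: mult_left_mono)
    qed
    then show ?thesis using c[of m] by (intro exI[of _ "1 / c m"]) auto
  qed
  have mK: "u \<in> borel_measurable (lebesgue_on K)" if "K \<subseteq> W" "u \<in> borel_measurable (lebesgue_on W)" for K and u :: "_ \<Rightarrow> 'b"
    using that by (meson measurable_restrict_mono)
  have L2K: "L2_on K u" if K: "compact K" "K \<subseteq> W" and u: "u \<in> borel_measurable (lebesgue_on W)" "L2sq N u < \<infinity>" for K and u :: "_ \<Rightarrow> 'b"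
  proof -
    obtain a where "L2sq (lebesgue_on K) u \<le> ennreal a * L2sq N u" using KN[OF K] u(1) by blast
    also have "\<dots> < \<infinity>" using u(2) by (simp add: ennreal_mult_less_top)
    finally show ?thesis using mK[OF K(2) u(1)] by (simp add: L2_on_iff)
  qed
  show thesis
  proof (rule that)
    show "L2loc W v" using L2K v(2) vm by (auto simp: L2loc_def)
    fix K h l
    assume K: "compact K" "K \<subseteq> W" and h: "L2_on K h" and lim: "(\<lambda>n. LINT x|lebesgue_on K. w n x \<bullet> h x) \<longlonglongrightarrow> l"
    define L where "L u = (LINT x|lebesgue_on K. u x \<bullet> h x)" for u
    note hm[measurable] = L2_on_measurable[OF h]
    have int: "integrable (lebesgue_on K) (\<lambda>x. u x \<bullet> h x)" if "L2_on K u" for u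
      using that h by (intro integrable_inner_L2) (auto simp: L2_on_def)
    have tail: "L2_on K u" if "u \<in> midpoint_tail w n" for u n
      using that
    proof (induction rule: midpoint_tail.induct)
      case (base k)
      then show ?case using w K by (force simp: L2_bounded_def)
    next
      case (midpoint g h)
      have "L2_on K (\<lambda>x. (1/2) *\<^sub>R (g x + h x))"
        by (rule L2_on_bounded_scaleR[OF L2_on_add[OF midpoint.IH], where B="1/2"]) auto
      then show ?case .
    qed
    \<comment> \<open>Elements of late tails pair with \<open>h\<close> almost as the sequence
      itself does, so the strong limit \<open>v\<close> inherits the limit of the pairings.\<close>
    have "(\<lambda>n. L (g n)) \<longlonglongrightarrow> l"
    proof (rule LIMSEQ_I)
      fix e :: real assume "0 < e"
      then obtain n0 where n0: "\<And>n. n \<ge> n0 \<Longrightarrow> \<bar>L (w n) - l\<bar> \<le> e/2"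
        using LIMSEQ_D[OF lim, of "e/2"] unfolding L_def by (metis half_gt_zero less_eq_real_def real_norm_def)
      have "\<bar>L (g n) - l\<bar> \<le> e/2" if "n \<ge> n0" for n
      proof (rule midpoint_tail_functional[OF g])
        show "\<bar>L (w k) - l\<bar> \<le> e/2" if "n \<le> k" for k using n0 \<open>n \<ge> n0\<close> that by simp
        show "L (\<lambda>x. (1/2) *\<^sub>R (p x + q x)) = (L p + L q) / 2" if "p \<in> midpoint_tail w n" "q \<in> midpoint_tail w n" for p q
          using int[OF tail[OF that(1)]] int[OF tail[OF that(2)]] by (simp add: L_def inner_add_left)
      qed
      then show "\<exists>no. \<forall>n\<ge>no. norm (L (g n) - l) < e" using \<open>0 < e\<close> by (intro exI[of _ n0]) fastforce
    qed
    moreover have "(\<lambda>n. L (g n)) \<longlonglongrightarrow> L v"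
    proof -
      have [measurable]: "g n \<in> borel_measurable (lebesgue_on K)" "v \<in> borel_measurable (lebesgue_on K)" for n
        by (rule mK[OF K(2) gm], rule mK[OF K(2) vm])
      have "(\<lambda>n. LINT x|lebesgue_on K. (g n x - v x) \<bullet> h x) \<longlonglongrightarrow> 0"
      proof (rule tendsto_inner_integral_strong)
        show "L2sq (lebesgue_on K) h < \<infinity>" using h by (simp add: L2_on_iff)
        obtain a where a: "\<And>u. u \<in> borel_measurable (lebesgue_on W) \<Longrightarrow> L2sq (lebesgue_on K) u \<le> ennreal a * L2sq N (u :: _ \<Rightarrow> 'b)"
          using KN[OF K] by blast
        have lim0: "(\<lambda>n. ennreal a * L2sq N (\<lambda>x. g n x - v x)) \<longlonglongrightarrow> 0"
          using ennreal_tendsto_cmult[OF _ gv, of "ennreal a"] by simp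
        show "(\<lambda>n. L2sq (lebesgue_on K) (\<lambda>x. g n x - v x)) \<longlonglongrightarrow> 0"
        proof (rule tendsto_sandwich[OF _ _ tendsto_const lim0])
          show "\<forall>\<^sub>F n in sequentially. L2sq (lebesgue_on K) (\<lambda>x. g n x - v x) \<le> ennreal a * L2sq N (\<lambda>x. g n x - v x)"
            using gm vm by (intro always_eventually allI a) auto
        qed simp
      qed measurable
      moreover have "(LINT x|lebesgue_on K. (g n x - v x) \<bullet> h x) = L (g n) - L v" for n
        using int[OF tail[OF g]] int[OF L2K[OF K vm v(2)]] by (simp add: L_def inner_diff_left)
      ultimately show ?thesis by (simp add: LIM_zero_iff)
    qed
    ultimately show "(LINT x|lebesgue_on K. v x \<bullet> h x) = l"
      unfolding L_def by (rule LIMSEQ_unique[symmetric])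
  qed
qed

section \<open>Almost everywhere limits and uniqueness of weak limits\<close>

lemma tendsto_if_subseqs:
  fixes x :: "nat \<Rightarrow> 'a::metric_space"
  assumes "\<And>r. strict_mono r \<Longrightarrow> \<exists>s :: nat \<Rightarrow> nat. strict_mono s \<and> (\<lambda>n. x (r (s n))) \<longlonglongrightarrow> l"
  shows "x \<longlonglongrightarrow> l"
proof (rule ccontr)
  assume "\<not> x \<longlonglongrightarrow> l"
  then obtain e where e: "e > 0" "\<not> (\<forall>\<^sub>F n in sequentially. dist (x n) l < e)"
    unfolding tendsto_iff by blast
  from not_eventually_sequentiallyD[OF e(2)] obtain r :: "nat \<Rightarrow> nat" where r: "strict_mono r" "\<forall>n. \<not> dist (x (r n)) l < e"
    by blast
  from assms[OF r(1)] obtain s where "(\<lambda>n. x (r (s n))) \<longlonglongrightarrow> l" by blast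
  then have "\<forall>\<^sub>F n in sequentially. dist (x (r (s n))) l < e" using e(1) by (rule tendstoD)
  then show False using r(2) by (auto simp: eventually_sequentially)
qed

lemma L2_on_integrable_inner: "L2_on K u \<Longrightarrow> L2_on K h \<Longrightarrow> integrable (lebesgue_on K) (\<lambda>x. u x \<bullet> h x)"
  by (intro integrable_inner_L2) (auto simp: L2_on_def)

text \<open>Fatou puts the limit into L^2 on compact sets; the differences are then bounded in L^2
  and tend to 0 almost everywhere, which suffices for the pairings.\<close>

lemma weakly_conv_L2loc_AE:
  fixes u :: "nat \<Rightarrow> real^2 \<Rightarrow> 'b::euclidean_space"
  assumes W: "open W" and u: "L2_bounded W u" and lim: "AE x in lebesgue_on W. (\<lambda>n. u n x) \<longlonglongrightarrow> v x"
  shows "weakly_conv_L2loc W u v"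
proof -
  have limK: "AE x in lebesgue_on K. (\<lambda>n. u n x) \<longlonglongrightarrow> v x" if "compact K" "K \<subseteq> W" for K
    using AE_lebesgue_on_subset[OF lim that(2)] that W by (auto simp: compact_lebesgue open_lebesgue)
  have vK: "L2_on K v" if K: "compact K" "K \<subseteq> W" for K
  proof -
    obtain C where C: "\<And>n. L2_on K (u n)" "\<And>n. (LINT x|lebesgue_on K. (norm (u n x))\<^sup>2) \<le> C"
      using L2_boundedD[OF u K] by blast
    have m[measurable]: "u n \<in> borel_measurable (lebesgue_on K)" for n using C(1) by (rule L2_on_measurable)
    have v[measurable]: "v \<in> borel_measurable (lebesgue_on K)"
      by (rule borel_measurable_lebesgue_on_AE_limit[OF m compact_lebesgue[OF K(1)] limK[OF K]])
    have "L2sq (lebesgue_on K) v \<le> ennreal C"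
      by (rule L2sq_Fatou[OF m v limK[OF K], of 0]) (auto simp: L2_on_L2sq[OF C(1)] intro!: ennreal_leI C(2))
    also have "\<dots> < \<infinity>" by simp
    finally show ?thesis using v by (simp add: L2_on_iff)
  qed
  show ?thesis
    unfolding weakly_conv_L2loc_def
  proof (intro conjI allI impI)
    show "L2loc W (u n)" for n using u by (rule L2_bounded_L2loc)
    show "L2loc W v" using vK by (auto simp: L2loc_def)
    fix K and h :: "real^2 \<Rightarrow> 'b" assume "compact K \<and> K \<subseteq> W \<and> L2_on K h"
    then have K: "compact K" "K \<subseteq> W" and h: "L2_on K h" by auto
    obtain C where C: "\<And>n. L2_on K (u n)" "\<And>n. (LINT x|lebesgue_on K. (norm (u n x))\<^sup>2) \<le> C"
      using L2_boundedD[OF u K] by blast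
    have d: "L2_on K (\<lambda>x. u n x - v x)" for n by (rule L2_on_diff[OF C(1) vK[OF K]])
    have "(\<lambda>n. LINT x|lebesgue_on K. (u n x - v x) \<bullet> h x) \<longlonglongrightarrow> 0"
    proof (rule tendsto_inner_integral_AE)
      show "(LINT x|lebesgue_on K. (norm (u n x - v x))\<^sup>2) \<le> 2 * C + 2 * (LINT x|lebesgue_on K. (norm (v x))\<^sup>2)" for n
        using integral_norm_square_add_le[OF C(1)[of n] L2_on_uminus[OF vK[OF K]]] C(2)[of n] by simp
      show "AE x in lebesgue_on K. (\<lambda>n. u n x - v x) \<longlonglongrightarrow> 0"
        using limK[OF K] by eventually_elim (simp add: LIM_zero)
    qed (use d h in \<open>auto simp: L2_on_def\<close>)
    moreover have "(LINT x|lebesgue_on K. (u n x - v x) \<bullet> h x) = (LINT x|lebesgue_on K. u n x \<bullet> h x) - (LINT x|lebesgue_on K. v x \<bullet> h x)" for n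
      using L2_on_integrable_inner[OF C(1) h] L2_on_integrable_inner[OF vK[OF K] h] by (simp add: inner_diff_left)
    ultimately show "(\<lambda>n. LINT x|lebesgue_on K. u n x \<bullet> h x) \<longlonglongrightarrow> (LINT x|lebesgue_on K. v x \<bullet> h x)"
      by (simp add: LIM_zero_iff)
  qed
qed

text \<open>The difference of the two limits is itself admissible as \<open>h\<close> on each closed
  box.\<close>

lemma weakly_conv_L2loc_unique:
  fixes u :: "nat \<Rightarrow> real^2 \<Rightarrow> 'b::euclidean_space"
  assumes W: "open W" and v: "weakly_conv_L2loc W u v" and w: "weakly_conv_L2loc W u w"
  shows "AE x in lebesgue_on W. v x = w x"
proof -
  have "AE x in lebesgue. x \<in> W \<longrightarrow> v x = w x"
  proof (rule AE_open_if_cboxes[OF W])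
    fix a b :: "real^2" assume ab: "cbox a b \<subseteq> W"
    let ?K = "cbox a b" 
    have vw: "L2_on ?K v" "L2_on ?K w" using v w ab by (auto simp: weakly_conv_L2loc_def L2loc_def)
    note d = L2_on_diff[OF vw]
    have "(LINT x|lebesgue_on ?K. v x \<bullet> (v x - w x)) = (LINT x|lebesgue_on ?K. w x \<bullet> (v x - w x))"
      using v w ab d unfolding weakly_conv_L2loc_def by (meson LIMSEQ_unique compact_cbox)
    then have "(LINT x|lebesgue_on ?K. (v x - w x) \<bullet> (v x - w x)) = 0"
      using L2_on_integrable_inner[OF vw(1) d] L2_on_integrable_inner[OF vw(2) d]
      by (subst inner_diff_left) simp
    then have "AE x in lebesgue_on ?K. (v x - w x) \<bullet> (v x - w x) = 0"
      using L2_on_integrable_inner[OF d d] by (subst (asm) integral_nonneg_eq_0_iff_AE) auto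
    then show "AE x in lebesgue. x \<in> ?K \<longrightarrow> v x = w x"
      unfolding AE_lebesgue_on_iff[OF compact_lebesgue[OF compact_cbox]] by simp
  qed
  then show ?thesis by (simp add: AE_lebesgue_on_iff open_lebesgue[OF W])
qed

section \<open>Weak partial derivatives\<close>

lemma integral_lebesgue_on_support:
  fixes f :: "'a::euclidean_space \<Rightarrow> 'b::euclidean_space"
  assumes "K \<subseteq> W" "K \<in> sets lebesgue" "W \<in> sets lebesgue" "\<And>x. x \<notin> K \<Longrightarrow> f x = 0"
  shows "(LINT x|lebesgue_on W. f x) = (LINT x|lebesgue_on K. f x)"
proof -
  have "(LINT x|lebesgue_on W. f x) = (LINT x|lebesgue_on W. (if x \<in> K then f x else 0))"
    using assms(4) by (intro Bochner_Integration.integral_cong) auto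
  also have "\<dots> = (LINT x|lebesgue_on K. f x)"
    by (rule Lebesgue_Measure.integral_restrict[OF assms(1-3)])
  finally show ?thesis .
qed

lemma continuous_lebesgue_on_measurable:
  fixes f :: "'a::euclidean_space \<Rightarrow> 'b::euclidean_space"
  assumes "continuous_on UNIV f"
  shows "f \<in> borel_measurable (lebesgue_on S)"
proof -
  have "f \<in> borel_measurable lebesgue"
    using borel_measurable_continuous_onI[OF assms] by (intro measurable_completion) simp
  then show ?thesis by (rule measurable_restrict_space1)
qed

lemma test_function_compact:
  assumes "test_function W \<phi>"
  obtains K B where "compact K" "K \<subseteq> W" "\<And>x. x \<notin> K \<Longrightarrow> \<phi> x = 0" "\<And>x i. x \<notin> K \<Longrightarrow> pd i \<phi> x = 0"
    "\<And>x. \<bar>\<phi> x\<bar> \<le> B" "\<And>x. \<bar>pd i \<phi> x\<bar> \<le> B"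
  using test_function_support[OF assms] test_function_bounded[OF assms, of i] by metis

lemma L1loc_AE:
  assumes u: "L1loc W u" and W: "open W" and ae: "AE x in lebesgue_on W. u x = v x"
  shows "L1loc W v"
  unfolding L1loc_def
proof (intro allI impI, elim conjE)
  fix K assume K: "compact K" "K \<subseteq> W"
  have 1: "integrable (lebesgue_on K) u" using u K by (auto simp: L1loc_def)
  have 2: "AE x in lebesgue_on K. u x = v x"
    using AE_lebesgue_on_subset[OF ae K(2) compact_lebesgue[OF K(1)] open_lebesgue[OF W]] .
  have "v \<in> borel_measurable (lebesgue_on K)"
    by (rule borel_measurable_lebesgue_on_AE[OF _ compact_lebesgue[OF K(1)] 2]) (use 1 in auto)
  then show "integrable (lebesgue_on K) v"
    using integrable_cong_AE[OF _ _ 2] 1 by auto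
qed

lemma test_integral_AE:
  fixes u v :: "real^2 \<Rightarrow> 'b::euclidean_space"
  assumes u: "L1loc W u" and W: "open W" and ae: "AE x in lebesgue_on W. u x = v x"
    and K: "compact K" "K \<subseteq> W" and f: "\<And>x. x \<notin> K \<Longrightarrow> f x = 0" "continuous_on UNIV f"
  shows "(LINT x|lebesgue_on W. f x *\<^sub>R u x) = (LINT x|lebesgue_on W. f x *\<^sub>R v x)"
proof -
  have ae: "AE x in lebesgue_on K. u x = v x"
    using AE_lebesgue_on_subset[OF ae K(2) compact_lebesgue[OF K(1)] open_lebesgue[OF W]] .
  have [measurable]: "u \<in> borel_measurable (lebesgue_on K)" using u K by (auto simp: L1loc_def)
  have [measurable]: "v \<in> borel_measurable (lebesgue_on K)"
    by (rule borel_measurable_lebesgue_on_AE[OF _ compact_lebesgue[OF K(1)] ae]) measurable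
  have [measurable]: "f \<in> borel_measurable (lebesgue_on K)" by (rule continuous_lebesgue_on_measurable[OF f(2)])
  have *: "(LINT x|lebesgue_on W. f x *\<^sub>R w x) = (LINT x|lebesgue_on K. f x *\<^sub>R w x)" for w :: "_ \<Rightarrow> 'b"
    using f(1) by (intro integral_lebesgue_on_support K(2) compact_lebesgue[OF K(1)] open_lebesgue[OF W]) auto
  show ?thesis
    unfolding * using ae by (intro integral_cong_AE) (auto elim: eventually_mono)
qed

lemma is_weak_partial_AE:
  assumes wp: "is_weak_partial W i u v" and W: "open W"
    and u: "AE x in lebesgue_on W. u x = u' x" and v: "AE x in lebesgue_on W. v x = v' x"
  shows "is_weak_partial W i u' v'"
  unfolding is_weak_partial_def
proof (intro conjI allI impI)
  have L: "L1loc W u" "L1loc W v" using wp by (auto simp: is_weak_partial_def)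
  show "L1loc W u'" using L1loc_AE[OF L(1) W u] .
  show "L1loc W v'" using L1loc_AE[OF L(2) W v] .
  fix \<phi> assume \<phi>: "test_function W \<phi>"
  obtain K where K: "compact K" "K \<subseteq> W" "\<And>x. x \<notin> K \<Longrightarrow> \<phi> x = 0" "\<And>x i. x \<notin> K \<Longrightarrow> pd i \<phi> x = 0"
    using test_function_support[OF \<phi>] by blast
  have "(LINT x|lebesgue_on W. pd i \<phi> x *\<^sub>R u x) = - (LINT x|lebesgue_on W. \<phi> x *\<^sub>R v x)"
    using wp \<phi> by (auto simp: is_weak_partial_def)
  then show "(LINT x|lebesgue_on W. pd i \<phi> x *\<^sub>R u' x) = - (LINT x|lebesgue_on W. \<phi> x *\<^sub>R v' x)"
    using test_integral_AE[OF L(1) W u K(1,2) K(4) test_function_pd_continuous[OF \<phi>]]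
      test_integral_AE[OF L(2) W v K(1,2) K(3) test_function_continuous[OF \<phi>]] by simp
qed

lemma L1loc_test_integrable:
  assumes u: "L1loc W u" and K: "compact K" "K \<subseteq> W" and f: "continuous_on UNIV f" "\<And>x. \<bar>f x\<bar> \<le> B"
  shows "integrable (lebesgue_on K) (\<lambda>x. f x *\<^sub>R u x)"
  using u K by (intro integrable_bounded_scaleR[where B=B] continuous_lebesgue_on_measurable f) (auto simp: L1loc_def)

text \<open>The fundamental lemma applied to the difference. This makes the choice in
  \<open>weak_partial\<close> harmless up to null sets.\<close>

lemma is_weak_partial_unique:
  assumes W: "open W" and v: "is_weak_partial W i u v" and w: "is_weak_partial W i u w"
  shows "AE x in lebesgue_on W. v x = w x"
proof -
  have L: "L1loc W v" "L1loc W w" using v w by (auto simp: is_weak_partial_def)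
  have "AE x in lebesgue. x \<in> W \<longrightarrow> v x - w x = 0"
  proof (rule fundamental_lemma[OF W])
    show "L1loc W (\<lambda>x. v x - w x)" using L by (auto simp: L1loc_def)
    fix \<phi> assume \<phi>: "test_function W \<phi>"
    obtain K B where K: "compact K" "K \<subseteq> W" "\<And>x. x \<notin> K \<Longrightarrow> \<phi> x = 0" "\<And>x. \<bar>\<phi> x\<bar> \<le> B"
      using test_function_compact[OF \<phi>] by metis
    have *: "(LINT x|lebesgue_on W. \<phi> x *\<^sub>R w x) = (LINT x|lebesgue_on K. \<phi> x *\<^sub>R w x)" for w :: "_ \<Rightarrow> 'a"
      using K(3) by (intro integral_lebesgue_on_support K(2) compact_lebesgue[OF K(1)] open_lebesgue[OF W]) auto
    have "(LINT x|lebesgue_on W. \<phi> x *\<^sub>R v x) = (LINT x|lebesgue_on W. \<phi> x *\<^sub>R w x)"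
      using v w \<phi> by (auto simp: is_weak_partial_def)
    then show "(LINT x|lebesgue_on W. \<phi> x *\<^sub>R (v x - w x)) = 0"
      unfolding * using L1loc_test_integrable[OF L(1) K(1,2) test_function_continuous[OF \<phi>] K(4)]
        L1loc_test_integrable[OF L(2) K(1,2) test_function_continuous[OF \<phi>] K(4)]
      by (simp add: scaleR_diff_right)
  qed
  then show ?thesis by (simp add: AE_lebesgue_on_iff open_lebesgue[OF W])
qed

text \<open>Translation by a unit vector does not change the integral of \<open>\<phi>\<close>.
  Writing the change as an integral of derivatives and exchanging integrals leaves exactly the
  integral of \<open>pd i \<phi>\<close>.\<close>

lemma integral_pd_test_function:
  assumes \<phi>: "test_function W \<phi>"
  shows "integrable lborel (pd i \<phi>)" "(LINT x|lborel. pd i \<phi> x) = 0"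
proof -
  obtain K B where K: "compact K" "\<And>x. x \<notin> K \<Longrightarrow> \<phi> x = 0" "\<And>x i. x \<notin> K \<Longrightarrow> pd i \<phi> x = 0"
    using test_function_support[OF \<phi>] by metis
  have int: "integrable lborel f" if "continuous_on UNIV f" "\<And>x. x \<notin> K \<Longrightarrow> f x = 0" for f :: "real^2 \<Rightarrow> real"
  proof -
    have "f = (\<lambda>x. indicator K x *\<^sub>R f x)" by (rule ext) (use that(2) in \<open>auto simp: indicator_def\<close>)
    then show ?thesis
      using borel_integrable_compact[OF K(1), of f] that(1) continuous_on_subset
      by (metis (no_types, lifting) set_integrable_def subset_UNIV)
  qed
  have i1: "integrable lborel \<phi>" using test_function_continuous[OF \<phi>] K(2) by (rule int)
  have i2: "integrable lborel (pd i \<phi>)" using test_function_pd_continuous[OF \<phi>] K(3) by (rule int)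
  let ?e = "axis i 1 :: real^2"
  have m[measurable]: "\<phi> \<in> borel_measurable borel" "pd i \<phi> \<in> borel_measurable borel" using i1 i2 by auto
  have sh: "(LINT x|lborel. f (x - c)) = (LINT x|lborel. f x)" if "f \<in> borel_measurable borel" for f :: "real^2 \<Rightarrow> real" and c
    using integral_lborel_shift[of f "-c"] that by simp
  have "0 = (LINT x|lborel. \<phi> x) - (LINT x|lborel. \<phi> (x - 1 *\<^sub>R ?e))" by (subst sh) auto
  also have "\<dots> = (LINT x|lborel. \<phi> x - \<phi> (x - 1 *\<^sub>R ?e))"
    using integrable_lborel_shift[OF i1, of "- (1 *\<^sub>R ?e)"] i1 by simp
  also have "\<dots> = (LINT x|lborel. LINT s|lborel. indicator {0..1} s *\<^sub>R pd i \<phi> (x - s *\<^sub>R ?e))"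
    by (intro Bochner_Integration.integral_cong refl test_function_FTC[OF \<phi>]) simp
  also have "\<dots> = (LINT s|lborel. LINT x|lborel. indicator {0..1} s *\<^sub>R pd i \<phi> (x - s *\<^sub>R ?e))"
    by (rule lborel_pair.Fubini_integral) (use integrable_translates[OF i2, of 1 "-?e"] in simp)
  also have "\<dots> = (LINT s|lborel. indicator {0..1::real} s *\<^sub>R (LINT x|lborel. pd i \<phi> x))"
    by (simp only: integral_scaleR_right sh[OF m(2)])
  also have "\<dots> = (LINT x|lborel. pd i \<phi> x)" by simp
  finally show "(LINT x|lborel. pd i \<phi> x) = 0" by simp
  show "integrable lborel (pd i \<phi>)" by (rule i2)
qed

lemma is_weak_partial_add_const:
  fixes u :: "real^2 \<Rightarrow> 'b::euclidean_space"
  assumes W: "open W" and wp: "is_weak_partial W i u v"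
  shows "is_weak_partial W i (\<lambda>x. u x + c) v"
  unfolding is_weak_partial_def
proof (intro conjI allI impI)
  have L: "L1loc W u" "L1loc W v" using wp by (auto simp: is_weak_partial_def)
  have Lc: "L1loc W (\<lambda>x. c)" by (intro L2loc_L1loc L2loc_const)
  show "L1loc W (\<lambda>x. u x + c)" using L Lc by (auto simp: L1loc_def)
  show "L1loc W v" by fact
  fix \<phi> assume \<phi>: "test_function W \<phi>"
  obtain K B where K: "compact K" "K \<subseteq> W" "\<And>x i. x \<notin> K \<Longrightarrow> pd i \<phi> x = 0" "\<And>x. \<bar>pd i \<phi> x\<bar> \<le> B"
    using test_function_compact[OF \<phi>, of i] by metis
  have *: "(LINT x|lebesgue_on W. pd i \<phi> x *\<^sub>R w x) = (LINT x|lebesgue_on K. pd i \<phi> x *\<^sub>R w x)" for w :: "_ \<Rightarrow> 'b"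
    using K(3) by (intro integral_lebesgue_on_support K(2) compact_lebesgue[OF K(1)] open_lebesgue[OF W]) auto
  have "(LINT x|lebesgue_on W. pd i \<phi> x *\<^sub>R c) = (LINT x|lborel. pd i \<phi> x *\<^sub>R c)"
    by (rule test_integral_lborel(2)[OF W order_refl \<phi>]) auto
  also have "\<dots> = 0"
    using integral_pd_test_function[OF \<phi>, of i] by simp
  finally have "(LINT x|lebesgue_on W. pd i \<phi> x *\<^sub>R (u x + c)) = (LINT x|lebesgue_on W. pd i \<phi> x *\<^sub>R u x)"
    unfolding * using L1loc_test_integrable[OF L(1) K(1,2) test_function_pd_continuous[OF \<phi>] K(4)]
        L1loc_test_integrable[OF Lc K(1,2) test_function_pd_continuous[OF \<phi>] K(4)]
    by (simp add: scaleR_add_right)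
  also have "\<dots> = - (LINT x|lebesgue_on W. \<phi> x *\<^sub>R v x)" using wp \<phi> by (auto simp: is_weak_partial_def)
  finally show "(LINT x|lebesgue_on W. pd i \<phi> x *\<^sub>R (u x + c)) = - (LINT x|lebesgue_on W. \<phi> x *\<^sub>R v x)" .
qed

lemma is_weak_partial_diff_const_iff:
  fixes u :: "real^2 \<Rightarrow> 'b::euclidean_space"
  assumes W: "open W"
  shows "is_weak_partial W i (\<lambda>x. u x - c) v \<longleftrightarrow> is_weak_partial W i u v"
  using is_weak_partial_add_const[OF W, of i u v "-c"] is_weak_partial_add_const[OF W, of i "\<lambda>x. u x - c" v c] by auto

text \<open>A genuine equality and not merely one up to null sets, because the predicates under the
  choice operator coincide.\<close>

lemma weak_partial_diff_const: "open W \<Longrightarrow> weak_partial W i (\<lambda>x. u x - c) = weak_partial W i u"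
  by (simp add: weak_partial_def is_weak_partial_diff_const_iff)

lemma weak_partial_works: "is_weak_partial W i u v \<Longrightarrow> is_weak_partial W i u (weak_partial W i u)"
  unfolding weak_partial_def by (rule someI[of "\<lambda>v. is_weak_partial W i u v"])

lemma Hloc_AE:
  "Hloc k W u \<Longrightarrow> open W \<Longrightarrow> AE x in lebesgue_on W. u x = u' x \<Longrightarrow> Hloc k W u'"
proof (cases k)
  case (Suc m)
  assume *: "Hloc k W u" "open W" "AE x in lebesgue_on W. u x = u' x"
  have "\<exists>v. is_weak_partial W i u' v \<and> Hloc m W v" for i
  proof -
    obtain v where "is_weak_partial W i u v" "Hloc m W v" using * Suc by auto
    then show ?thesis using is_weak_partial_AE[OF _ *(2,3), of i v v] by auto
  qed
  then show ?thesis using * Suc by (auto intro: L2loc_AE)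
qed (auto intro: L2loc_AE)

text \<open>Uniqueness up to null sets and invariance of \<open>Hloc\<close> under such changes let
  the chosen \<open>weak_partial\<close> replace the existentially bound derivative.\<close>

lemma Hloc_Suc_iff:
  assumes "open W"
  shows "Hloc (Suc k) W u \<longleftrightarrow> L2loc W u \<and>
    (\<forall>i. is_weak_partial W i u (weak_partial W i u) \<and> Hloc k W (weak_partial W i u))"
proof
  assume *: "Hloc (Suc k) W u"
  have "is_weak_partial W i u (weak_partial W i u) \<and> Hloc k W (weak_partial W i u)" for i
  proof -
    obtain v where v: "is_weak_partial W i u v" "Hloc k W v" using * by auto
    have w: "is_weak_partial W i u (weak_partial W i u)" using weak_partial_works[OF v(1)] .
    then show ?thesis using Hloc_AE[OF v(2) assms is_weak_partial_unique[OF assms v(1) w]] by simp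
  qed
  then show "L2loc W u \<and> (\<forall>i. is_weak_partial W i u (weak_partial W i u) \<and> Hloc k W (weak_partial W i u))"
    using * by simp
qed auto

text \<open>Weak $L^2$ compactness of the derivatives: every cluster point is the weak derivative of the limit,
  so that uniqueness yields convergence of the whole sequence.\<close>

lemma weak_partial_closed:
  fixes u w :: "nat \<Rightarrow> real^2 \<Rightarrow> 'b::euclidean_space"
  assumes W: "open W" and u: "weakly_conv_L2loc W u u0"
    and wp: "\<And>n. is_weak_partial W i (u n) (w n)" and w: "L2_bounded W w"
  obtains w0 where "is_weak_partial W i u0 w0" "weakly_conv_L2loc W w w0"
proof -
  \<comment> \<open>Stated for an arbitrary subsequence: its cluster point inherits the integration
    by parts, because the pairings of \<open>u\<close> with derivatives of test functions
    converge.\<close>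
  have cluster: "\<exists>v. L2loc W v \<and> is_weak_partial W i u0 v \<and>
     (\<forall>K h l. compact K \<longrightarrow> K \<subseteq> W \<longrightarrow> L2_on K h \<longrightarrow> (\<lambda>n. LINT x|lebesgue_on K. w (s n) x \<bullet> h x) \<longlonglongrightarrow> l \<longrightarrow>
        (LINT x|lebesgue_on K. v x \<bullet> h x) = l)" if s: "strict_mono s" for s :: "nat \<Rightarrow> nat"
  proof -
    obtain v where v: "L2loc W v" "\<And>K h l. compact K \<Longrightarrow> K \<subseteq> W \<Longrightarrow> L2_on K h \<Longrightarrow>
      (\<lambda>n. LINT x|lebesgue_on K. w (s n) x \<bullet> h x) \<longlonglongrightarrow> l \<Longrightarrow> (LINT x|lebesgue_on K. v x \<bullet> h x) = l"
      by (rule L2_bounded_weak_cluster[OF W L2_bounded_subseq[OF w, of s]], rule that)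
    have u0: "L2loc W u0" and un: "L2loc W (u n)" for n using u by (auto simp: weakly_conv_L2loc_def)
    have wn: "L2loc W (w n)" for n using L2_bounded_L2loc[OF w] .
    have wpv: "is_weak_partial W i u0 v"
      unfolding is_weak_partial_def
    proof (intro conjI allI impI)
      show "L1loc W u0" "L1loc W v" using u0 v(1) by (auto intro: L2loc_L1loc)
      fix \<phi> assume \<phi>: "test_function W \<phi>"
      obtain K B where K: "compact K" "K \<subseteq> W" "\<And>x. x \<notin> K \<Longrightarrow> \<phi> x = 0" "\<And>x i. x \<notin> K \<Longrightarrow> pd i \<phi> x = 0"
        "\<And>x. \<bar>\<phi> x\<bar> \<le> B" "\<And>x. \<bar>pd i \<phi> x\<bar> \<le> B"
        by (rule test_function_compact[OF \<phi>, of i], rule that)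
      note cont = test_function_continuous[OF \<phi>] test_function_pd_continuous[OF \<phi>, of i]
      \<comment> \<open>Vector-valued integrals are compared along each \<open>b\<close>; these
        components are pairings with the compactly supported function
        \<open>f x *\<^sub>R b\<close>.\<close>
      have inn: "(LINT x|lebesgue_on W. f x *\<^sub>R p x) \<bullet> b = (LINT x|lebesgue_on K. p x \<bullet> (f x *\<^sub>R b))"
        if p: "L2loc W p" and f: "continuous_on UNIV f" "\<And>x. \<bar>f x\<bar> \<le> B" "\<And>x. x \<notin> K \<Longrightarrow> f x = 0" for f p and b :: 'b
      proof -
        have "(LINT x|lebesgue_on W. f x *\<^sub>R p x) = (LINT x|lebesgue_on K. f x *\<^sub>R p x)"
          using f(3) by (intro integral_lebesgue_on_support K(2) compact_lebesgue[OF K(1)] open_lebesgue[OF W]) auto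
        then show ?thesis
          using L1loc_test_integrable[OF L2loc_L1loc[OF p] K(1,2) f(1,2)]
          by (simp add: integral_inner_left[symmetric])
      qed
      have L2: "L2_on K (\<lambda>x. f x *\<^sub>R b)" if f: "continuous_on UNIV f" "\<And>x. \<bar>f x\<bar> \<le> B" for f and b :: 'b
        by (rule L2_on_bounded_scaleR[OF L2_on_const[OF K(1)] continuous_lebesgue_on_measurable[OF f(1)] f(2)])
      have "(LINT x|lebesgue_on W. pd i \<phi> x *\<^sub>R u0 x) \<bullet> b = (- (LINT x|lebesgue_on W. \<phi> x *\<^sub>R v x)) \<bullet> b" for b
      proof -
        have "(\<lambda>n. LINT x|lebesgue_on K. u n x \<bullet> (pd i \<phi> x *\<^sub>R b)) \<longlonglongrightarrow> (LINT x|lebesgue_on K. u0 x \<bullet> (pd i \<phi> x *\<^sub>R b))"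
          using u K(1,2) L2[OF cont(2) K(6)] unfolding weakly_conv_L2loc_def by blast
        from LIMSEQ_subseq_LIMSEQ[OF this s]
        have "(\<lambda>n. LINT x|lebesgue_on K. u (s n) x \<bullet> (pd i \<phi> x *\<^sub>R b)) \<longlonglongrightarrow> (LINT x|lebesgue_on K. u0 x \<bullet> (pd i \<phi> x *\<^sub>R b))"
          by (simp add: o_def)
        then have "(\<lambda>n. - (LINT x|lebesgue_on K. u (s n) x \<bullet> (pd i \<phi> x *\<^sub>R b))) \<longlonglongrightarrow> - (LINT x|lebesgue_on K. u0 x \<bullet> (pd i \<phi> x *\<^sub>R b))"
          by (rule tendsto_minus)
        moreover have "- (LINT x|lebesgue_on K. u n x \<bullet> (pd i \<phi> x *\<^sub>R b)) = (LINT x|lebesgue_on K. w n x \<bullet> (\<phi> x *\<^sub>R b))" for n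
        proof -
          have "(LINT x|lebesgue_on W. pd i \<phi> x *\<^sub>R u n x) = - (LINT x|lebesgue_on W. \<phi> x *\<^sub>R w n x)"
            using wp \<phi> by (auto simp: is_weak_partial_def)
          then have eq: "(LINT x|lebesgue_on W. pd i \<phi> x *\<^sub>R u n x) \<bullet> b = - ((LINT x|lebesgue_on W. \<phi> x *\<^sub>R w n x) \<bullet> b)" by simp
          have A: "(LINT x|lebesgue_on W. pd i \<phi> x *\<^sub>R u n x) \<bullet> b = (LINT x|lebesgue_on K. u n x \<bullet> (pd i \<phi> x *\<^sub>R b))"
            by (rule inn[OF un cont(2) K(6) K(4)])
          have B: "(LINT x|lebesgue_on W. \<phi> x *\<^sub>R w n x) \<bullet> b = (LINT x|lebesgue_on K. w n x \<bullet> (\<phi> x *\<^sub>R b))"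
            by (rule inn[OF wn cont(1) K(5) K(3)])
          show ?thesis using eq unfolding A B by linarith
        qed
        ultimately have "(LINT x|lebesgue_on K. v x \<bullet> (\<phi> x *\<^sub>R b)) = - (LINT x|lebesgue_on K. u0 x \<bullet> (pd i \<phi> x *\<^sub>R b))"
          by (intro v(2) K(1,2) L2[OF cont(1) K(5)]) simp
        moreover have "(LINT x|lebesgue_on W. pd i \<phi> x *\<^sub>R u0 x) \<bullet> b = (LINT x|lebesgue_on K. u0 x \<bullet> (pd i \<phi> x *\<^sub>R b))"
          by (rule inn[OF u0 cont(2) K(6) K(4)])
        moreover have "(LINT x|lebesgue_on W. \<phi> x *\<^sub>R v x) \<bullet> b = (LINT x|lebesgue_on K. v x \<bullet> (\<phi> x *\<^sub>R b))"
          by (rule inn[OF v(1) cont(1) K(5) K(3)])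
        ultimately show ?thesis
          unfolding inner_minus_left by linarith
      qed
      then show "(LINT x|lebesgue_on W. pd i \<phi> x *\<^sub>R u0 x) = - (LINT x|lebesgue_on W. \<phi> x *\<^sub>R v x)"
        by (rule euclidean_eqI)
    qed
    show ?thesis
      by (intro exI[of _ v] conjI allI impI v(1) wpv) (rule v(2))
  qed
  obtain w0 where w0: "L2loc W w0" "is_weak_partial W i u0 w0" using cluster[of id] strict_mono_id by auto
  have "weakly_conv_L2loc W w w0"
    unfolding weakly_conv_L2loc_def
  proof (intro conjI allI impI)
    show "L2loc W (w n)" for n using L2_bounded_L2loc[OF w] .
    show "L2loc W w0" by fact
    fix K and h :: "real^2 \<Rightarrow> 'b" assume "compact K \<and> K \<subseteq> W \<and> L2_on K h"
    then have K: "compact K" "K \<subseteq> W" and h: "L2_on K h" by auto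
    obtain C where C: "\<And>n. L2_on K (w n)" "\<And>n. (LINT x|lebesgue_on K. (norm (w n x))\<^sup>2) \<le> C"
      using L2_boundedD[OF w K] by blast
    show "(\<lambda>n. LINT x|lebesgue_on K. w n x \<bullet> h x) \<longlonglongrightarrow> (LINT x|lebesgue_on K. w0 x \<bullet> h x)"
    proof (rule tendsto_if_subseqs)
      fix r :: "nat \<Rightarrow> nat" assume r: "strict_mono r"
      \<comment> \<open>Only numbers are extracted here: for fixed \<open>K\<close> and
        \<open>h\<close> the pairings are bounded reals, and the cluster point of the further
        subsequence identifies their limit.\<close>
      have "bounded (range (\<lambda>n. LINT x|lebesgue_on K. w (r n) x \<bullet> h x))"
      proof (rule boundedI, clarify)
        fix n
        have "norm (LINT x|lebesgue_on K. w (r n) x \<bullet> h x) \<le> (LINT x|lebesgue_on K. norm (w (r n) x \<bullet> h x))"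
          by (rule integral_norm_bound)
        also have "\<dots> \<le> (LINT x|lebesgue_on K. (norm (w (r n) x))\<^sup>2 + (norm (h x))\<^sup>2)"
        proof (rule integral_mono)
          show "integrable (lebesgue_on K) (\<lambda>x. norm (w (r n) x \<bullet> h x))"
            using L2_on_integrable_inner[OF C(1) h] by auto
          show "integrable (lebesgue_on K) (\<lambda>x. (norm (w (r n) x))\<^sup>2 + (norm (h x))\<^sup>2)"
            using C(1) h by (auto simp: L2_on_def)
          fix x
          have "norm (w (r n) x \<bullet> h x) \<le> norm (w (r n) x) * norm (h x)" using Cauchy_Schwarz_ineq2 by simp
          moreover have "0 \<le> norm (w (r n) x) * norm (h x)" by simp
          ultimately show "norm (w (r n) x \<bullet> h x) \<le> (norm (w (r n) x))\<^sup>2 + (norm (h x))\<^sup>2"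
            using sum_squares_bound[of "norm (w (r n) x)" "norm (h x)"] by linarith
        qed
        also have "\<dots> \<le> C + (LINT x|lebesgue_on K. (norm (h x))\<^sup>2)"
          using C h by (auto simp: L2_on_def)
        finally show "norm (LINT x|lebesgue_on K. w (r n) x \<bullet> h x) \<le> C + (LINT x|lebesgue_on K. (norm (h x))\<^sup>2)" .
      qed
      from bounded_imp_convergent_subsequence[OF this] obtain l s where s: "strict_mono s"
        "(\<lambda>n. LINT x|lebesgue_on K. w (r (s n)) x \<bullet> h x) \<longlonglongrightarrow> l" by (auto simp: o_def)
      have "strict_mono (\<lambda>n. r (s n))" using r s(1) by (auto simp: strict_mono_def)
      from cluster[OF this] obtain v where v: "is_weak_partial W i u0 v"
        "\<And>K h l. compact K \<Longrightarrow> K \<subseteq> W \<Longrightarrow> L2_on K h \<Longrightarrow> (\<lambda>n. LINT x|lebesgue_on K. w (r (s n)) x \<bullet> h x) \<longlonglongrightarrow> l \<Longrightarrow>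
        (LINT x|lebesgue_on K. v x \<bullet> h x) = l" "L2loc W v" by blast
      \<comment> \<open>The cluster point may depend on the subsequence, but as a weak derivative of
        \<open>u0\<close> it agrees with \<open>w0\<close> almost everywhere.\<close>
      have ae: "AE x in lebesgue_on K. v x = w0 x"
        using AE_lebesgue_on_subset[OF is_weak_partial_unique[OF W v(1) w0(2)] K(2) compact_lebesgue[OF K(1)] open_lebesgue[OF W]] .
      have [measurable]: "v \<in> borel_measurable (lebesgue_on K)" "w0 \<in> borel_measurable (lebesgue_on K)" "h \<in> borel_measurable (lebesgue_on K)"
        using v(3) w0(1) K h by (auto simp: L2loc_def L2_on_def)
      have "l = (LINT x|lebesgue_on K. v x \<bullet> h x)" using v(2)[OF K h s(2)] by simp
      also have "\<dots> = (LINT x|lebesgue_on K. w0 x \<bullet> h x)"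
        using ae by (intro integral_cong_AE) (auto elim: eventually_mono)
      finally show "\<exists>s. strict_mono s \<and> (\<lambda>n. LINT x|lebesgue_on K. w (r (s n)) x \<bullet> h x) \<longlonglongrightarrow> (LINT x|lebesgue_on K. w0 x \<bullet> h x)"
        using s by blast
    qed
  qed
  with w0(2) show thesis by (rule that)
qed

section \<open>The theorems of Poincare and Rellich\<close>

lemma L2sq_lborel:
  fixes f f0 :: "'a::euclidean_space \<Rightarrow> 'b::euclidean_space"
  assumes K: "K \<in> sets borel" and ae: "AE x in lebesgue. x \<in> K \<longrightarrow> f x = f0 x"
  shows "L2sq (lebesgue_on K) f = (\<integral>\<^sup>+x. indicator K x * sqnorm (f0 x) \<partial>lborel)"
proof -
  have "L2sq (lebesgue_on K) f = (\<integral>\<^sup>+x. indicator K x * sqnorm (f x) \<partial>lebesgue)"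
    using L2sq_lebesgue_on[of K UNIV f] K by (simp add: lebesgue_on_UNIV_eq sets_completionI_sets)
  also have "\<dots> = (\<integral>\<^sup>+x. indicator K x * sqnorm (f0 x) \<partial>lebesgue)"
    using ae by (intro nn_integral_cong_AE) (auto elim!: eventually_mono simp: indicator_def)
  also have "\<dots> = (\<integral>\<^sup>+x. indicator K x * sqnorm (f0 x) \<partial>lborel)"
    by (rule nn_integral_completion)
  finally show ?thesis .
qed

lemma L2sq_box_cbox:
  "L2sq (lebesgue_on (box a b)) f = L2sq (lebesgue_on (cbox a b)) (f :: 'a::euclidean_space \<Rightarrow> 'b::euclidean_space)"
proof -
  have "AE x in lebesgue. x \<in> cbox a b \<longrightarrow> x \<in> box a b"
    using AE_box_cbox[of a b "\<lambda>x. x \<in> box a b"] by simp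
  then have "AE x in lebesgue. indicator (box a b) x * sqnorm (f x) = indicator (cbox a b) x * sqnorm (f x)"
    by eventually_elim (use box_subset_cbox[of a b] in \<open>auto simp: indicator_def\<close>)
  then show ?thesis
    using L2sq_lebesgue_on[of "box a b" UNIV f] L2sq_lebesgue_on[of "cbox a b" UNIV f]
    by (simp add: lebesgue_on_UNIV_eq sets_completionI_sets nn_integral_cong_AE)
qed

lemma weak_partial_box_reps:
  fixes u :: "real^2 \<Rightarrow> 'b::euclidean_space"
  assumes W: "open W" "cbox a b \<subseteq> W" and wp: "\<And>i. is_weak_partial W i u (v i)"
  obtains u0 v0 where "\<And>i. weak_partial_box i a b u0 (v0 i)"
    "AE x in lebesgue. x \<in> cbox a b \<longrightarrow> u x = u0 x" "\<And>i. AE x in lebesgue. x \<in> cbox a b \<longrightarrow> v i x = v0 i x"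
proof -
  have L: "L1loc W u" "L1loc W (v i)" for i using wp[of i] by (auto simp: is_weak_partial_def)
  have rep: "\<exists>w0. w0 \<in> borel_measurable borel \<and> integrable lborel w0 \<and> (AE x in lebesgue. x \<in> cbox a b \<longrightarrow> w x = w0 x)"
    if w: "L1loc W w" for w :: "real^2 \<Rightarrow> 'b"
  proof -
    have wi: "integrable (lebesgue_on (cbox a b)) w" using w W(2) by (auto simp: L1loc_def)
    have cb: "cbox a b \<in> sets borel" by simp
    obtain w0 where "w0 \<in> borel_measurable borel" "integrable lborel w0" "AE x in lebesgue. x \<in> cbox a b \<longrightarrow> w x = w0 x"
      by (rule integrable_borel_rep[OF wi cb], rule that)
    then show ?thesis by blast
  qed
  obtain u0 where u0: "u0 \<in> borel_measurable borel" "integrable lborel u0" "AE x in lebesgue. x \<in> cbox a b \<longrightarrow> u x = u0 x"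
    using rep[OF L(1)] by blast
  have "\<forall>i. \<exists>w0. w0 \<in> borel_measurable borel \<and> integrable lborel w0 \<and> (AE x in lebesgue. x \<in> cbox a b \<longrightarrow> v i x = w0 x)"
    using rep[OF L(2)] by blast
  from choice[OF this] obtain v0 where "\<forall>i. v0 i \<in> borel_measurable borel \<and> integrable lborel (v0 i) \<and> (AE x in lebesgue. x \<in> cbox a b \<longrightarrow> v i x = v0 i x)"
    by blast
  then have v0: "\<And>i. v0 i \<in> borel_measurable borel" "\<And>i. integrable lborel (v0 i)" "\<And>i. AE x in lebesgue. x \<in> cbox a b \<longrightarrow> v i x = v0 i x"
    by auto
  have sub: "box a b \<subseteq> W" using W(2) box_subset_cbox by blast
  have "weak_partial_box i a b u0 (v0 i)" for i
    unfolding weak_partial_box_def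
  proof (intro conjI allI impI)
    fix \<phi> assume \<phi>: "test_function (box a b) \<phi>"
    have "(LINT x|lebesgue_on W. pd i \<phi> x *\<^sub>R u x) = - (LINT x|lebesgue_on W. \<phi> x *\<^sub>R v i x)"
      using wp[of i] test_function_subset[OF \<phi> sub] by (auto simp: is_weak_partial_def)
    then show "(LINT x|lborel. pd i \<phi> x *\<^sub>R u0 x) = - (LINT x|lborel. \<phi> x *\<^sub>R v0 i x)"
      unfolding test_integral_lborel(2)[OF W(1) sub \<phi> u0(1) u0(3)[folded AE_box_cbox]]
        test_integral_lborel(1)[OF W(1) sub \<phi> v0(1) v0(3)[folded AE_box_cbox]] .
  qed (use u0 v0 in auto)
  then show thesis using u0(3) v0(3) by (rule that)
qed

text \<open>Passing to Borel representatives does not change the averages, since each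
  \<open>S x\<close> lies in the box where they agree with the given functions.\<close>

lemma weak_gradient_average:
  fixes u :: "real^2 \<Rightarrow> 'b::euclidean_space"
  assumes W: "open W" "cbox a b \<subseteq> W" and wp: "\<And>i. is_weak_partial W i u (v i)"
    and S: "Measurable.pred (borel \<Otimes>\<^sub>M borel) (\<lambda>p. snd p \<in> S (fst p))" "\<And>x. S x \<in> sets borel"
    and P: "P \<in> sets borel" and PQ: "P \<subseteq> box a b"
    and SQ: "\<And>x. x \<in> P \<Longrightarrow> S x \<subseteq> box a b"
    and m: "\<And>x. x \<in> P \<Longrightarrow> emeasure lborel (S x) = ennreal m" "m > 0"
    and h: "\<And>x y i. x \<in> P \<Longrightarrow> y \<in> S x \<Longrightarrow> \<bar>y $ i - x $ i\<bar> \<le> h" "0 \<le> h"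
  shows "L2sq (lebesgue_on P) (\<lambda>x. u x - (1/m) *\<^sub>R (LINT y|lebesgue_on (cbox a b). indicator (S x) y *\<^sub>R u y))
    \<le> ennreal (8 * h^4 / m) * (\<Sum>i\<in>UNIV. L2sq (lebesgue_on (cbox a b)) (v i))"
proof -
  obtain u0 v0 where uv: "\<And>i. weak_partial_box i a b u0 (v0 i)"
    and u0: "AE x in lebesgue. x \<in> cbox a b \<longrightarrow> u x = u0 x" and v0: "\<And>i. AE x in lebesgue. x \<in> cbox a b \<longrightarrow> v i x = v0 i x"
    using weak_partial_box_reps[OF W wp] by blast
  have u0m: "u0 \<in> borel_measurable borel" using uv[of 1] by (auto simp: weak_partial_box_def)
  have S_eq: "(LINT y|lebesgue_on (cbox a b). indicator (S x) y *\<^sub>R u y) = (LINT y|lborel. indicator (S x) y *\<^sub>R u0 y)" if "x \<in> P" for x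
  proof (rule integral_lebesgue_on_eq_lborel(1)[where S="S x"])
    show "S x \<subseteq> cbox a b" using SQ[OF that] box_subset_cbox by blast
    then show "AE y in lebesgue. y \<in> S x \<longrightarrow> u y = u0 y" using u0 by (auto elim!: eventually_mono)
  qed (use S(2) u0m in auto)
  have ae: "AE x in lebesgue. x \<in> P \<longrightarrow> u x - (1/m) *\<^sub>R (LINT y|lebesgue_on (cbox a b). indicator (S x) y *\<^sub>R u y)
      = u0 x - (1/m) *\<^sub>R (LINT y|lborel. indicator (S x) y *\<^sub>R u0 y)"
    using u0 by eventually_elim (use S_eq PQ box_subset_cbox[of a b] in auto)
  have "L2sq (lebesgue_on P) (\<lambda>x. u x - (1/m) *\<^sub>R (LINT y|lebesgue_on (cbox a b). indicator (S x) y *\<^sub>R u y))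
    = (\<integral>\<^sup>+x. indicator P x * sqnorm (u0 x - (1/m) *\<^sub>R (LINT y|lborel. indicator (S x) y *\<^sub>R u0 y)) \<partial>lborel)"
    by (rule L2sq_lborel[OF P ae])
  also have "\<dots> \<le> ennreal (8 * h^4 / m) * (\<Sum>i\<in>UNIV. \<integral>\<^sup>+x. indicator (box a b) x * sqnorm (v0 i x) \<partial>lborel)"
    by (rule weak_gradient_box_average[OF uv S(1) P PQ SQ m h])
  also have "(\<Sum>i\<in>UNIV. \<integral>\<^sup>+x. indicator (box a b) x * sqnorm (v0 i x) \<partial>lborel) = (\<Sum>i\<in>UNIV. L2sq (lebesgue_on (cbox a b)) (v i))"
  proof (rule sum.cong[OF refl])
    fix i
    show "(\<integral>\<^sup>+x. indicator (box a b) x * sqnorm (v0 i x) \<partial>lborel) = L2sq (lebesgue_on (cbox a b)) (v i)"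
      using L2sq_lborel[of "box a b" "v i" "v0 i"] v0[of i, folded AE_box_cbox] by (simp add: L2sq_box_cbox)
  qed
  finally show ?thesis .
qed

text \<open>The averaging estimate with \<open>S x\<close> the whole box: \<open>\<beta>\<close> is
  the mean value and the diagonal length serves as \<open>h\<close>. The order of quantifiers makes
  \<open>C\<close> depend on the box alone.\<close>

lemma Poincare:
  fixes W :: "(real^2) set"
  assumes W: "open W" "cbox a b \<subseteq> W" and ne: "box a b \<noteq> {}"
  shows "\<exists>C. \<forall>(u :: real^2 \<Rightarrow> 'b::euclidean_space) v. (\<forall>i. is_weak_partial W i u (v i)) \<longrightarrow>
    (\<exists>\<beta>. L2sq (lebesgue_on (cbox a b)) (\<lambda>x. u x - \<beta>) \<le> ennreal C * (\<Sum>i\<in>UNIV. L2sq (lebesgue_on (cbox a b)) (v i)))"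
proof -
  define m where "m = measure lborel (box a b)"
  have fin: "emeasure lborel (box a b) < \<infinity>" by (rule emeasure_bounded_finite) simp
  then have m: "emeasure lborel (box a b) = ennreal m" by (simp add: m_def emeasure_eq_ennreal_measure less_top)
  have m0: "m > 0"
  proof -
    have "box a b \<notin> null_sets lebesgue"
      using open_not_negligible[OF open_box ne] by (simp add: negligible_iff_null_sets)
    then have "box a b \<notin> null_sets lborel" using null_sets_completionI by blast
    then have "ennreal m \<noteq> 0" unfolding m[symmetric] by auto
    then show ?thesis by (simp add: m_def zero_less_measure_iff)
  qed
  have "\<exists>\<beta>. L2sq (lebesgue_on (cbox a b)) (\<lambda>x. u x - \<beta>) \<le> ennreal (8 * (norm (b - a))^4 / m) * (\<Sum>i\<in>UNIV. L2sq (lebesgue_on (cbox a b)) (v i))"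
    if wp: "\<And>i. is_weak_partial W i u (v i)" for u :: "real^2 \<Rightarrow> 'b" and v
  proof -
    have "L2sq (lebesgue_on (box a b)) (\<lambda>x. u x - (1/m) *\<^sub>R (LINT y|lebesgue_on (cbox a b). indicator (box a b) y *\<^sub>R u y))
      \<le> ennreal (8 * (norm (b - a))^4 / m) * (\<Sum>i\<in>UNIV. L2sq (lebesgue_on (cbox a b)) (v i))"
    proof (rule weak_gradient_average[OF W wp])
      fix x y i assume "x \<in> box a b" "y \<in> box a b"
      then have "\<bar>y $ i - x $ i\<bar> \<le> \<bar>(b - a) $ i\<bar>" unfolding mem_box_cart by (smt (verit) vector_minus_component)
      also have "\<dots> \<le> norm (b - a)" by (rule component_le_norm_cart)
      finally show "\<bar>y $ i - x $ i\<bar> \<le> norm (b - a)" .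
    qed (use m m0 in auto)
    then show ?thesis unfolding L2sq_box_cbox by blast
  qed
  then show ?thesis by blast
qed

text \<open>Half-open squares of side 1/N. They partition the plane, and two floors name the cell of
  a point, so averages over cells are measurable step functions.\<close>

definition grid_cell :: "real \<Rightarrow> int \<Rightarrow> int \<Rightarrow> (real^2) set" where
  "grid_cell N k l = {y. \<lfloor>N * y $ 1\<rfloor> = k \<and> \<lfloor>N * y $ 2\<rfloor> = l}"

lemma grid_cell_borel[measurable]: "grid_cell N k l \<in> sets borel"
  unfolding grid_cell_def by measurable

lemma emeasure_grid_cell:
  assumes N: "N > 0" shows "emeasure lborel (grid_cell N k l) = ennreal (1 / N\<^sup>2)"
proof -
  define p :: "real^2" where "p = (\<chi> i. (if i = 1 then of_int k else of_int l) / N)"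
  define q :: "real^2" where "q = (\<chi> i. ((if i = 1 then of_int k else of_int l) + 1) / N)"
  have le: "p $ i \<le> q $ i" for i using N by (simp add: p_def q_def divide_right_mono)
  have sub: "box p q \<subseteq> grid_cell N k l" "grid_cell N k l \<subseteq> cbox p q"
    using N by (auto simp: grid_cell_def mem_box_cart forall_2 p_def q_def floor_eq_iff field_simps)
  have "measure lborel (cbox p q) = 1 / N\<^sup>2"
    using le N by (subst content_cbox_cart) (auto simp: interval_eq_empty_cart not_less UNIV_2 p_def q_def power2_eq_square diff_divide_distrib[symmetric])
  then have c: "emeasure lborel (cbox p q) = ennreal (1 / N\<^sup>2)"
    by (metis emeasure_eq_ennreal_measure emeasure_lborel_cbox_finite infinity_ennreal_def less_top)
  have "emeasure lborel (box p q) = emeasure lborel (cbox p q)"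
    using le by (simp add: emeasure_lborel_box_eq emeasure_lborel_cbox_eq)
  then show ?thesis
    using c emeasure_mono[OF sub(1), of lborel] emeasure_mono[OF sub(2), of lborel] by (auto intro: antisym)
qed

text \<open>Fine grid cells around points of the inner box must stay in the outer one; half of the
  smallest gap between corresponding sides suffices.\<close>

lemma cbox_subset_box_margin:
  fixes a b c d :: "real^2"
  assumes "cbox c d \<subseteq> box a b" "cbox c d \<noteq> {}"
  obtains \<delta> where "\<delta> > 0" "\<And>x y. x \<in> cbox c d \<Longrightarrow> (\<And>i. \<bar>y $ i - x $ i\<bar> \<le> \<delta>) \<Longrightarrow> y \<in> box a b"
proof -
  have "c \<in> cbox c d" "d \<in> cbox c d" using assms(2) by (auto simp: interval_ne_empty_cart mem_box_cart)
  then have cd: "a $ i < c $ i" "d $ i < b $ i" for i using assms(1) by (auto simp: mem_box_cart subset_iff)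
  define \<delta> where "\<delta> = min (min (c $ 1 - a $ 1) (c $ 2 - a $ 2)) (min (b $ 1 - d $ 1) (b $ 2 - d $ 2)) / 2"
  have "\<delta> > 0" using cd by (simp add: \<delta>_def)
  moreover have d: "\<delta> < c $ i - a $ i" "\<delta> < b $ i - d $ i" for i
    using cd[of 1] cd[of 2] exhaust_2[of i] by (auto simp: \<delta>_def min_def)
  have "y \<in> box a b" if "x \<in> cbox c d" "\<And>i. \<bar>y $ i - x $ i\<bar> \<le> \<delta>" for x y
    unfolding mem_box_cart
  proof
    fix i
    show "a $ i < y $ i \<and> y $ i < b $ i"
      using that(1) that(2)[of i] d[of i] unfolding mem_box_cart by (smt (verit))
  qed
  ultimately show thesis by (rule that)
qed

text \<open>The diagonal sequence without an initial segment refines the j-th subsequence, so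
  \<open>stable\<close> gives \<open>P j\<close> for it; \<open>tail\<close> restores the initial
  segment.\<close>

lemma diagonal_subsequence:
  fixes P :: "nat \<Rightarrow> (nat \<Rightarrow> nat) \<Rightarrow> bool"
  assumes ex: "\<And>j (s :: nat \<Rightarrow> nat). strict_mono s \<Longrightarrow> \<exists>r :: nat \<Rightarrow> nat. strict_mono r \<and> P j (s \<circ> r)"
    and stable: "\<And>j s (r :: nat \<Rightarrow> nat). strict_mono r \<Longrightarrow> P j s \<Longrightarrow> P j (s \<circ> r)"
    and tail: "\<And>j s k. P j (\<lambda>n. s (k + n)) \<Longrightarrow> P j s"
  obtains r where "strict_mono r" "\<And>j. P j r"
proof -
  interpret subseqs P by unfold_locales (rule ex)
  have "P j (diagseq \<circ> ((+) (Suc j)))" for j by (rule diagseq_holds) (rule stable)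
  then have "P j diagseq" for j by (intro tail[of j diagseq "Suc j"]) (simp add: o_def)
  then show thesis using subseq_diagseq by (intro that)
qed

lemma diagonal_bounded_subsequence:
  fixes x :: "'c::countable \<Rightarrow> nat \<Rightarrow> 'b::heine_borel"
  assumes "\<And>q. bounded (range (x q))"
  obtains r :: "nat \<Rightarrow> nat" where "strict_mono r" "\<And>q. convergent (\<lambda>n. x q (r n))"
proof -
  obtain r :: "nat \<Rightarrow> nat" where r: "strict_mono r" "\<And>j :: nat. j \<in> range (to_nat :: 'c \<Rightarrow> nat) \<longrightarrow> convergent (\<lambda>n. x (from_nat j) (r n))"
  proof (rule diagonal_subsequence[where P="\<lambda>j s. j \<in> range (to_nat :: 'c \<Rightarrow> nat) \<longrightarrow> convergent (\<lambda>n. x (from_nat j) (s n))"])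
    fix j and s :: "nat \<Rightarrow> nat" assume "strict_mono s"
    have "bounded (range (\<lambda>n. x (from_nat j) (s n)))"
      by (rule bounded_subset[OF assms[of "from_nat j"]]) auto
    from bounded_imp_convergent_subsequence[OF this] obtain l r where "strict_mono r" "((\<lambda>n. x (from_nat j) (s n)) \<circ> r) \<longlonglongrightarrow> l"
      by blast
    then show "\<exists>r. strict_mono r \<and> (j \<in> range (to_nat :: 'c \<Rightarrow> nat) \<longrightarrow> convergent (\<lambda>n. x (from_nat j) ((s \<circ> r) n)))"
      by (auto simp: o_def convergent_def)
  next
    fix j and s r :: "nat \<Rightarrow> nat"
    assume "strict_mono r" "j \<in> range (to_nat :: 'c \<Rightarrow> nat) \<longrightarrow> convergent (\<lambda>n. x (from_nat j) (s n))"
    then show "j \<in> range (to_nat :: 'c \<Rightarrow> nat) \<longrightarrow> convergent (\<lambda>n. x (from_nat j) ((s \<circ> r) n))"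
      using convergent_subseq_convergent[of "\<lambda>n. x (from_nat j) (s n)" r] by (auto simp: o_def)
  next
    fix j k and s :: "nat \<Rightarrow> nat"
    assume "j \<in> range (to_nat :: 'c \<Rightarrow> nat) \<longrightarrow> convergent (\<lambda>n. x (from_nat j) (s (k + n)))"
    then show "j \<in> range (to_nat :: 'c \<Rightarrow> nat) \<longrightarrow> convergent (\<lambda>n. x (from_nat j) (s n))"
      using convergent_ignore_initial_segment[of "\<lambda>n. x (from_nat j) (s n)" k] by (auto simp: add.commute)
  qed (rule that, assumption+)
  have "convergent (\<lambda>n. x q (r n))" for q using r(2)[of "to_nat q"] by simp
  with r(1) show thesis by (rule that)
qed

text \<open>Averages over grid cells converge along one diagonal subsequence for all meshes. By the
  averaging estimate the functions stay within 8 C' / (j+1)^2 of their averages in squared norm,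
  uniformly in n, so the subsequence is Cauchy in L^2 on the inner box.\<close>

lemma Rellich_box:
  fixes z :: "nat \<Rightarrow> real^2 \<Rightarrow> 'b::euclidean_space"
  assumes W: "open W" "cbox a b \<subseteq> W" and cd: "cbox c d \<subseteq> box a b"
    and wp: "\<And>n i. is_weak_partial W i (z n) (v n i)"
    and z: "\<And>n. L2_on (cbox a b) (z n)" "\<And>n. L2sq (lebesgue_on (cbox a b)) (z n) \<le> ennreal C"
    and v: "\<And>n. (\<Sum>i\<in>UNIV. L2sq (lebesgue_on (cbox a b)) (v n i)) \<le> ennreal C"
  shows "\<exists>r. strict_mono r \<and> (AE x in lebesgue. x \<in> cbox c d \<longrightarrow> convergent (\<lambda>n. z (r n) x))"
proof (cases "cbox c d = {}")
  case True
  then show ?thesis using strict_mono_id by auto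
next
  case ne: False
  let ?Q = "cbox a b" and ?P = "cbox c d"
  obtain \<delta> where \<delta>: "\<delta> > 0" "\<And>x y. x \<in> ?P \<Longrightarrow> (\<And>i. \<bar>y $ i - x $ i\<bar> \<le> \<delta>) \<Longrightarrow> y \<in> box a b"
    by (rule cbox_subset_box_margin[OF cd ne], rule that, assumption, blast)
  define C' where "C' = max C 0"
  have C': "0 \<le> C'" "L2sq (lebesgue_on ?Q) (z n) \<le> ennreal C'" "(\<Sum>i\<in>UNIV. L2sq (lebesgue_on ?Q) (v n i)) \<le> ennreal C'" for n
    using z(2)[of n] v[of n] by (auto simp: C'_def max_def ennreal_neg)
  have zr: "(LINT x|lebesgue_on ?Q. (norm (z n x))\<^sup>2) \<le> C'" for n
    using C'(2)[of n] unfolding L2_on_L2sq[OF z(1)] by (simp add: ennreal_le_iff C'(1))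
  define I where "I = (\<lambda>(j, k, l) n. LINT y|lebesgue_on ?Q. indicator (grid_cell (real (Suc j)) k l) y *\<^sub>R z n y)"
  have "bounded (range (I q))" for q
  proof -
    obtain j k l where q: "q = (j, k, l)" by (cases q)
    interpret finite_measure "lebesgue_on ?Q" by (rule finite_measure_compact) simp
    have "norm (I q n) \<le> measure (lebesgue_on ?Q) (space (lebesgue_on ?Q)) + C'" for n
    proof -
      have zi: "integrable (lebesgue_on ?Q) (z n)" by (rule L2_on_integrable[OF z(1)]) simp
      have z2: "integrable (lebesgue_on ?Q) (\<lambda>x. (norm (z n x))\<^sup>2)" using z(1) by (auto simp: L2_on_def)
      have "norm (I q n) \<le> (LINT y|lebesgue_on ?Q. norm (indicator (grid_cell (real (Suc j)) k l) y *\<^sub>R z n y))"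
        unfolding I_def q by simp (rule order_trans[OF integral_norm_bound], simp)
      also have "\<dots> \<le> (LINT y|lebesgue_on ?Q. 1 + (norm (z n y))\<^sup>2)"
      proof (rule integral_mono)
        show "integrable (lebesgue_on ?Q) (\<lambda>y. norm (indicator (grid_cell (real (Suc j)) k l) y *\<^sub>R z n y))"
        proof (intro integrable_norm integrable_bounded_scaleR[OF zi, where B=1])
          show "indicator (grid_cell (real (Suc j)) k l) \<in> borel_measurable (lebesgue_on ?Q)"
            by (intro measurable_restrict_space1 measurable_completion) simp
        qed (auto simp: indicator_def)
        show "integrable (lebesgue_on ?Q) (\<lambda>y. 1 + (norm (z n y))\<^sup>2)" using z2 by simp
        fix y
        have "norm (z n y) \<le> 1 + (norm (z n y))\<^sup>2"
          using sum_squares_bound[of "norm (z n y)" 1] norm_ge_zero[of "z n y"] unfolding mult_1_right one_power2 by linarith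
        then show "norm (indicator (grid_cell (real (Suc j)) k l) y *\<^sub>R z n y) \<le> 1 + (norm (z n y))\<^sup>2"
          by (auto simp: indicator_def)
      qed
      also have "\<dots> \<le> measure (lebesgue_on ?Q) (space (lebesgue_on ?Q)) + C'"
        using z2 zr[of n] by simp
      finally show ?thesis .
    qed
    then show ?thesis by (intro boundedI[of _ "measure (lebesgue_on ?Q) (space (lebesgue_on ?Q)) + C'"]) auto
  qed
  then obtain r where r: "strict_mono r" "\<And>q. convergent (\<lambda>n. I q (r n))"
    using diagonal_bounded_subsequence[of I] by blast
  \<comment> \<open>The cell average: the cell has area 1/(j+1)^2, so the integral is multiplied by
    (j+1)^2.\<close>
  define A where "A j n x = (real (Suc j))\<^sup>2 *\<^sub>R I (j, \<lfloor>real (Suc j) * x $ 1\<rfloor>, \<lfloor>real (Suc j) * x $ 2\<rfloor>) (r n)" for j n and x :: "real^2"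
  have Am: "A j n \<in> borel_measurable (lebesgue_on S)" for j n S
  proof -
    have "A j n \<in> borel_measurable borel"
    proof -
      have [measurable]: "(\<lambda>x::real^2. \<lfloor>real (Suc j) * x $ i\<rfloor>) \<in> borel \<rightarrow>\<^sub>M count_space UNIV" for i by measurable
      have "(\<lambda>x. I (j, k, \<lfloor>real (Suc j) * x $ 2\<rfloor>) (r n)) \<in> borel_measurable (borel :: (real^2) measure)" for k
        by (rule measurable_compose_countable[where f="\<lambda>l x. I (j, k, l) (r n)"]) measurable
      then have "(\<lambda>x. I (j, \<lfloor>real (Suc j) * x $ 1\<rfloor>, \<lfloor>real (Suc j) * x $ 2\<rfloor>) (r n)) \<in> borel_measurable (borel :: (real^2) measure)"
        by (rule measurable_compose_countable[where f="\<lambda>k x. I (j, k, \<lfloor>real (Suc j) * x $ 2\<rfloor>) (r n)"]) measurable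
      then show ?thesis unfolding A_def by measurable
    qed
    then show ?thesis by (intro measurable_restrict_space1 measurable_completion) simp
  qed
  have PQ: "?P \<subseteq> ?Q" using cd box_subset_cbox by blast
  have zm[measurable]: "z n \<in> borel_measurable (lebesgue_on ?P)" for n
    using L2_on_measurable[OF L2_on_subset[OF z(1) PQ]] by (simp add: compact_lebesgue)
  \<comment> \<open>With N = j+1, h = 1/N and m = 1/N^2 the constant 8 h^4 / m becomes 8 / N^2. The
    condition on \<open>j\<close> keeps the cells inside the outer box.\<close>
  have zA: "L2sq (lebesgue_on ?P) (\<lambda>x. z (r n) x - A j n x) \<le> ennreal (8 * C' / (real (Suc j))\<^sup>2)"
    if j: "1 / real (Suc j) \<le> \<delta>" for n j
  proof -
    let ?N = "real (Suc j)"
    let ?S = "\<lambda>x :: real^2. grid_cell ?N \<lfloor>?N * x $ 1\<rfloor> \<lfloor>?N * x $ 2\<rfloor>"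
    have close: "\<bar>y $ i - x $ i\<bar> \<le> 1 / ?N" if "y \<in> ?S x" for x y i
    proof -
      have "\<lfloor>?N * y $ i\<rfloor> = \<lfloor>?N * x $ i\<rfloor>" using that exhaust_2[of i] by (auto simp: grid_cell_def)
      then have "\<bar>?N * y $ i - ?N * x $ i\<bar> \<le> 1" by linarith
      then have "?N * \<bar>y $ i - x $ i\<bar> \<le> 1" by (simp add: right_diff_distrib[symmetric] abs_mult del: of_nat_Suc)
      then show ?thesis by (simp add: field_simps del: of_nat_Suc)
    qed
    have "L2sq (lebesgue_on ?P) (\<lambda>x. z (r n) x - (1 / (1 / ?N\<^sup>2)) *\<^sub>R (LINT y|lebesgue_on ?Q. indicator (?S x) y *\<^sub>R z (r n) y))
      \<le> ennreal (8 * (1 / ?N)^4 / (1 / ?N\<^sup>2)) * (\<Sum>i\<in>UNIV. L2sq (lebesgue_on ?Q) (v (r n) i))"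
    proof (rule weak_gradient_average[OF W wp])
      have 1: "(\<lambda>x::real^2. x $ i) \<in> borel_measurable borel" for i by measurable
      have [measurable]: "(\<lambda>p :: (real^2) \<times> (real^2). fst p $ i) \<in> borel_measurable (borel \<Otimes>\<^sub>M borel)"
        "(\<lambda>p :: (real^2) \<times> (real^2). snd p $ i) \<in> borel_measurable (borel \<Otimes>\<^sub>M borel)" for i
        by (rule measurable_compose[OF measurable_fst 1], rule measurable_compose[OF measurable_snd 1])
      show "Measurable.pred (borel \<Otimes>\<^sub>M borel) (\<lambda>p. snd p \<in> ?S (fst p))"
        unfolding grid_cell_def mem_Collect_eq by measurable
      show "?S x \<subseteq> box a b" if "x \<in> ?P" for x
        using \<delta>(2)[OF that] order_trans[OF close j] by blast
      show "emeasure lborel (?S x) = ennreal (1 / ?N\<^sup>2)" for x by (rule emeasure_grid_cell) simp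
      show "\<bar>y $ i - x $ i\<bar> \<le> 1 / ?N" if "y \<in> ?S x" for x y i by (rule close[OF that])
    qed (use cd in auto)
    also have "\<dots> \<le> ennreal (8 * (1 / ?N)^4 / (1 / ?N\<^sup>2)) * ennreal C'" by (intro mult_left_mono C'(3)) simp
    also have "\<dots> = ennreal (8 * C' / ?N\<^sup>2)"
      using C'(1) by (simp add: ennreal_mult[symmetric] power4_eq_xxxx power2_eq_square field_simps del: of_nat_Suc)
    finally show ?thesis by (simp add: A_def[abs_def] I_def)
  qed
  have AA: "\<exists>M. \<forall>m\<ge>M. \<forall>n\<ge>M. L2sq (lebesgue_on ?P) (\<lambda>x. A j m x - A j n x) \<le> ennreal e" if e: "e > 0" for j e
  proof -
    let ?N = "real (Suc j)"
    \<comment> \<open>Only finitely many cells meet the inner box, so one index serves for all of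
      them.\<close>
    define F where "F = {\<lfloor>?N * c $ 1\<rfloor>..\<lfloor>?N * d $ 1\<rfloor>} \<times> {\<lfloor>?N * c $ 2\<rfloor>..\<lfloor>?N * d $ 2\<rfloor>}"
    have F: "finite F" by (simp add: F_def)
    define \<mu> where "\<mu> = measure (lebesgue_on ?P) (space (lebesgue_on ?P))"
    interpret finite_measure "lebesgue_on ?P" by (rule finite_measure_compact) simp
    have \<mu>: "emeasure (lebesgue_on ?P) (space (lebesgue_on ?P)) = ennreal \<mu>" by (simp add: \<mu>_def emeasure_eq_measure)
    \<comment> \<open>Multiplied by N^2 and squared this is e / (\<mu> + 1), whose integral over the
      inner box is at most \<open>e\<close>; the added 1 avoids division by 0.\<close>
    define \<eta> where "\<eta> = sqrt (e / (\<mu> + 1)) / ?N\<^sup>2"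
    have \<mu>0: "0 \<le> \<mu>" by (simp add: \<mu>_def)
    have \<eta>: "\<eta> > 0" using e \<mu>0 by (simp add: \<eta>_def)
    have "\<exists>M. \<forall>m\<ge>M. \<forall>n\<ge>M. norm (I (j, q) (r m) - I (j, q) (r n)) < \<eta>" for q
      using r(2)[of "(j, q)"] \<eta> by (metis CauchyD Cauchy_convergent_iff)
    then obtain M where M: "\<And>q m n. m \<ge> M q \<Longrightarrow> n \<ge> M q \<Longrightarrow> norm (I (j, q) (r m) - I (j, q) (r n)) < \<eta>"
      by metis
    have "L2sq (lebesgue_on ?P) (\<lambda>x. A j m x - A j n x) \<le> ennreal e" if mn: "m \<ge> Max (M ` F)" "n \<ge> Max (M ` F)" for m n
    proof -
      have "L2sq (lebesgue_on ?P) (\<lambda>x. A j m x - A j n x) \<le> (\<integral>\<^sup>+x. ennreal (e / (\<mu> + 1)) \<partial>lebesgue_on ?P)"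
        unfolding L2sq_def
      proof (rule nn_integral_mono)
        fix x assume "x \<in> space (lebesgue_on ?P)"
        then have x: "x \<in> ?P" by (simp add: space_restrict_space)
        let ?q = "(\<lfloor>?N * x $ 1\<rfloor>, \<lfloor>?N * x $ 2\<rfloor>)"
        have "?q \<in> F" using x by (auto simp: F_def mem_box_cart intro!: floor_mono mult_left_mono)
        then have "M ?q \<le> Max (M ` F)" using F by simp
        then have "norm (I (j, ?q) (r m) - I (j, ?q) (r n)) < \<eta>" using mn by (intro M) auto
        then have "?N\<^sup>2 * norm (I (j, ?q) (r m) - I (j, ?q) (r n)) \<le> sqrt (e / (\<mu> + 1))"
          by (simp add: \<eta>_def field_simps del: of_nat_Suc)
        moreover have "norm (A j m x - A j n x) = ?N\<^sup>2 * norm (I (j, ?q) (r m) - I (j, ?q) (r n))"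
          by (simp add: A_def scaleR_diff_right[symmetric] del: of_nat_Suc)
        ultimately have "(norm (A j m x - A j n x))\<^sup>2 \<le> (sqrt (e / (\<mu> + 1)))\<^sup>2"
          by (intro power_mono) auto
        also have "\<dots> = e / (\<mu> + 1)" using e \<mu>0 by simp
        finally show "sqnorm (A j m x - A j n x) \<le> ennreal (e / (\<mu> + 1))" by (rule ennreal_leI)
      qed
      also have "\<dots> = ennreal (e / (\<mu> + 1)) * ennreal \<mu>" by (subst nn_integral_const) (simp only: \<mu>)
      also have "\<dots> = ennreal (e / (\<mu> + 1) * \<mu>)" using e \<mu>0 by (intro ennreal_mult[symmetric]) auto
      also have "\<dots> \<le> ennreal e"
      proof (rule ennreal_leI)
        have "e * \<mu> \<le> e * (\<mu> + 1)" using e by simp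
        then show "e / (\<mu> + 1) * \<mu> \<le> e" using \<mu>0 by (simp add: field_simps)
      qed
      finally show ?thesis .
    qed
    then show ?thesis by blast
  qed
  have Cauchy: "\<exists>M. \<forall>m\<ge>M. \<forall>n\<ge>M. L2sq (lebesgue_on ?P) (\<lambda>x. z (r m) x - z (r n) x) \<le> ennreal e" if e: "e > 0" for e
  proof -
    have "(\<lambda>j. 8 * C' * (inverse (real (Suc j)))\<^sup>2) \<longlonglongrightarrow> 8 * C' * 0\<^sup>2"
      by (intro tendsto_mult tendsto_const tendsto_power LIMSEQ_inverse_real_of_nat)
    then have "\<forall>\<^sub>F j in sequentially. 8 * C' * (inverse (real (Suc j)))\<^sup>2 < e / 16"
      using e by (intro order_tendstoD(2)) auto
    moreover have "\<forall>\<^sub>F j in sequentially. inverse (real (Suc j)) < \<delta>"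
      using \<delta>(1) by (rule order_tendstoD(2)[OF LIMSEQ_inverse_real_of_nat])
    ultimately have "\<forall>\<^sub>F j in sequentially. 8 * C' * (inverse (real (Suc j)))\<^sup>2 < e / 16 \<and> inverse (real (Suc j)) < \<delta>"
      by (rule eventually_conj)
    then obtain j where j: "8 * C' * (inverse (real (Suc j)))\<^sup>2 < e / 16" "inverse (real (Suc j)) < \<delta>"
      unfolding eventually_sequentially by blast
    have "1 / real (Suc j) \<le> \<delta>" using j(2) unfolding inverse_eq_divide by linarith
    from zA[OF this] have zA': "L2sq (lebesgue_on ?P) (\<lambda>x. z (r n) x - A j n x) \<le> ennreal (e / 16)" for n
    proof (rule order_trans)
      have "8 * C' / (real (Suc j))\<^sup>2 = 8 * C' * (inverse (real (Suc j)))\<^sup>2" by (simp add: divide_inverse power_inverse)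
      then show "ennreal (8 * C' / (real (Suc j))\<^sup>2) \<le> ennreal (e / 16)" using j(1) by (intro ennreal_leI) linarith
    qed
    \<comment> \<open>Splitting into three differences costs the factors 2, 4 and 4, so errors of
      e/16 add up to 10 e / 16.\<close>
    obtain M where M: "\<And>m n. m \<ge> M \<Longrightarrow> n \<ge> M \<Longrightarrow> L2sq (lebesgue_on ?P) (\<lambda>x. A j m x - A j n x) \<le> ennreal (e / 16)"
      using AA[of "e/16" j] e by auto
    have "L2sq (lebesgue_on ?P) (\<lambda>x. z (r m) x - z (r n) x) \<le> ennreal e" if mn: "m \<ge> M" "n \<ge> M" for m n
    proof -
      note [measurable] = Am
      let ?L = "L2sq (lebesgue_on ?P)"
      have "?L (\<lambda>x. z (r m) x - z (r n) x) = ?L (\<lambda>x. (z (r m) x - A j m x) + ((A j m x - A j n x) + (A j n x - z (r n) x)))"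
        by simp
      also have "\<dots> \<le> 2 * ?L (\<lambda>x. z (r m) x - A j m x) + 2 * ?L (\<lambda>x. (A j m x - A j n x) + (A j n x - z (r n) x))"
        by (rule L2sq_add_le) measurable
      also have "\<dots> \<le> 2 * ?L (\<lambda>x. z (r m) x - A j m x) + 2 * (2 * ?L (\<lambda>x. A j m x - A j n x) + 2 * ?L (\<lambda>x. A j n x - z (r n) x))"
        by (intro add_left_mono mult_left_mono L2sq_add_le) auto
      also have "?L (\<lambda>x. A j n x - z (r n) x) = ?L (\<lambda>x. z (r n) x - A j n x)" by (simp add: L2sq_def norm_minus_commute)
      also have "2 * ?L (\<lambda>x. z (r m) x - A j m x) + 2 * (2 * ?L (\<lambda>x. A j m x - A j n x) + 2 * ?L (\<lambda>x. z (r n) x - A j n x))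
        \<le> 2 * ennreal (e/16) + 2 * (2 * ennreal (e/16) + 2 * ennreal (e/16))"
        by (intro add_mono mult_left_mono zA' M mn) auto
      also have "\<dots> = ennreal (2 * (e/16) + 2 * (2 * (e/16) + 2 * (e/16)))"
      proof -
        have n2: "2 * ennreal x = ennreal (2 * x)" for x by (metis ennreal_mult' ennreal_numeral zero_le_numeral)
        have "0 \<le> e / 16" using e by simp
        then show ?thesis
          by (simp only: n2 ennreal_plus[symmetric] mult_nonneg_nonneg add_nonneg_nonneg zero_le_numeral)
      qed
      also have "\<dots> \<le> ennreal e" using e by (intro ennreal_leI) (simp add: field_simps)
      finally show ?thesis .
    qed
    then show ?thesis by blast
  qed
  obtain s w where s: "strict_mono s" "AE x in lebesgue_on ?P. (\<lambda>n. z (r (s n)) x) \<longlonglongrightarrow> w x"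
    by (rule L2_Cauchy_limit[of "\<lambda>n. z (r n)" "lebesgue_on ?P", OF zm Cauchy], assumption, rule that)
  have "strict_mono (r \<circ> s)" using r(1) s(1) by (rule strict_mono_o)
  moreover have "AE x in lebesgue. x \<in> ?P \<longrightarrow> convergent (\<lambda>n. z ((r \<circ> s) n) x)"
    using s(2) unfolding AE_lebesgue_on_iff[OF compact_lebesgue[OF compact_cbox]]
    by eventually_elim (auto simp: convergent_def)
  ultimately show ?thesis by blast
qed

section \<open>Compactness up to constants\<close>

text \<open>Rellich's theorem needs room around the box on which convergence is claimed. Degenerate
  boxes are allowed, so that single points can be enclosed when covers are built.\<close>

lemma cbox_enlarge:
  fixes c d :: "real^2"
  assumes W: "open W" "cbox c d \<subseteq> W" and ne: "cbox c d \<noteq> {}"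
  obtains a b where "cbox c d \<subseteq> box a b" "cbox a b \<subseteq> W" "box a b \<noteq> {}"
proof -
  obtain e where e: "e > 0" "(\<Union>x\<in>cbox c d. ball x e) \<subseteq> W"
    by (rule compact_subset_open_imp_ball_epsilon_subset[OF compact_cbox W], rule that)
  \<comment> \<open>A displacement with both coordinates at most e/4 has l1 norm at most e/2,
    strictly below \<open>e\<close>.\<close>
  define \<delta> where "\<delta> = e / 4"
  have \<delta>: "\<delta> > 0" using e by (simp add: \<delta>_def)
  define a b :: "real^2" where "a = (\<chi> i. c $ i - \<delta>)" and "b = (\<chi> i. d $ i + \<delta>)"
  have cd: "c $ i \<le> d $ i" for i using ne by (auto simp: interval_ne_empty_cart)
  have sub: "cbox c d \<subseteq> box a b"
  proof
    fix x assume "x \<in> cbox c d"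
    then have "c $ i \<le> x $ i" "x $ i \<le> d $ i" for i by (auto simp: mem_box_cart)
    then have "c $ i - \<delta> < x $ i" "x $ i < d $ i + \<delta>" for i using \<delta> by (smt (verit))+
    then show "x \<in> box a b" by (simp add: mem_box_cart a_def b_def)
  qed
  moreover have "cbox a b \<subseteq> W"
  proof
    fix y assume "y \<in> cbox a b"
    then have y: "c $ i - \<delta> \<le> y $ i" "y $ i \<le> d $ i + \<delta>" for i by (auto simp: mem_box_cart a_def b_def)
    \<comment> \<open>Clamping each coordinate gives a point of the inner box close to
      \<open>y\<close>.\<close>
    define x :: "real^2" where "x = (\<chi> i. max (c $ i) (min (d $ i) (y $ i)))"
    have x: "x \<in> cbox c d" using cd by (auto simp: mem_box_cart x_def)
    have "\<bar>(x - y) $ i\<bar> \<le> \<delta>" for i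
      using y[of i] cd[of i] \<delta> by (auto simp: x_def max_def min_def abs_le_iff)
    then have "(\<Sum>i\<in>UNIV. \<bar>(x - y) $ i\<bar>) \<le> (\<Sum>i\<in>(UNIV::2 set). \<delta>)" by (intro sum_mono) auto
    then have "norm (x - y) \<le> 2 * \<delta>" using norm_le_l1_cart[of "x - y"] by simp
    then have "dist x y < e" using e(1) by (simp add: dist_norm \<delta>_def)
    then show "y \<in> W" using e(2) x by (auto simp: subset_iff)
  qed
  moreover have "box a b \<noteq> {}" using sub ne by auto
  ultimately show thesis by (rule that)
qed

lemma L2_on_cbox_gradient_bound:
  assumes "\<And>i. L2_bounded W (v i)" "cbox a b \<subseteq> W"
  obtains B where "\<And>n. (\<Sum>i\<in>(UNIV :: 2 set). L2sq (lebesgue_on (cbox a b)) (v i n)) \<le> ennreal B" "0 \<le> B"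
proof -
  have "\<exists>C. \<forall>n. L2_on (cbox a b) (v i n) \<and> (LINT x|lebesgue_on (cbox a b). (norm (v i n x))\<^sup>2) \<le> C" for i
    using assms unfolding L2_bounded_def by (meson compact_cbox)
  then obtain B where B: "\<And>i n. L2_on (cbox a b) (v i n)" "\<And>i n. (LINT x|lebesgue_on (cbox a b). (norm (v i n x))\<^sup>2) \<le> B i"
    by metis
  have "(\<Sum>i\<in>UNIV. L2sq (lebesgue_on (cbox a b)) (v i n)) \<le> ennreal (\<Sum>i\<in>UNIV. max (B i) 0)" for n
  proof -
    have "(\<Sum>i\<in>UNIV. L2sq (lebesgue_on (cbox a b)) (v i n)) \<le> (\<Sum>i\<in>UNIV. ennreal (max (B i) 0))"
    proof (rule sum_mono)
      fix i
      show "L2sq (lebesgue_on (cbox a b)) (v i n) \<le> ennreal (max (B i) 0)"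
        unfolding L2_on_L2sq[OF B(1)] using B(2)[of i n] by (intro ennreal_leI) auto
    qed
    also have "\<dots> = ennreal (\<Sum>i\<in>UNIV. max (B i) 0)" by (rule sum_ennreal) simp
    finally show ?thesis .
  qed
  then show thesis by (rule that) (simp add: sum_nonneg)
qed

text \<open>Rellich's theorem on each box of a countable cover, combined by a diagonal sequence and
  a countable union of null sets.\<close>

lemma convergent_AE_subsequence:
  fixes u :: "nat \<Rightarrow> real^2 \<Rightarrow> 'b::euclidean_space"
  assumes W: "open W" and u: "L2_bounded W u" and wp: "\<And>n i. is_weak_partial W i (u n) (v i n)"
    and v: "\<And>i. L2_bounded W (v i)"
  obtains r :: "nat \<Rightarrow> nat" where "strict_mono r" "AE x in lebesgue_on W. convergent (\<lambda>n. u (r n) x)"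
proof -
  obtain D where D: "countable D" "\<And>X. X \<in> D \<Longrightarrow> \<exists>a b. X = cbox a b" "\<Union>D = W"
    using open_countable_Union_open_cbox[OF W] by metis
  have box: "\<exists>r. strict_mono r \<and> (AE x in lebesgue. x \<in> cbox c d \<longrightarrow> convergent (\<lambda>n. u ((s \<circ> r) n) x))"
    if cd: "cbox c d \<subseteq> W" and s: "strict_mono s" for c d and s :: "nat \<Rightarrow> nat"
  proof (cases "cbox c d = {}")
    case True
    then show ?thesis using strict_mono_id by auto
  next
    case False
    obtain a b where ab: "cbox c d \<subseteq> box a b" "cbox a b \<subseteq> W"
      by (rule cbox_enlarge[OF W cd False], rule that)
    obtain C where C: "\<And>n. L2_on (cbox a b) (u n)" "\<And>n. (LINT x|lebesgue_on (cbox a b). (norm (u n x))\<^sup>2) \<le> C"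
      using L2_boundedD[OF u compact_cbox ab(2)] by blast
    obtain B where B: "\<And>n. (\<Sum>i\<in>(UNIV :: 2 set). L2sq (lebesgue_on (cbox a b)) (v i n)) \<le> ennreal B" "0 \<le> B"
      by (rule L2_on_cbox_gradient_bound[OF v ab(2)], rule that)
    have "\<exists>r. strict_mono r \<and> (AE x in lebesgue. x \<in> cbox c d \<longrightarrow> convergent (\<lambda>n. u (s (r n)) x))"
    proof (rule Rellich_box[OF W ab(2,1), where C="max C B" and v="\<lambda>n i. v i (s n)"])
      show "is_weak_partial W i (u (s n)) (v i (s n))" for n i by (rule wp)
      show "L2_on (cbox a b) (u (s n))" for n by (rule C)
      show "L2sq (lebesgue_on (cbox a b)) (u (s n)) \<le> ennreal (max C B)" for n
        unfolding L2_on_L2sq[OF C(1)] using C(2)[of "s n"] by (intro ennreal_leI) auto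
      show "(\<Sum>i\<in>UNIV. L2sq (lebesgue_on (cbox a b)) (v i (s n))) \<le> ennreal (max C B)" for n
        by (rule order_trans[OF B(1)]) (intro ennreal_leI, simp)
    qed
    then show ?thesis by (simp add: o_def)
  qed
  show thesis
  proof (cases "D = {}")
    case True
    then have "W = {}" using D(3) by simp
    then show thesis using that[of id] strict_mono_id by (simp add: AE_lebesgue_on_iff)
  next
    case False
    define X where "X = from_nat_into D"
    have X: "X j \<in> D" for j using False by (simp add: X_def from_nat_into)
    obtain r where r: "strict_mono r" "\<And>j. AE x in lebesgue. x \<in> X j \<longrightarrow> convergent (\<lambda>n. u (r n) x)"
    proof (rule diagonal_subsequence[where P="\<lambda>j s. AE x in lebesgue. x \<in> X j \<longrightarrow> convergent (\<lambda>n. u (s n) x)"])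
      fix j and s :: "nat \<Rightarrow> nat" assume s: "strict_mono s"
      obtain c d where cd: "X j = cbox c d" using D(2)[OF X] by blast
      moreover have "X j \<subseteq> W" using X D(3) by blast
      ultimately show "\<exists>r. strict_mono r \<and> (AE x in lebesgue. x \<in> X j \<longrightarrow> convergent (\<lambda>n. u ((s \<circ> r) n) x))"
        using box[OF _ s] by simp
    next
      fix j and s r :: "nat \<Rightarrow> nat"
      assume r: "strict_mono r" and "AE x in lebesgue. x \<in> X j \<longrightarrow> convergent (\<lambda>n. u (s n) x)"
      from this(2) show "AE x in lebesgue. x \<in> X j \<longrightarrow> convergent (\<lambda>n. u ((s \<circ> r) n) x)"
        by eventually_elim (use convergent_subseq_convergent[OF _ r] in \<open>auto simp: o_def\<close>)
    next
      fix j k and s :: "nat \<Rightarrow> nat"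
      assume "AE x in lebesgue. x \<in> X j \<longrightarrow> convergent (\<lambda>n. u (s (k + n)) x)"
      then show "AE x in lebesgue. x \<in> X j \<longrightarrow> convergent (\<lambda>n. u (s n) x)"
      proof eventually_elim
        case (elim x)
        then show ?case using convergent_ignore_initial_segment[of "\<lambda>n. u (s n) x" k] by (auto simp: add.commute)
      qed
    qed (rule that, assumption+)
    have "AE x in lebesgue. \<forall>j. x \<in> X j \<longrightarrow> convergent (\<lambda>n. u (r n) x)" unfolding AE_all_countable using r(2) by blast
    then have "AE x in lebesgue. x \<in> W \<longrightarrow> convergent (\<lambda>n. u (r n) x)"
    proof eventually_elim
      case (elim x)
      then show ?case using D(1,3) False by (metis UnionE X_def from_nat_into_surj)
    qed
    then have "AE x in lebesgue_on W. convergent (\<lambda>n. u (r n) x)"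
      unfolding AE_lebesgue_on_iff[OF open_lebesgue[OF W]] .
    with r(1) show thesis by (rule that)
  qed
qed

text \<open>Almost everywhere convergence bounds the sequence by one number on a set of positive
  measure. There the constants differ from a bounded sequence by something bounded in L^2, hence are
  bounded.\<close>

lemma bounded_constants:
  fixes z :: "nat \<Rightarrow> 'a \<Rightarrow> 'b::{banach, second_countable_topology}"
  assumes [measurable]: "\<And>n. z n \<in> borel_measurable M"
    and conv: "AE x in M. convergent (\<lambda>n. z n x)"
    and M: "emeasure M (space M) \<noteq> 0" "emeasure M (space M) \<noteq> \<infinity>"
    and bnd: "\<And>n. L2sq M (\<lambda>x. z n x - e n) \<le> ennreal C"
  obtains B where "\<And>n. norm (e n) \<le> B"
proof -
  \<comment> \<open>Convergent sequences are bounded, so these sets exhaust the space up to a null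
    set and one of them has positive measure.\<close>
  define E where "E k = {x \<in> space M. \<forall>n. norm (z n x) \<le> real k}" for k
  have E[measurable]: "E k \<in> sets M" for k unfolding E_def by measurable
  have "\<exists>k. emeasure M (E k) \<noteq> 0"
  proof (rule ccontr)
    assume "\<not> ?thesis"
    then have "(\<Union>k. E k) \<in> null_sets M" by (intro null_sets_UN) (auto simp: null_sets_def)
    then have "AE x in M. x \<notin> (\<Union>k. E k)" by (rule AE_not_in)
    then have "AE x in M. False"
      using conv AE_space
    proof eventually_elim
      case (elim x)
      obtain B where B: "\<And>n. norm (z n x) \<le> B"
        using BseqD[OF convergent_imp_Bseq[OF elim(2)]] by blast
      obtain k where "B \<le> real k" using real_arch_simple by blast
      then have "x \<in> E k" using elim(3) by (auto simp: E_def intro: order_trans[OF B])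
      then show ?case using elim(1) by blast
    qed
    then have "AE x in M. x \<notin> space M" by (rule eventually_mono) simp
    then have "space M \<in> null_sets M" by (subst AE_iff_null_sets) auto
    then show False using M(1) by (auto simp: null_sets_def)
  qed
  then obtain k where k: "emeasure M (E k) \<noteq> 0" by blast
  have "emeasure M (E k) \<le> emeasure M (space M)" by (intro emeasure_mono) (auto simp: E_def)
  then have "emeasure M (E k) < \<infinity>" using M(2) by (simp add: less_top order_le_less_trans)
  then obtain \<mu> where \<mu>: "emeasure M (E k) = ennreal \<mu>" "\<mu> > 0"
    using k by (cases "emeasure M (E k)") auto
  define C' where "C' = max C 0"
  have C': "0 \<le> C'" "L2sq M (\<lambda>x. z n x - e n) \<le> ennreal C'" for n using bnd[of n] by (auto simp: C'_def max_def ennreal_neg)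
  have "(norm (e n))\<^sup>2 \<le> (2 * C' + 2 * (real k)\<^sup>2 * \<mu>) / \<mu>" for n
  proof -
    have "ennreal ((norm (e n))\<^sup>2 * \<mu>) = (\<integral>\<^sup>+x. sqnorm (e n) * indicator (E k) x \<partial>M)"
      using \<mu> by (simp add: nn_integral_cmult_indicator ennreal_mult)
    also have "\<dots> \<le> (\<integral>\<^sup>+x. 2 * sqnorm (z n x - e n) + ennreal (2 * (real k)\<^sup>2) * indicator (E k) x \<partial>M)"
    proof (rule nn_integral_mono)
      fix x
      show "sqnorm (e n) * indicator (E k) x \<le> 2 * sqnorm (z n x - e n) + ennreal (2 * (real k)\<^sup>2) * indicator (E k) x"
      proof (cases "x \<in> E k")
        case True
        then have "(norm (z n x))\<^sup>2 \<le> (real k)\<^sup>2" by (intro power_mono) (auto simp: E_def)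
        moreover have "(norm (e n))\<^sup>2 \<le> 2 * (norm (z n x - e n))\<^sup>2 + 2 * (norm (z n x))\<^sup>2"
          using norm_add_square_le[of "e n - z n x" "z n x"] by (simp add: norm_minus_commute)
        ultimately have "(norm (e n))\<^sup>2 \<le> 2 * (norm (z n x - e n))\<^sup>2 + 2 * (real k)\<^sup>2" by linarith
        then have "sqnorm (e n) \<le> ennreal (2 * (norm (z n x - e n))\<^sup>2 + 2 * (real k)\<^sup>2)" by (rule ennreal_leI)
        also have "\<dots> = 2 * sqnorm (z n x - e n) + ennreal (2 * (real k)\<^sup>2)"
          by (simp add: ennreal_mult ennreal_plus)
        finally show ?thesis using True by simp
      qed simp
    qed
    also have "\<dots> = 2 * L2sq M (\<lambda>x. z n x - e n) + ennreal (2 * (real k)\<^sup>2) * ennreal \<mu>"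
      unfolding L2sq_def by (subst nn_integral_add) (auto simp: nn_integral_cmult nn_integral_cmult_indicator \<mu>)
    also have "\<dots> \<le> 2 * ennreal C' + ennreal (2 * (real k)\<^sup>2) * ennreal \<mu>"
      by (intro add_right_mono mult_left_mono C') simp
    also have "\<dots> = ennreal (2 * C' + 2 * (real k)\<^sup>2 * \<mu>)"
    proof -
      have "2 * ennreal C' = ennreal (2 * C')" by (metis ennreal_mult' ennreal_numeral zero_le_numeral)
      moreover have "ennreal (2 * (real k)\<^sup>2) * ennreal \<mu> = ennreal (2 * (real k)\<^sup>2 * \<mu>)"
        using \<mu> by (intro ennreal_mult[symmetric]) auto
      ultimately show ?thesis using C'(1) \<mu> by (simp only:) (intro ennreal_plus[symmetric], auto)
    qed
    finally have "(norm (e n))\<^sup>2 * \<mu> \<le> 2 * C' + 2 * (real k)\<^sup>2 * \<mu>"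
      using C'(1) \<mu>(2) by (subst (asm) ennreal_le_iff) auto
    then show ?thesis using \<mu>(2) by (simp add: pos_le_divide_eq)
  qed
  then have "norm (e n) \<le> sqrt ((2 * C' + 2 * (real k)\<^sup>2 * \<mu>) / \<mu>)" for n by (rule real_le_rsqrt)
  then show thesis by (rule that)
qed

lemma L2sq_sum_cover:
  fixes u :: "real^2 \<Rightarrow> 'b::euclidean_space"
  assumes fin: "finite D" and D: "\<And>X. X \<in> D \<Longrightarrow> X \<in> sets lebesgue" and K: "K \<in> sets lebesgue" "K \<subseteq> \<Union>D"
    and u: "\<And>X. X \<in> D \<Longrightarrow> u \<in> borel_measurable (lebesgue_on X)"
  shows "L2sq (lebesgue_on K) u \<le> (\<Sum>X\<in>D. L2sq (lebesgue_on X) u)"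
proof -
  have m: "(\<lambda>x. indicator X x * sqnorm (u x)) \<in> borel_measurable lebesgue" if "X \<in> D" for X
  proof -
    have "(\<lambda>x. if x \<in> X then u x else 0) \<in> borel_measurable lebesgue" using u[OF that] borel_measurable_if[OF D[OF that]] by blast
    then have "(\<lambda>x. sqnorm (if x \<in> X then u x else 0)) \<in> borel_measurable lebesgue" by measurable
    moreover have "(\<lambda>x. sqnorm (if x \<in> X then u x else 0)) = (\<lambda>x. indicator X x * sqnorm (u x))"
      by (auto simp: indicator_def)
    ultimately show ?thesis by simp
  qed
  have eq: "L2sq (lebesgue_on X) u = (\<integral>\<^sup>+x. indicator X x * sqnorm (u x) \<partial>lebesgue)" if "X \<in> sets lebesgue" for X
    using L2sq_lebesgue_on[of X UNIV u] that by (simp add: lebesgue_on_UNIV_eq)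
  have "L2sq (lebesgue_on K) u \<le> (\<integral>\<^sup>+x. (\<Sum>X\<in>D. indicator X x * sqnorm (u x)) \<partial>lebesgue)"
    unfolding eq[OF K(1)]
  proof (rule nn_integral_mono)
    fix x
    show "indicator K x * sqnorm (u x) \<le> (\<Sum>X\<in>D. indicator X x * sqnorm (u x))"
    proof (cases "x \<in> K")
      case True
      then obtain X where "X \<in> D" "x \<in> X" using K(2) by blast
      then show ?thesis
        using member_le_sum[of X D "\<lambda>X. indicator X x * sqnorm (u x)"] True fin by simp
    qed simp
  qed
  also have "\<dots> = (\<Sum>X\<in>D. \<integral>\<^sup>+x. indicator X x * sqnorm (u x) \<partial>lebesgue)"
    by (rule nn_integral_sum) (rule m)
  also have "\<dots> = (\<Sum>X\<in>D. L2sq (lebesgue_on X) u)" using D by (intro sum.cong refl) (simp add: eq)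
  finally show ?thesis .
qed

lemma box_emeasure:
  fixes a b :: "real^2"
  assumes "box a b \<noteq> {}"
  shows "emeasure (lebesgue_on (cbox a b)) (space (lebesgue_on (cbox a b))) \<noteq> 0"
    "emeasure (lebesgue_on (cbox a b)) (space (lebesgue_on (cbox a b))) \<noteq> \<infinity>"
proof -
  have "\<not> negligible (cbox a b)"
    using open_not_negligible[OF open_box assms] negligible_subset box_subset_cbox by blast
  then have "emeasure lebesgue (cbox a b) \<noteq> 0" by (auto simp: negligible_iff_null_sets null_sets_def)
  then show "emeasure (lebesgue_on (cbox a b)) (space (lebesgue_on (cbox a b))) \<noteq> 0"
    by (simp add: emeasure_restrict_space space_restrict_space)
  interpret finite_measure "lebesgue_on (cbox a b)" by (rule finite_measure_compact) simp
  show "emeasure (lebesgue_on (cbox a b)) (space (lebesgue_on (cbox a b))) \<noteq> \<infinity>" by (simp add: emeasure_eq_measure)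
qed

lemma Poincare_sequence:
  fixes u :: "nat \<Rightarrow> real^2 \<Rightarrow> 'b::euclidean_space"
  assumes W: "open W" "cbox a b \<subseteq> W" and ne: "box a b \<noteq> {}"
    and wp: "\<And>n i. is_weak_partial W i (u n) (v i n)" and v: "\<And>i. L2_bounded W (v i)"
  obtains \<beta> C where "\<And>n. L2sq (lebesgue_on (cbox a b)) (\<lambda>x. u n x - \<beta> n) \<le> ennreal C"
proof -
  obtain B where B: "\<And>n. (\<Sum>i\<in>(UNIV :: 2 set). L2sq (lebesgue_on (cbox a b)) (v i n)) \<le> ennreal B" "0 \<le> B"
    by (rule L2_on_cbox_gradient_bound[OF v W(2)], rule that)
  obtain C where C: "\<And>(u :: real^2 \<Rightarrow> 'b) v. (\<And>i. is_weak_partial W i u (v i)) \<Longrightarrow>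
    (\<exists>\<beta>. L2sq (lebesgue_on (cbox a b)) (\<lambda>x. u x - \<beta>) \<le> ennreal C * (\<Sum>i\<in>UNIV. L2sq (lebesgue_on (cbox a b)) (v i)))"
    using Poincare[OF W ne] by blast
  have "\<exists>\<beta>. L2sq (lebesgue_on (cbox a b)) (\<lambda>x. u n x - \<beta>) \<le> ennreal (max C 0 * B)" for n
  proof -
    obtain \<beta> where "L2sq (lebesgue_on (cbox a b)) (\<lambda>x. u n x - \<beta>) \<le> ennreal C * (\<Sum>i\<in>UNIV. L2sq (lebesgue_on (cbox a b)) (v i n))"
      using C[OF wp] by blast
    also have "\<dots> \<le> ennreal C * ennreal B" by (intro mult_left_mono B) simp
    also have "\<dots> \<le> ennreal (max C 0) * ennreal B" by (intro mult_right_mono ennreal_leI) auto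
    also have "\<dots> = ennreal (max C 0 * B)" using B(2) by (intro ennreal_mult[symmetric]) auto
    finally show ?thesis by blast
  qed
  then obtain \<beta> where "\<And>n. L2sq (lebesgue_on (cbox a b)) (\<lambda>x. u n x - \<beta> n) \<le> ennreal (max C 0 * B)" by metis
  then show thesis by (rule that)
qed

text \<open>Rebuilds in a chart the bound that almost everywhere convergence does not carry along:
  Poincare and \<open>bounded_constants\<close> give it on boxes, and finitely many boxes cover a
  compact set.\<close>

lemma L2_bounded_if_convergent_AE:
  fixes u :: "nat \<Rightarrow> real^2 \<Rightarrow> 'b::euclidean_space"
  assumes W: "open W" and u: "\<And>n. L2loc W (u n)" and wp: "\<And>n i. is_weak_partial W i (u n) (v i n)"
    and v: "\<And>i. L2_bounded W (v i)" and conv: "AE x in lebesgue_on W. convergent (\<lambda>n. u n x)"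
  shows "L2_bounded W u"
  unfolding L2_bounded_def
proof (intro allI impI)
  fix K assume "compact K \<and> K \<subseteq> W"
  then have K: "compact K" "K \<subseteq> W" by auto
  have uK: "L2_on S (u n)" if "compact S" "S \<subseteq> W" for S n using u that by (auto simp: L2loc_def)
  have boxB: "\<exists>B. \<forall>n. L2sq (lebesgue_on (cbox a b)) (u n) \<le> ennreal B" if ab: "cbox a b \<subseteq> W" "box a b \<noteq> {}" for a b
  proof -
    let ?M = "lebesgue_on (cbox a b)"
    have m[measurable]: "u n \<in> borel_measurable ?M" for n using uK[OF compact_cbox ab(1)] by (rule L2_on_measurable)
    obtain \<beta> C where \<beta>: "\<And>n. L2sq ?M (\<lambda>x. u n x - \<beta> n) \<le> ennreal C"
      by (rule Poincare_sequence[OF W ab wp v], rule that)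
    have cv: "AE x in ?M. convergent (\<lambda>n. u n x)"
      by (rule AE_lebesgue_on_subset[OF conv ab(1)]) (auto simp: compact_lebesgue open_lebesgue[OF W])
    obtain B where B: "\<And>n. norm (\<beta> n) \<le> B"
      by (rule bounded_constants[OF m cv box_emeasure[OF ab(2)] \<beta>], rule that)
    interpret finite_measure ?M by (rule finite_measure_compact) simp
    let ?\<mu> = "measure ?M (space ?M)"
    have "L2sq ?M (u n) \<le> ennreal (2 * max C 0 + 2 * (B\<^sup>2 * ?\<mu>))" for n
    proof -
      have "L2sq ?M (u n) = L2sq ?M (\<lambda>x. (u n x - \<beta> n) + \<beta> n)" by simp
      also have "\<dots> \<le> 2 * L2sq ?M (\<lambda>x. u n x - \<beta> n) + 2 * L2sq ?M (\<lambda>x. \<beta> n)" by (rule L2sq_add_le) measurable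
      also have "\<dots> \<le> 2 * ennreal (max C 0) + 2 * ennreal (B\<^sup>2 * ?\<mu>)"
      proof (intro add_mono mult_left_mono)
        show "L2sq ?M (\<lambda>x. u n x - \<beta> n) \<le> ennreal (max C 0)"
          by (rule order_trans[OF \<beta>]) (intro ennreal_leI, simp)
        have "L2sq ?M (\<lambda>x. \<beta> n) = ennreal ((norm (\<beta> n))\<^sup>2 * ?\<mu>)"
          unfolding L2sq_def by (subst nn_integral_const) (simp add: emeasure_eq_measure ennreal_mult)
        also have "\<dots> \<le> ennreal (B\<^sup>2 * ?\<mu>)" by (intro ennreal_leI mult_right_mono power_mono B) auto
        finally show "L2sq ?M (\<lambda>x. \<beta> n) \<le> ennreal (B\<^sup>2 * ?\<mu>)" .
      qed auto
      also have "\<dots> = ennreal (2 * max C 0 + 2 * (B\<^sup>2 * ?\<mu>))"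
      proof -
        have n2: "2 * ennreal x = ennreal (2 * x)" for x by (metis ennreal_mult' ennreal_numeral zero_le_numeral)
        show ?thesis unfolding n2 by (intro ennreal_plus[symmetric]) auto
      qed
      finally show ?thesis .
    qed
    then show ?thesis by blast
  qed
  define \<U> where "\<U> = {(a, b). cbox a b \<subseteq> W \<and> box a b \<noteq> {}}"
  have "K \<subseteq> (\<Union>(a, b)\<in>\<U>. box a b)"
  proof
    fix x assume "x \<in> K"
    then have x: "cbox x x \<subseteq> W" "cbox x x \<noteq> {}" using K(2) by auto
    obtain a b where "cbox x x \<subseteq> box a b" "cbox a b \<subseteq> W" "box a b \<noteq> {}"
      by (rule cbox_enlarge[OF W x], rule that)
    then show "x \<in> (\<Union>(a, b)\<in>\<U>. box a b)" by (auto simp: \<U>_def)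
  qed
  then obtain D where D: "D \<subseteq> \<U>" "finite D" "K \<subseteq> (\<Union>(a, b)\<in>D. box a b)"
    using compactE_image[OF K(1), of \<U> "\<lambda>(a, b). box a b"] by (auto simp: case_prod_unfold)
  obtain B where B: "\<And>a b n. (a, b) \<in> D \<Longrightarrow> L2sq (lebesgue_on (cbox a b)) (u n) \<le> ennreal (B a b)"
    using boxB D(1) unfolding \<U>_def subset_iff by (metis (mono_tags, lifting) case_prodD mem_Collect_eq)
  \<comment> \<open>The covering sum ranges over sets instead of corner pairs, so the bounds are
    chosen again, indexed by sets.\<close>
  let ?X = "(\<lambda>(a, b). cbox a b) ` D"
  have "\<exists>B. \<forall>n. L2sq (lebesgue_on X) (u n) \<le> ennreal B" if "X \<in> ?X" for X using that B by auto
  then obtain B' where B': "\<And>X n. X \<in> ?X \<Longrightarrow> L2sq (lebesgue_on X) (u n) \<le> ennreal (B' X)" by metis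
  have XW: "compact X \<and> X \<subseteq> W" if "X \<in> ?X" for X using that D(1) by (auto simp: \<U>_def)
  have "L2sq (lebesgue_on K) (u n) \<le> ennreal (\<Sum>X\<in>?X. max (B' X) 0)" for n
  proof -
    have "L2sq (lebesgue_on K) (u n) \<le> (\<Sum>X\<in>?X. L2sq (lebesgue_on X) (u n))"
    proof (rule L2sq_sum_cover)
      show "K \<subseteq> \<Union>?X" using D(3) box_subset_cbox by fastforce
      show "u n \<in> borel_measurable (lebesgue_on X)" if "X \<in> ?X" for X
        using uK XW[OF that] by (auto intro: L2_on_measurable)
    qed (use D(2) XW K in \<open>auto simp: compact_lebesgue\<close>)
    also have "\<dots> \<le> (\<Sum>X\<in>?X. ennreal (max (B' X) 0))"
    proof (rule sum_mono)
      fix X assume "X \<in> ?X"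
      from B'[OF this, of n] show "L2sq (lebesgue_on X) (u n) \<le> ennreal (max (B' X) 0)"
        by (rule order_trans) (intro ennreal_leI, simp)
    qed
    also have "\<dots> = ennreal (\<Sum>X\<in>?X. max (B' X) 0)" by (rule sum_ennreal) simp
    finally show ?thesis .
  qed
  then have "(LINT x|lebesgue_on K. (norm (u n x))\<^sup>2) \<le> (\<Sum>X\<in>?X. max (B' X) 0)" for n
    unfolding L2_on_L2sq[OF uK[OF K]] by (subst (asm) ennreal_le_iff) (auto intro: sum_nonneg)
  then show "\<exists>C. \<forall>n. L2_on K (u n) \<and> (LINT x|lebesgue_on K. (norm (u n x))\<^sup>2) \<le> C"
    using uK[OF K] by blast
qed

text \<open>The constants are fixed for the full sequence before any subsequence is taken, so a
  diagonal argument over all boxes can keep them. If the functions are already bounded nothing is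
  subtracted, which later makes the translations vanish.\<close>

lemma normalized_subsequences:
  fixes u :: "nat \<Rightarrow> real^2 \<Rightarrow> 'b::euclidean_space"
  assumes W: "open W" and u: "\<And>n. L2loc W (u n)" and wp: "\<And>n i. is_weak_partial W i (u n) (v i n)"
    and v: "\<And>i. L2_bounded W (v i)" and cd: "cbox c d \<subseteq> W" "cbox c d \<noteq> {}"
  shows "\<exists>\<beta>. (L2_bounded W u \<longrightarrow> (\<forall>n. \<beta> n = 0)) \<and> (\<forall>s :: nat \<Rightarrow> nat. strict_mono s \<longrightarrow>
    (\<exists>r. strict_mono r \<and> (AE x in lebesgue. x \<in> cbox c d \<longrightarrow> convergent (\<lambda>n. u (s (r n)) x - \<beta> (s (r n))))))"
proof -
  obtain a b where ab: "cbox c d \<subseteq> box a b" "cbox a b \<subseteq> W" "box a b \<noteq> {}"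
    by (rule cbox_enlarge[OF W cd], rule that)
  obtain B where B: "\<And>n. (\<Sum>i\<in>(UNIV :: 2 set). L2sq (lebesgue_on (cbox a b)) (v i n)) \<le> ennreal B" "0 \<le> B"
    by (rule L2_on_cbox_gradient_bound[OF v ab(2)], rule that)
  have uQ: "L2_on (cbox a b) (u n)" for n using u ab(2) by (auto simp: L2loc_def)
  have "\<exists>\<beta> C. (L2_bounded W u \<longrightarrow> (\<forall>n. \<beta> n = 0)) \<and> (\<forall>n. L2sq (lebesgue_on (cbox a b)) (\<lambda>x. u n x - \<beta> n) \<le> ennreal C)"
  proof (cases "L2_bounded W u")
    case True
    obtain C where "\<And>n. (LINT x|lebesgue_on (cbox a b). (norm (u n x))\<^sup>2) \<le> C"
      by (rule L2_boundedD[OF True compact_cbox ab(2)], rule that)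
    then have "L2sq (lebesgue_on (cbox a b)) (\<lambda>x. u n x - 0) \<le> ennreal C" for n
      unfolding diff_zero L2_on_L2sq[OF uQ] by (intro ennreal_leI)
    then show ?thesis by (intro exI[of _ "\<lambda>_. 0"] exI[of _ C]) simp
  next
    case False
    obtain \<beta> C where "\<And>n. L2sq (lebesgue_on (cbox a b)) (\<lambda>x. u n x - \<beta> n) \<le> ennreal C"
      by (rule Poincare_sequence[OF W ab(2,3) wp v], rule that)
    with False show ?thesis by blast
  qed
  then obtain \<beta> C where \<beta>: "L2_bounded W u \<longrightarrow> (\<forall>n. \<beta> n = 0)"
    and C: "\<And>n. L2sq (lebesgue_on (cbox a b)) (\<lambda>x. u n x - \<beta> n) \<le> ennreal C" by blast
  have "\<exists>r. strict_mono r \<and> (AE x in lebesgue. x \<in> cbox c d \<longrightarrow> convergent (\<lambda>n. u (s (r n)) x - \<beta> (s (r n))))"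
    for s :: "nat \<Rightarrow> nat"
  proof (rule Rellich_box[OF W ab(2,1), where z="\<lambda>n x. u (s n) x - \<beta> (s n)" and v="\<lambda>n i. v i (s n)" and C="max C B"])
    show "is_weak_partial W i (\<lambda>x. u (s n) x - \<beta> (s n)) (v i (s n))" for n i
      using wp by (simp add: is_weak_partial_diff_const_iff[OF W])
    show "L2_on (cbox a b) (\<lambda>x. u (s n) x - \<beta> (s n))" for n
      by (intro L2_on_diff uQ L2_on_const) simp
    show "L2sq (lebesgue_on (cbox a b)) (\<lambda>x. u (s n) x - \<beta> (s n)) \<le> ennreal (max C B)" for n
      by (rule order_trans[OF C]) (intro ennreal_leI, simp)
    show "(\<Sum>i\<in>UNIV. L2sq (lebesgue_on (cbox a b)) (v i (s n))) \<le> ennreal (max C B)" for n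
      by (rule order_trans[OF B(1)]) (intro ennreal_leI, simp)
  qed
  with \<beta> show ?thesis by blast
qed

section \<open>Limits of isometric immersions in a chart\<close>

lemma weakly_conv_L2loc_AE_cong:
  fixes u :: "nat \<Rightarrow> real^2 \<Rightarrow> 'b::euclidean_space"
  assumes u: "weakly_conv_L2loc W u v" and W: "open W" and ae: "AE x in lebesgue_on W. v x = v' x"
  shows "weakly_conv_L2loc W u v'"
  unfolding weakly_conv_L2loc_def
proof (intro conjI allI impI)
  have v: "L2loc W v" using u by (auto simp: weakly_conv_L2loc_def)
  show v': "L2loc W v'" using L2loc_AE[OF v W ae] .
  show "L2loc W (u n)" for n using u by (auto simp: weakly_conv_L2loc_def)
  fix K and h :: "real^2 \<Rightarrow> 'b" assume *: "compact K \<and> K \<subseteq> W \<and> L2_on K h"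
  have [measurable]: "v \<in> borel_measurable (lebesgue_on K)" "v' \<in> borel_measurable (lebesgue_on K)" "h \<in> borel_measurable (lebesgue_on K)"
    using v v' * by (auto simp: L2loc_def L2_on_def)
  have "AE x in lebesgue_on K. v x = v' x"
    using * by (intro AE_lebesgue_on_subset[OF ae]) (auto simp: compact_lebesgue open_lebesgue[OF W])
  then have "(LINT x|lebesgue_on K. v x \<bullet> h x) = (LINT x|lebesgue_on K. v' x \<bullet> h x)"
    by (intro integral_cong_AE) (auto elim: eventually_mono)
  moreover have "(\<lambda>n. LINT x|lebesgue_on K. u n x \<bullet> h x) \<longlonglongrightarrow> (LINT x|lebesgue_on K. v x \<bullet> h x)"
    using u * unfolding weakly_conv_L2loc_def by blast
  ultimately show "(\<lambda>n. LINT x|lebesgue_on K. u n x \<bullet> h x) \<longlonglongrightarrow> (LINT x|lebesgue_on K. v' x \<bullet> h x)" by simp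
qed

lemma weakly_conv_L2loc_diff:
  fixes u w :: "nat \<Rightarrow> real^2 \<Rightarrow> 'b::euclidean_space"
  assumes u: "weakly_conv_L2loc W u v" and w: "weakly_conv_L2loc W w z"
  shows "weakly_conv_L2loc W (\<lambda>n x. u n x - w n x) (\<lambda>x. v x - z x)"
  unfolding weakly_conv_L2loc_def
proof (intro conjI allI impI)
  have L: "L2loc W (u n)" "L2loc W (w n)" "L2loc W v" "L2loc W z" for n
    using u w by (auto simp: weakly_conv_L2loc_def)
  show "L2loc W (\<lambda>x. u n x - w n x)" "L2loc W (\<lambda>x. v x - z x)" for n using L by (auto intro: L2loc_diff)
  fix K and h :: "real^2 \<Rightarrow> 'b" assume *: "compact K \<and> K \<subseteq> W \<and> L2_on K h"
  have int: "(LINT x|lebesgue_on K. (p x - q x) \<bullet> h x) = (LINT x|lebesgue_on K. p x \<bullet> h x) - (LINT x|lebesgue_on K. q x \<bullet> h x)"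
    if "L2loc W p" "L2loc W q" for p q
    using that * L2_on_integrable_inner[of K p h] L2_on_integrable_inner[of K q h]
    by (simp add: inner_diff_left L2loc_def)
  have "(\<lambda>n. (LINT x|lebesgue_on K. u n x \<bullet> h x) - (LINT x|lebesgue_on K. w n x \<bullet> h x)) \<longlonglongrightarrow>
    (LINT x|lebesgue_on K. v x \<bullet> h x) - (LINT x|lebesgue_on K. z x \<bullet> h x)"
    using u w * unfolding weakly_conv_L2loc_def by (intro tendsto_diff) blast+
  then show "(\<lambda>n. LINT x|lebesgue_on K. (u n x - w n x) \<bullet> h x) \<longlonglongrightarrow> (LINT x|lebesgue_on K. (v x - z x) \<bullet> h x)"
    by (simp only: int[OF L(1,2)] int[OF L(3,4)])
qed

lemma weakly_conv_L2loc_subseq: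
  fixes r :: "nat \<Rightarrow> nat" and u :: "nat \<Rightarrow> real^2 \<Rightarrow> 'b::euclidean_space"
  assumes u: "weakly_conv_L2loc W u v" and r: "strict_mono r"
  shows "weakly_conv_L2loc W (\<lambda>n. u (r n)) v"
  unfolding weakly_conv_L2loc_def
proof (intro conjI allI impI)
  show "L2loc W (u (r n))" "L2loc W v" for n using u by (auto simp: weakly_conv_L2loc_def)
  fix K and h :: "real^2 \<Rightarrow> 'b" assume "compact K \<and> K \<subseteq> W \<and> L2_on K h"
  then have "(\<lambda>n. LINT x|lebesgue_on K. u n x \<bullet> h x) \<longlonglongrightarrow> (LINT x|lebesgue_on K. v x \<bullet> h x)"
    using u unfolding weakly_conv_L2loc_def by blast
  from LIMSEQ_subseq_LIMSEQ[OF this r] show "(\<lambda>n. LINT x|lebesgue_on K. u (r n) x \<bullet> h x) \<longlonglongrightarrow> (LINT x|lebesgue_on K. v x \<bullet> h x)"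
    by (simp add: o_def)
qed

lemma weakly_conv_L2loc_if_subseqs:
  fixes u :: "nat \<Rightarrow> real^2 \<Rightarrow> 'b::euclidean_space"
  assumes "\<And>s :: nat \<Rightarrow> nat. strict_mono s \<Longrightarrow> \<exists>t :: nat \<Rightarrow> nat. strict_mono t \<and> weakly_conv_L2loc W (\<lambda>n. u (s (t n))) v"
    and u: "\<And>n. L2loc W (u n)"
  shows "weakly_conv_L2loc W u v"
  unfolding weakly_conv_L2loc_def
proof (intro conjI allI impI)
  show "L2loc W (u n)" for n by (rule u)
  show "L2loc W v" using assms(1)[OF strict_mono_id] by (auto simp: weakly_conv_L2loc_def)
  fix K and h :: "real^2 \<Rightarrow> 'b" assume *: "compact K \<and> K \<subseteq> W \<and> L2_on K h"
  show "(\<lambda>n. LINT x|lebesgue_on K. u n x \<bullet> h x) \<longlonglongrightarrow> (LINT x|lebesgue_on K. v x \<bullet> h x)"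
  proof (rule tendsto_if_subseqs)
    fix s :: "nat \<Rightarrow> nat" assume "strict_mono s"
    from assms(1)[OF this] obtain t :: "nat \<Rightarrow> nat" where "strict_mono t" "weakly_conv_L2loc W (\<lambda>n. u (s (t n))) v" by blast
    then show "\<exists>t. strict_mono t \<and> (\<lambda>n. LINT x|lebesgue_on K. u (s (t n)) x \<bullet> h x) \<longlonglongrightarrow> (LINT x|lebesgue_on K. v x \<bullet> h x)"
      using * unfolding weakly_conv_L2loc_def by blast
  qed
qed

lemma weak_partial_limit:
  fixes u :: "nat \<Rightarrow> real^2 \<Rightarrow> 'b::euclidean_space"
  assumes W: "open W" and u: "weakly_conv_L2loc W u v"
    and wp: "\<And>n. is_weak_partial W i (u n) (weak_partial W i (u n))" and b: "L2_bounded W (\<lambda>n. weak_partial W i (u n))"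
  shows "is_weak_partial W i v (weak_partial W i v)"
    and "weakly_conv_L2loc W (\<lambda>n. weak_partial W i (u n)) (weak_partial W i v)"
proof -
  obtain w where w: "is_weak_partial W i v w" "weakly_conv_L2loc W (\<lambda>n. weak_partial W i (u n)) w"
    by (rule weak_partial_closed[OF W u wp b], rule that)
  show 1: "is_weak_partial W i v (weak_partial W i v)" using weak_partial_works[OF w(1)] .
  show "weakly_conv_L2loc W (\<lambda>n. weak_partial W i (u n)) (weak_partial W i v)"
    by (rule weakly_conv_L2loc_AE_cong[OF w(2) W is_weak_partial_unique[OF W w(1) 1]])
qed

text \<open>The L^2 bound on the functions follows from their convergence; closedness of weak
  derivatives is then applied to the first and to the second derivatives.\<close>

lemma weakly_conv_H2loc_if_AE:
  fixes u :: "nat \<Rightarrow> real^2 \<Rightarrow> 'b::euclidean_space"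
  assumes W: "open W" and u: "\<And>n. Hloc 2 W (u n)" and lim: "AE x in lebesgue_on W. (\<lambda>n. u n x) \<longlonglongrightarrow> v x"
    and b1: "\<And>i. L2_bounded W (\<lambda>n. weak_partial W i (u n))"
    and b2: "\<And>i j. L2_bounded W (\<lambda>n. weak_partial W j (weak_partial W i (u n)))"
  shows "weakly_conv_Hloc 2 W u v"
proof -
  have H: "L2loc W (u n)" "is_weak_partial W i (u n) (weak_partial W i (u n))"
    "is_weak_partial W j (weak_partial W i (u n)) (weak_partial W j (weak_partial W i (u n)))" for n i j
    using u[of n] unfolding numeral_2_eq_2 Hloc_Suc_iff[OF W] by blast+
  have "AE x in lebesgue_on W. convergent (\<lambda>n. u n x)" using lim by eventually_elim (auto simp: convergent_def)
  from L2_bounded_if_convergent_AE[OF W H(1) H(2) b1 this]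
  have c0: "weakly_conv_L2loc W u v" by (rule weakly_conv_L2loc_AE[OF W _ lim])
  note c1 = weak_partial_limit[OF W c0 H(2) b1]
  note c2 = weak_partial_limit[OF W c1(2) H(3) b2]
  have L: "L2loc W v" "L2loc W (weak_partial W i v)" "L2loc W (weak_partial W j (weak_partial W i v))" for i j
    using c0 c1(2)[of i] c2(2)[of j i] by (auto simp: weakly_conv_L2loc_def)
  have "Hloc 2 W v"
    unfolding numeral_2_eq_2 Hloc_Suc_iff[OF W] Hloc.simps(1) using L c1(1) c2(1) by blast
  moreover have "weak_derivs_conv 2 W u v"
    unfolding numeral_2_eq_2 weak_derivs_conv.simps using c0 c1(2) c2(2) by blast
  ultimately show ?thesis using u by (simp add: weakly_conv_Hloc_def)
qed

text \<open>Bounded gradients give a subsequence with some almost everywhere limit, and uniqueness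
  of weak limits identifies it as \<open>u0\<close>.\<close>

lemma weak_limit_AE_subsequence:
  fixes u :: "nat \<Rightarrow> real^2 \<Rightarrow> 'b::euclidean_space"
  assumes W: "open W" and u: "L2_bounded W u" and wp: "\<And>n i. is_weak_partial W i (u n) (v i n)"
    and v: "\<And>i. L2_bounded W (v i)" and lim: "weakly_conv_L2loc W u u0"
  obtains r :: "nat \<Rightarrow> nat" where "strict_mono r" "AE x in lebesgue_on W. (\<lambda>n. u (r n) x) \<longlonglongrightarrow> u0 x"
proof -
  obtain r :: "nat \<Rightarrow> nat" where r: "strict_mono r" "AE x in lebesgue_on W. convergent (\<lambda>n. u (r n) x)"
    by (rule convergent_AE_subsequence[OF W u wp v], rule that)
  have l: "AE x in lebesgue_on W. (\<lambda>n. u (r n) x) \<longlonglongrightarrow> lim (\<lambda>n. u (r n) x)"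
    using r(2) by eventually_elim (simp add: convergent_LIMSEQ_iff)
  have "weakly_conv_L2loc W (\<lambda>n. u (r n)) (\<lambda>x. lim (\<lambda>n. u (r n) x))"
    by (rule weakly_conv_L2loc_AE[OF W L2_bounded_subseq[OF u] l])
  from weakly_conv_L2loc_unique[OF W this weakly_conv_L2loc_subseq[OF lim r(1)]] l
  have "AE x in lebesgue_on W. (\<lambda>n. u (r n) x) \<longlonglongrightarrow> u0 x" by eventually_elim simp
  with r(1) show thesis by (rule that)
qed

section \<open>Isometric immersions in one chart: bounds and passage to the limit\<close>

lemma in_coords_diff_const: "in_coords c (\<lambda>p. f p - a) = (\<lambda>x. in_coords c f x - a)"
  by (simp add: in_coords_def fun_eq_iff)

lemma D1_diff_const: "open (coord_dom c) \<Longrightarrow> D1 c (\<lambda>p. f p - a) i = D1 c f i"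
  by (simp add: D1_def in_coords_diff_const weak_partial_diff_const)

text \<open>The data of one chart, gathered so that the analysis there refers to neither atlas nor
  surface.\<close>

definition immersion_family :: "'a chart \<Rightarrow> 'a metric_tensor \<Rightarrow> (nat \<Rightarrow> 'a \<Rightarrow> real^3) \<Rightarrow> bool" where
  "immersion_family c g f \<longleftrightarrow> open (coord_dom c) \<and> (\<forall>n. Hloc 2 (coord_dom c) (in_coords c (f n))) \<and>
    (\<forall>n. AE x in lebesgue_on (coord_dom c). \<forall>X Y. differential c (f n) x X \<bullet> differential c (f n) x Y = X \<bullet> (g c x *v Y)) \<and>
    (\<forall>i j. L2_bounded (coord_dom c) (\<lambda>n. second_fundamental_form c g (f n) i j))"

lemma immersion_familyD:
  assumes "immersion_family c g f"
  shows "open (coord_dom c)" "Hloc 2 (coord_dom c) (in_coords c (f n))"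
    "AE x in lebesgue_on (coord_dom c). \<forall>X Y. differential c (f n) x X \<bullet> differential c (f n) x Y = X \<bullet> (g c x *v Y)"
    "L2_bounded (coord_dom c) (\<lambda>n. second_fundamental_form c g (f n) i j)"
    "L2loc (coord_dom c) (in_coords c (f n))"
    "is_weak_partial (coord_dom c) i (in_coords c (f n)) (D1 c (f n) i)"
    "L2loc (coord_dom c) (D1 c (f n) i)"
    "is_weak_partial (coord_dom c) j (D1 c (f n) i) (D2 c (f n) j i)"
    "L2loc (coord_dom c) (D2 c (f n) j i)"
proof -
  show W: "open (coord_dom c)" and H: "Hloc 2 (coord_dom c) (in_coords c (f n))"
    and "AE x in lebesgue_on (coord_dom c). \<forall>X Y. differential c (f n) x X \<bullet> differential c (f n) x Y = X \<bullet> (g c x *v Y)"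
    and "L2_bounded (coord_dom c) (\<lambda>n. second_fundamental_form c g (f n) i j)"
    using assms by (auto simp: immersion_family_def)
  show "L2loc (coord_dom c) (in_coords c (f n))"
    "is_weak_partial (coord_dom c) i (in_coords c (f n)) (D1 c (f n) i)"
    "L2loc (coord_dom c) (D1 c (f n) i)"
    "is_weak_partial (coord_dom c) j (D1 c (f n) i) (D2 c (f n) j i)"
    "L2loc (coord_dom c) (D2 c (f n) j i)"
    using H unfolding numeral_2_eq_2 Hloc_Suc_iff[OF W] Hloc.simps(1) D1_def D2_def by blast+
qed

text \<open>By the isometry condition, the length of the image of a vector field does not depend on the immersion.\<close>

lemma differential_L2_bounded:
  assumes F: "immersion_family c g f" and L: "\<And>n. L2loc (coord_dom c) (\<lambda>x. differential c (f n) x (X x))"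
  shows "L2_bounded (coord_dom c) (\<lambda>n x. differential c (f n) x (X x))"
  unfolding L2_bounded_def
proof (intro allI impI)
  let ?W = "coord_dom c"
  fix K assume "compact K \<and> K \<subseteq> ?W"
  then have K: "compact K" "K \<subseteq> ?W" by auto
  have LK: "L2_on K (\<lambda>x. differential c (f n) x (X x))" for n using L K by (auto simp: L2loc_def)
  have eq: "(LINT x|lebesgue_on K. (norm (differential c (f n) x (X x)))\<^sup>2) = (LINT x|lebesgue_on K. (norm (differential c (f 0) x (X x)))\<^sup>2)" for n
  proof (rule integral_cong_AE)
    show "(\<lambda>x. (norm (differential c (f n) x (X x)))\<^sup>2) \<in> borel_measurable (lebesgue_on K)"
      "(\<lambda>x. (norm (differential c (f 0) x (X x)))\<^sup>2) \<in> borel_measurable (lebesgue_on K)"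
      using L2_on_measurable[OF LK] by measurable
    have "AE x in lebesgue_on ?W. (norm (differential c (f n) x (X x)))\<^sup>2 = (norm (differential c (f 0) x (X x)))\<^sup>2"
      using immersion_familyD(3)[OF F, of n] immersion_familyD(3)[OF F, of 0]
      by eventually_elim (simp add: power2_norm_eq_inner)
    then show "AE x in lebesgue_on K. (norm (differential c (f n) x (X x)))\<^sup>2 = (norm (differential c (f 0) x (X x)))\<^sup>2"
      by (rule AE_lebesgue_on_subset) (use K immersion_familyD(1)[OF F] in \<open>auto simp: compact_lebesgue open_lebesgue\<close>)
  qed
  show "\<exists>C. \<forall>n. L2_on K (\<lambda>x. differential c (f n) x (X x)) \<and>
      (LINT x|lebesgue_on K. (norm (differential c (f n) x (X x)))\<^sup>2) \<le> C"
    by (intro exI[of _ "LINT x|lebesgue_on K. (norm (differential c (f 0) x (X x)))\<^sup>2"] allI conjI LK eq_refl[OF eq])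
qed

lemma differential_axis: "differential c f x (axis i 1) = D1 c f i x"
  using exhaust_2[of i] by (auto simp: differential_def UNIV_2 axis_def)

lemma D1_L2_bounded:
  assumes F: "immersion_family c g f"
  shows "L2_bounded (coord_dom c) (\<lambda>n. D1 c (f n) i)"
  using differential_L2_bounded[OF F, of "\<lambda>_. axis i 1"] immersion_familyD(7)[OF F] by (simp add: differential_axis)

lemma L2_bounded_add:
  assumes "L2_bounded W u" "L2_bounded W v"
  shows "L2_bounded W (\<lambda>n x. u n x + v n x)"
  unfolding L2_bounded_def
proof (intro allI impI)
  fix K assume "compact K \<and> K \<subseteq> W"
  then have K: "compact K" "K \<subseteq> W" by auto
  obtain C where C: "\<And>n. L2_on K (u n)" "\<And>n. (LINT x|lebesgue_on K. (norm (u n x))\<^sup>2) \<le> C"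
    by (rule L2_boundedD[OF assms(1) K], rule that)
  obtain D where D: "\<And>n. L2_on K (v n)" "\<And>n. (LINT x|lebesgue_on K. (norm (v n x))\<^sup>2) \<le> D"
    by (rule L2_boundedD[OF assms(2) K], rule that)
  have "(LINT x|lebesgue_on K. (norm (u n x + v n x))\<^sup>2) \<le> 2 * C + 2 * D" for n
    using integral_norm_square_add_le[OF C(1) D(1), of n n] C(2)[of n] D(2)[of n] by linarith
  then show "\<exists>C. \<forall>n. L2_on K (\<lambda>x. u n x + v n x) \<and> (LINT x|lebesgue_on K. (norm (u n x + v n x))\<^sup>2) \<le> C"
    using L2_on_add[OF C(1) D(1)] by blast
qed

text \<open>Collecting the upper index into a vector turns the tangential term into the differential
  applied to a vector field, to which the isometry condition applies.\<close>

definition christoffel_vec :: "'a chart \<Rightarrow> 'a metric_tensor \<Rightarrow> 2 \<Rightarrow> 2 \<Rightarrow> real^2 \<Rightarrow> real^2" where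
  "christoffel_vec c g i j x = (\<chi> k. christoffel c g k i j x)"

lemma sff_eq: "second_fundamental_form c g f i j x = D2 c f i j x - differential c f x (christoffel_vec c g i j x)"
  by (simp add: second_fundamental_form_def differential_def christoffel_vec_def)

text \<open>For each \<open>n\<close> the term is the second derivative minus the second fundamental
  form, hence locally square integrable whatever the Christoffel symbols are; uniformity in
  \<open>n\<close> is the isometry condition.\<close>

lemma tangential_L2_bounded:
  assumes F: "immersion_family c g f"
  shows "L2_bounded (coord_dom c) (\<lambda>n x. differential c (f n) x (christoffel_vec c g i j x))"
proof (rule differential_L2_bounded[OF F])
  fix n
  have "L2loc (coord_dom c) (\<lambda>x. D2 c (f n) i j x - second_fundamental_form c g (f n) i j x)"
    by (rule L2loc_diff[OF immersion_familyD(9)[OF F] L2_bounded_L2loc[OF immersion_familyD(4)[OF F]]])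
  then show "L2loc (coord_dom c) (\<lambda>x. differential c (f n) x (christoffel_vec c g i j x))" by (simp add: sff_eq)
qed

lemma D2_L2_bounded:
  assumes F: "immersion_family c g f"
  shows "L2_bounded (coord_dom c) (\<lambda>n. D2 c (f n) i j)"
  using L2_bounded_add[OF immersion_familyD(4)[OF F] tangential_L2_bounded[OF F], of i j i j] by (simp add: sff_eq)

context
  fixes c :: "'a chart" and g f and r :: "nat \<Rightarrow> nat" and a :: "nat \<Rightarrow> real^3" and F :: "'a \<Rightarrow> real^3"
  assumes family: "immersion_family c g f"
    and lim: "AE x in lebesgue_on (coord_dom c). (\<lambda>n. in_coords c (f (r n)) x - a n) \<longlonglongrightarrow> in_coords c F x"
begin

private lemma W: "open (coord_dom c)" by (rule immersion_familyD(1)[OF family])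

lemma weakly_conv_Hloc_limit:
  "weakly_conv_Hloc 2 (coord_dom c) (\<lambda>n. in_coords c (\<lambda>p. f (r n) p - a n)) (in_coords c F)"
proof (rule weakly_conv_H2loc_if_AE[OF W])
  show "AE x in lebesgue_on (coord_dom c). (\<lambda>n. in_coords c (\<lambda>p. f (r n) p - a n) x) \<longlonglongrightarrow> in_coords c F x"
    using lim by (simp add: in_coords_diff_const)
  \<comment> \<open>Constants drop out of weak derivatives, so the translations are felt at order 0
    only.\<close>
  have D: "weak_partial (coord_dom c) i (in_coords c (\<lambda>p. f (r n) p - a n)) = D1 c (f (r n)) i" for i n
    using D1_diff_const[OF W, of "f (r n)" "a n" i] by (simp add: D1_def)
  show "L2_bounded (coord_dom c) (\<lambda>n. weak_partial (coord_dom c) i (in_coords c (\<lambda>p. f (r n) p - a n)))" for i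
    unfolding D by (rule L2_bounded_subseq[OF D1_L2_bounded[OF family]])
  show "L2_bounded (coord_dom c) (\<lambda>n. weak_partial (coord_dom c) j (weak_partial (coord_dom c) i (in_coords c (\<lambda>p. f (r n) p - a n))))" for i j
    unfolding D using L2_bounded_subseq[OF D2_L2_bounded[OF family, of j i], of r] by (simp add: D2_def)
  show "Hloc 2 (coord_dom c) (in_coords c (\<lambda>p. f (r n) p - a n))" for n
    using immersion_familyD(5-9)[OF family, where n="r n"] L2loc_diff[OF _ L2loc_const]
    unfolding numeral_2_eq_2 Hloc_Suc_iff[OF W] D
    unfolding in_coords_diff_const is_weak_partial_diff_const_iff[OF W] by (auto simp: D2_def)
qed

lemma D1_D2_weakly_conv:
  "weakly_conv_L2loc (coord_dom c) (\<lambda>n. D1 c (f (r n)) i) (D1 c F i)"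
  "weakly_conv_L2loc (coord_dom c) (\<lambda>n. D2 c (f (r n)) j i) (D2 c F j i)"
proof -
  have D: "weak_partial (coord_dom c) i (in_coords c (\<lambda>p. f (r n) p - a n)) = D1 c (f (r n)) i" for i n
    using D1_diff_const[OF W, of "f (r n)" "a n" i] by (simp add: D1_def)
  have "weak_derivs_conv 2 (coord_dom c) (\<lambda>n. in_coords c (\<lambda>p. f (r n) p - a n)) (in_coords c F)"
    using weakly_conv_Hloc_limit by (simp add: weakly_conv_Hloc_def)
  then have "weakly_conv_L2loc (coord_dom c) (\<lambda>n. D1 c (f (r n)) i) (D1 c F i) \<and>
    weakly_conv_L2loc (coord_dom c) (\<lambda>n. D2 c (f (r n)) j i) (D2 c F j i)"
    unfolding numeral_2_eq_2 weak_derivs_conv.simps D D1_def[of c F, symmetric] D2_def by blast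
  then show "weakly_conv_L2loc (coord_dom c) (\<lambda>n. D1 c (f (r n)) i) (D1 c F i)"
    "weakly_conv_L2loc (coord_dom c) (\<lambda>n. D2 c (f (r n)) j i) (D2 c F j i)" by auto
qed

text \<open>Bounded second derivatives make first derivatives compact; the two directions are
  treated in succession. An arbitrary \<open>s\<close> is allowed because the subsequence criterion
  for weak convergence asks for it.\<close>

lemma D1_AE_subsequence:
  assumes s: "strict_mono (s :: nat \<Rightarrow> nat)"
  obtains t :: "nat \<Rightarrow> nat" where "strict_mono t"
    "AE x in lebesgue_on (coord_dom c). \<forall>i. (\<lambda>n. D1 c (f (r (s (t n)))) i x) \<longlonglongrightarrow> D1 c F i x"
proof -
  have step: "\<exists>t :: nat \<Rightarrow> nat. strict_mono t \<and> (AE x in lebesgue_on (coord_dom c). (\<lambda>n. D1 c (f (r (s (t n)))) i x) \<longlonglongrightarrow> D1 c F i x)"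
    if s: "strict_mono (s :: nat \<Rightarrow> nat)" for s i
  proof -
    obtain t :: "nat \<Rightarrow> nat" where "strict_mono t" "AE x in lebesgue_on (coord_dom c). (\<lambda>n. D1 c (f (r (s (t n)))) i x) \<longlonglongrightarrow> D1 c F i x"
    proof (rule weak_limit_AE_subsequence[OF W, of "\<lambda>n. D1 c (f (r (s n))) i" "\<lambda>j n. D2 c (f (r (s n))) j i" "D1 c F i"])
      show "L2_bounded (coord_dom c) (\<lambda>n. D1 c (f (r (s n))) i)"
        by (rule L2_bounded_subseq[OF D1_L2_bounded[OF family, of i], of "\<lambda>n. r (s n)"])
      show "is_weak_partial (coord_dom c) j (D1 c (f (r (s n))) i) (D2 c (f (r (s n))) j i)" for n j
        by (rule immersion_familyD(8)[OF family])
      show "L2_bounded (coord_dom c) (\<lambda>n. D2 c (f (r (s n))) j i)" for j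
        by (rule L2_bounded_subseq[OF D2_L2_bounded[OF family, of j i], of "\<lambda>n. r (s n)"])
      show "weakly_conv_L2loc (coord_dom c) (\<lambda>n. D1 c (f (r (s n))) i) (D1 c F i)"
        by (rule weakly_conv_L2loc_subseq[OF D1_D2_weakly_conv(1) s])
    qed (rule that)
    then show ?thesis by blast
  qed
  obtain t1 :: "nat \<Rightarrow> nat" where t1: "strict_mono t1" "AE x in lebesgue_on (coord_dom c). (\<lambda>n. D1 c (f (r (s (t1 n)))) 1 x) \<longlonglongrightarrow> D1 c F 1 x"
    using step[OF s] by blast
  have "strict_mono (\<lambda>n. s (t1 n))" using s t1(1) by (simp add: strict_mono_def)
  from step[OF this] obtain t2 :: "nat \<Rightarrow> nat" where t2: "strict_mono t2" "AE x in lebesgue_on (coord_dom c). (\<lambda>n. D1 c (f (r (s (t1 (t2 n))))) 2 x) \<longlonglongrightarrow> D1 c F 2 x"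
    by blast
  have "AE x in lebesgue_on (coord_dom c). \<forall>i. (\<lambda>n. D1 c (f (r (s (t1 (t2 n))))) i x) \<longlonglongrightarrow> D1 c F i x"
    using t1(2) t2(2)
  proof eventually_elim
    case (elim x)
    then show ?case using LIMSEQ_subseq_LIMSEQ[OF elim(1) t2(1)] by (simp add: forall_2 o_def)
  qed
  moreover have "strict_mono (\<lambda>n. t1 (t2 n))" using t1(1) t2(1) by (simp add: strict_mono_def)
  ultimately show thesis by (intro that[of "\<lambda>n. t1 (t2 n)"])
qed

lemma differential_tendsto:
  assumes "\<forall>i. (\<lambda>n. D1 c (h n) i x) \<longlonglongrightarrow> D1 c F i x"
  shows "(\<lambda>n. differential c (h n) x X) \<longlonglongrightarrow> differential c F x X"
  unfolding differential_def using assms by (intro tendsto_sum tendsto_scaleR tendsto_const) blast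

text \<open>The condition is quadratic in the first derivatives and could be lost under weak
  convergence; along an almost everywhere convergent subsequence it persists pointwise.\<close>

lemma limit_isometric:
  "AE x in lebesgue_on (coord_dom c). \<forall>X Y. differential c F x X \<bullet> differential c F x Y = X \<bullet> (g c x *v Y)"
proof -
  obtain t :: "nat \<Rightarrow> nat" where t: "AE x in lebesgue_on (coord_dom c). \<forall>i. (\<lambda>n. D1 c (f (r (id (t n)))) i x) \<longlonglongrightarrow> D1 c F i x"
    by (rule D1_AE_subsequence[OF strict_mono_id], rule that)
  have "AE x in lebesgue_on (coord_dom c). \<forall>n. \<forall>X Y. differential c (f n) x X \<bullet> differential c (f n) x Y = X \<bullet> (g c x *v Y)"
    unfolding AE_all_countable using immersion_familyD(3)[OF family] by blast
  with t show ?thesis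
  proof eventually_elim
    case (elim x)
    show ?case
    proof (intro allI)
      fix X Y
      have "(\<lambda>n. differential c (f (r (id (t n)))) x X \<bullet> differential c (f (r (id (t n)))) x Y) \<longlonglongrightarrow> differential c F x X \<bullet> differential c F x Y"
        by (intro tendsto_inner differential_tendsto elim(1))
      then show "differential c F x X \<bullet> differential c F x Y = X \<bullet> (g c x *v Y)"
        using elim(2) by (simp add: LIMSEQ_const_iff)
    qed
  qed
qed

text \<open>At each point the Christoffel symbols are fixed coefficients, so the tangential term
  converges almost everywhere along subsequences. Its L^2 bound makes this weak convergence, and the
  limit does not depend on the subsequence.\<close>

lemma sff_weakly_conv:
  "weakly_conv_L2loc (coord_dom c) (\<lambda>n. second_fundamental_form c g (f (r n)) i j) (second_fundamental_form c g F i j)"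
proof -
  let ?T = "\<lambda>h x. differential c h x (christoffel_vec c g i j x)"
  have T: "L2_bounded (coord_dom c) (\<lambda>n. ?T (f (r n)))"
    by (rule L2_bounded_subseq[OF tangential_L2_bounded[OF family]])
  have "weakly_conv_L2loc (coord_dom c) (\<lambda>n. ?T (f (r n))) (?T F)"
  proof (rule weakly_conv_L2loc_if_subseqs)
    show "L2loc (coord_dom c) (?T (f (r n)))" for n using L2_bounded_L2loc[OF T] .
    fix s :: "nat \<Rightarrow> nat" assume s: "strict_mono s"
    obtain t :: "nat \<Rightarrow> nat" where t: "strict_mono t" "AE x in lebesgue_on (coord_dom c). \<forall>i. (\<lambda>n. D1 c (f (r (s (t n)))) i x) \<longlonglongrightarrow> D1 c F i x"
      by (rule D1_AE_subsequence[OF s], rule that)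
    have "weakly_conv_L2loc (coord_dom c) (\<lambda>n. ?T (f (r (s (t n))))) (?T F)"
    proof (rule weakly_conv_L2loc_AE[OF W])
      show "L2_bounded (coord_dom c) (\<lambda>n. ?T (f (r (s (t n)))))" by (rule L2_bounded_subseq[OF T])
      show "AE x in lebesgue_on (coord_dom c). (\<lambda>n. ?T (f (r (s (t n)))) x) \<longlonglongrightarrow> ?T F x"
        using t(2) by eventually_elim (rule differential_tendsto)
    qed
    with t(1) show "\<exists>t. strict_mono t \<and> weakly_conv_L2loc (coord_dom c) (\<lambda>n. ?T (f (r (s (t n))))) (?T F)" by blast
  qed
  from weakly_conv_L2loc_diff[OF D1_D2_weakly_conv(2) this] show ?thesis by (simp add: sff_eq[abs_def])
qed

end

text \<open>Equal images make the quadratic form of \<open>g\<close> vanish at the difference, so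
  positivity of \<open>g\<close> returns the injectivity that a limit of immersions could
  lose.\<close>

lemma differential_inj:
  assumes iso: "\<forall>X Y. differential c F x X \<bullet> differential c F x Y = X \<bullet> (g c x *v Y)"
    and pos: "\<forall>X. X \<noteq> 0 \<longrightarrow> X \<bullet> (g c x *v X) > 0"
  shows "inj (differential c F x)"
proof (rule injI, rule ccontr)
  fix X Y assume *: "differential c F x X = differential c F x Y" "X \<noteq> Y"
  have "differential c F x (X - Y) = differential c F x X - differential c F x Y"
    by (simp add: differential_def scaleR_diff_left sum_subtractf)
  then have "(X - Y) \<bullet> (g c x *v (X - Y)) = 0" using iso * by (metis diff_self inner_zero_left)
  then show False using pos *(2) by (metis eq_iff_diff_eq_0 less_irrefl)
qed

section \<open>Passing between charts\<close>

lemma AE_lebesgue_iff_negligible: "(AE x in lebesgue. P x) \<longleftrightarrow> negligible {x. \<not> P x}"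
proof
  assume "AE x in lebesgue. P x"
  then obtain N where N: "N \<in> null_sets lebesgue" "{x \<in> space lebesgue. \<not> P x} \<subseteq> N" by (auto simp: eventually_ae_filter)
  then show "negligible {x. \<not> P x}"
    using negligible_subset[of N "{x. \<not> P x}"] by (simp add: negligible_iff_null_sets)
next
  assume "negligible {x. \<not> P x}"
  then have "AE x in lebesgue. x \<notin> {x. \<not> P x}" by (intro AE_not_in) (simp add: negligible_iff_null_sets)
  then show "AE x in lebesgue. P x" by simp
qed

lemma chartD:
  assumes "is_chart M c"
  shows "openin (top_of_set M) (fst c)" "open (coord_dom c)" "fst c \<subseteq> M"
    "\<And>x. x \<in> coord_dom c \<Longrightarrow> chart_inv c x \<in> fst c" "\<And>x. x \<in> coord_dom c \<Longrightarrow> snd c (chart_inv c x) = x"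
    "\<And>p. p \<in> fst c \<Longrightarrow> snd c p \<in> coord_dom c" "\<And>p. p \<in> fst c \<Longrightarrow> chart_inv c (snd c p) = p"
    "homeomorphism (fst c) (coord_dom c) (snd c) (chart_inv c)"
proof -
  show o: "openin (top_of_set M) (fst c)" and "open (coord_dom c)"
    and h: "homeomorphism (fst c) (coord_dom c) (snd c) (chart_inv c)"
    using assms by (auto simp: is_chart_def)
  show "fst c \<subseteq> M" using openin_imp_subset[OF o] .
  show "\<And>x. x \<in> coord_dom c \<Longrightarrow> chart_inv c x \<in> fst c" "\<And>x. x \<in> coord_dom c \<Longrightarrow> snd c (chart_inv c x) = x"
    "\<And>p. p \<in> fst c \<Longrightarrow> snd c p \<in> coord_dom c" "\<And>p. p \<in> fst c \<Longrightarrow> chart_inv c (snd c p) = p"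
    using h by (auto simp: homeomorphism_def)
qed

lemma openin_chart_image:
  assumes c: "is_chart M c" and B: "open B" "B \<subseteq> coord_dom c"
  shows "openin (top_of_set M) (chart_inv c ` B)"
proof -
  have "openin (top_of_set (coord_dom c)) B" using B by (simp add: openin_open_eq chartD(2)[OF c])
  then have "openin (top_of_set (fst c)) (chart_inv c ` B)"
    using homeomorphism_imp_open_map[OF homeomorphism_symD[OF chartD(8)[OF c]]] by blast
  then show ?thesis using chartD(1)[OF c] openin_trans by blast
qed

lemma open_chart_preimage:
  assumes c: "is_chart M c" and U: "openin (top_of_set M) U" "U \<subseteq> fst c"
  shows "open (snd c ` U)"
proof -
  have "openin (top_of_set (fst c)) U"
    using U chartD(3)[OF c] by (meson openin_subset_trans)
  then have "openin (top_of_set (coord_dom c)) (snd c ` U)"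
    using homeomorphism_imp_open_map[OF chartD(8)[OF c]] by blast
  then show ?thesis using openin_open_trans chartD(2)[OF c] by blast
qed

text \<open>The set is covered by the image of part of \<open>N\<close> under the transition in the
  opposite direction, and differentiable maps between spaces of equal dimension preserve null
  sets.\<close>

lemma negligible_chart_change:
  assumes S: "smooth_surface M A" and c: "c \<in> A" and d: "d \<in> A" and N: "negligible N"
  shows "negligible {x \<in> coord_dom c. chart_inv c x \<in> fst d \<and> snd d (chart_inv c x) \<in> N}"
proof -
  have cc: "is_chart M c" and cd: "is_chart M d" using S c d by (auto simp: smooth_surface_def)
  have "smooth_on (overlap d c) (transition d c)" using S c d by (auto simp: smooth_surface_def)
  then have "C_on (Suc 0) (overlap d c) (transition d c)" unfolding smooth_on_def by blast
  then have "\<forall>x\<in>overlap d c. transition d c differentiable (at x)" by simp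
  then have "transition d c differentiable_on (N \<inter> overlap d c)"
    by (auto simp: differentiable_on_def intro: differentiable_at_withinI)
  then have "negligible (transition d c ` (N \<inter> overlap d c))"
    by (intro negligible_differentiable_image_negligible) (auto intro: negligible_subset[OF N])
  moreover have "{x \<in> coord_dom c. chart_inv c x \<in> fst d \<and> snd d (chart_inv c x) \<in> N} \<subseteq> transition d c ` (N \<inter> overlap d c)"
  proof safe
    fix x assume x: "x \<in> coord_dom c" "chart_inv c x \<in> fst d" "snd d (chart_inv c x) \<in> N"
    have "x = transition d c (snd d (chart_inv c x))"
      using x by (simp add: transition_def chartD(7)[OF cd] chartD(5)[OF cc])
    moreover have "snd d (chart_inv c x) \<in> overlap d c"
      using x chartD(4)[OF cc] by (auto simp: overlap_def)
    ultimately show "x \<in> transition d c ` (N \<inter> overlap d c)" using x(3) by blast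
  qed
  ultimately show ?thesis by (rule negligible_subset)
qed

text \<open>A homotopy between the constant loops at \<open>x\<close> and \<open>y\<close> carries
  the base point along a path from \<open>x\<close> to \<open>y\<close>.\<close>

lemma simply_connected_imp_connected_space:
  fixes M :: "'a::topological_space set"
  assumes "simply_connected M" shows "connected M"
proof -
  have "path_component M x y" if "x \<in> M" "y \<in> M" for x y
  proof -
    have "homotopic_loops M (\<lambda>_. x) (\<lambda>_. y)"
      using assms[unfolded simply_connected_def, rule_format, of "\<lambda>_. x" "\<lambda>_. y"] that
      by (auto simp: path_def pathfinish_def pathstart_def path_image_def)
    from homotopic_loops_imp_path_component_value[OF this, of 0] show ?thesis by simp
  qed
  then show ?thesis by (intro path_connected_imp_connected) (simp add: path_connected_component)
qed

text \<open>Lindelof on a second countable surface. The closed boxes stay inside the chart so that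
  the compactness theorems apply, while the open ones cover.\<close>

lemma countable_box_cover:
  fixes M :: "'a::{t2_space, second_countable_topology} set"
  assumes S: "smooth_surface M A" and ne: "M \<noteq> {}"
  obtains c :: "nat \<Rightarrow> 'a chart" and p q :: "nat \<Rightarrow> real^2" where
    "\<And>k. c k \<in> A" "\<And>k. cbox (p k) (q k) \<subseteq> coord_dom (c k)" "\<And>k. box (p k) (q k) \<noteq> {}"
    "(\<Union>k. chart_inv (c k) ` box (p k) (q k)) = M"
proof -
  define T where "T = {(c, p, q). c \<in> A \<and> cbox p q \<subseteq> coord_dom c \<and> box p q \<noteq> {}}"
  define U where "U = (\<lambda>(c :: 'a chart, p, q). chart_inv c ` box p q)"
  have chart: "is_chart M c" if "c \<in> A" for c using S that by (auto simp: smooth_surface_def)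
  have op: "openin (top_of_set M) (U t)" if "t \<in> T" for t
    using that box_subset_cbox by (auto simp: T_def U_def intro!: openin_chart_image chart)
  have cover: "\<Union>(U ` T) = M"
  proof
    show "\<Union>(U ` T) \<subseteq> M" using op openin_imp_subset by blast
    show "M \<subseteq> \<Union>(U ` T)"
    proof
      fix x assume "x \<in> M"
      then obtain c where c: "c \<in> A" "x \<in> fst c" using S by (auto simp: smooth_surface_def)
      let ?y = "snd c x"
      have y: "?y \<in> coord_dom c" using chartD(6)[OF chart[OF c(1)] c(2)] .
      then have 1: "cbox ?y ?y \<subseteq> coord_dom c" "cbox ?y ?y \<noteq> {}" by auto
      obtain p q where "cbox ?y ?y \<subseteq> box p q" "cbox p q \<subseteq> coord_dom c" "box p q \<noteq> {}"
        by (rule cbox_enlarge[OF chartD(2)[OF chart[OF c(1)]] 1], rule that)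
      moreover from this have "x \<in> U (c, p, q)"
        using chartD(7)[OF chart[OF c(1)] c(2)] by (force simp: U_def)
      moreover from calculation have "(c, p, q) \<in> T" using c(1) by (simp add: T_def)
      ultimately show "x \<in> \<Union>(U ` T)" by blast
    qed
  qed
  obtain \<F> where \<F>: "\<F> \<subseteq> U ` T" "countable \<F>" "\<Union>\<F> = M"
    using Lindelof_openin[of "U ` T" M] op cover by (metis (no_types, lifting) imageE)
  have "\<F> \<noteq> {}" using \<F>(3) ne by auto
  \<comment> \<open>The countable family is listed by the natural numbers, possibly with
    repetitions.\<close>
  then have rng: "range (from_nat_into \<F>) = \<F>" using \<F>(2) by (rule range_from_nat_into)
  have "\<forall>k. \<exists>t\<in>T. from_nat_into \<F> k = U t" using rng \<F>(1) by blast
  then obtain t where t: "\<And>k. t k \<in> T" "\<And>k. from_nat_into \<F> k = U (t k)" by metis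
  show thesis
  proof (rule that[of "\<lambda>k. fst (t k)" "\<lambda>k. fst (snd (t k))" "\<lambda>k. snd (snd (t k))"])
    show "fst (t k) \<in> A" "cbox (fst (snd (t k))) (snd (snd (t k))) \<subseteq> coord_dom (fst (t k))"
      "box (fst (snd (t k))) (snd (snd (t k))) \<noteq> {}" for k
      using t(1)[of k] by (auto simp: T_def)
    have "chart_inv (fst (t k)) ` box (fst (snd (t k))) (snd (snd (t k))) = U (t k)" for k
      by (simp add: U_def case_prod_unfold)
    moreover have "(\<Union>k. U (t k)) = M" unfolding t(2)[symmetric] rng by (rule \<F>(3))
    ultimately show "(\<Union>k. chart_inv (fst (t k)) ` box (fst (snd (t k))) (snd (snd (t k)))) = M" by simp
  qed
qed

text \<open>Each box comes with its own constants. All of them turn out to differ from those of box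
  0 by convergent sequences, so the constants of box 0 serve as translations everywhere.\<close>

lemma convergent_after_translation:
  fixes M :: "'a::{t2_space, second_countable_topology} set" and f :: "nat \<Rightarrow> 'a \<Rightarrow> real^3"
  assumes S: "smooth_surface M A" and conn: "connected M" and fam: "\<And>c. c \<in> A \<Longrightarrow> immersion_family c g f"
  obtains r :: "nat \<Rightarrow> nat" and a :: "nat \<Rightarrow> real^3" where "strict_mono r"
    "functions_L2_bounded A f \<Longrightarrow> \<forall>n. a n = 0"
    "\<And>c. c \<in> A \<Longrightarrow> AE x in lebesgue. x \<in> coord_dom c \<longrightarrow> convergent (\<lambda>n. in_coords c (f (r n)) x - a n)"
proof (cases "M = {}")
  case True
  have "coord_dom c = {}" if "c \<in> A" for c
    using S that True chartD(3)[of M c] by (auto simp: smooth_surface_def coord_dom_def)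
  then show thesis using that[of id "\<lambda>_. 0"] strict_mono_id by auto
next
  case False
  obtain c :: "nat \<Rightarrow> 'a chart" and p q where c: "\<And>k. c k \<in> A"
    and pq: "\<And>k. cbox (p k) (q k) \<subseteq> coord_dom (c k)" "\<And>k. box (p k) (q k) \<noteq> {}"
    and cover: "(\<Union>k. chart_inv (c k) ` box (p k) (q k)) = M"
    by (rule countable_box_cover[OF S False], rule that)
  have chart: "is_chart M c" if "c \<in> A" for c using S that by (auto simp: smooth_surface_def)
  define U where "U k = chart_inv (c k) ` box (p k) (q k)" for k
  have bsub: "box (p k) (q k) \<subseteq> coord_dom (c k)" for k using pq(1) box_subset_cbox by blast
  have Uop: "openin (top_of_set M) (U k)" for k
    unfolding U_def by (rule openin_chart_image[OF chart[OF c] open_box bsub])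
  have Uc: "U k \<subseteq> fst (c k)" for k
    unfolding U_def using bsub chartD(4)[OF chart[OF c]] by blast
  define Q where "Q k \<beta> \<longleftrightarrow> (L2_bounded (coord_dom (c k)) (\<lambda>n. in_coords (c k) (f n)) \<longrightarrow> (\<forall>n. \<beta> n = 0)) \<and>
    (\<forall>s :: nat \<Rightarrow> nat. strict_mono s \<longrightarrow> (\<exists>r. strict_mono r \<and>
      (AE x in lebesgue. x \<in> cbox (p k) (q k) \<longrightarrow> convergent (\<lambda>n. in_coords (c k) (f (s (r n))) x - \<beta> (s (r n))))))"
    for k and \<beta> :: "nat \<Rightarrow> real^3"
  have "\<exists>\<beta>. Q k \<beta>" for k
    unfolding Q_def
  proof (rule normalized_subsequences[where v="\<lambda>i n. D1 (c k) (f n) i"])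
    note F = fam[OF c[of k]]
    show "open (coord_dom (c k))" by (rule immersion_familyD(1)[OF F])
    show "L2loc (coord_dom (c k)) (in_coords (c k) (f n))" for n by (rule immersion_familyD(5)[OF F])
    show "is_weak_partial (coord_dom (c k)) i (in_coords (c k) (f n)) (D1 (c k) (f n) i)" for n i
      by (rule immersion_familyD(6)[OF F])
    show "L2_bounded (coord_dom (c k)) (\<lambda>n. D1 (c k) (f n) i)" for i by (rule D1_L2_bounded[OF F])
    show "cbox (p k) (q k) \<subseteq> coord_dom (c k)" by (rule pq)
    show "cbox (p k) (q k) \<noteq> {}" using pq(2)[of k] box_subset_cbox by blast
  qed
  then obtain \<beta> where \<beta>: "\<And>k. Q k (\<beta> k)" by metis
  define P where "P k s \<longleftrightarrow> (AE x in lebesgue. x \<in> cbox (p k) (q k) \<longrightarrow> convergent (\<lambda>n. in_coords (c k) (f (s n)) x - \<beta> k (s n)))"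
    for k and s :: "nat \<Rightarrow> nat"
  obtain r :: "nat \<Rightarrow> nat" where r: "strict_mono r" "\<And>k. P k r"
  proof (rule diagonal_subsequence[where P=P])
    show "\<exists>r. strict_mono r \<and> P k (s \<circ> r)" if "strict_mono s" for k and s :: "nat \<Rightarrow> nat"
      using \<beta>[of k] that by (simp add: P_def Q_def o_def)
    show "P k (s \<circ> r)" if r: "strict_mono r" and P: "P k s" for k and s r :: "nat \<Rightarrow> nat"
      using P unfolding P_def
    proof eventually_elim
      case (elim x)
      then show ?case
        using convergent_subseq_convergent[OF _ r, of "\<lambda>n. in_coords (c k) (f (s n)) x - \<beta> k (s n)"] by (simp add: o_def)
    qed
    show "P k s" if "P k (\<lambda>n. s (j + n))" for k j and s :: "nat \<Rightarrow> nat"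
      using that unfolding P_def
    proof eventually_elim
      case (elim x)
      then show ?case
        using convergent_ignore_initial_segment[of "\<lambda>n. in_coords (c k) (f (s n)) x - \<beta> k (s n)" j] by (simp add: add.commute)
    qed
  qed (rule that)
  define N where "N k = {x \<in> cbox (p k) (q k). \<not> convergent (\<lambda>n. in_coords (c k) (f (r n)) x - \<beta> k (r n))}" for k
  have N: "negligible (N k)" for k
    using r(2)[of k] unfolding P_def AE_lebesgue_iff_negligible N_def by (simp add: Collect_conj_eq)
  have good: "convergent (\<lambda>n. f (r n) x - \<beta> k (r n))" if "x \<in> U k" "snd (c k) x \<notin> N k" for x k
  proof -
    obtain y where y: "y \<in> box (p k) (q k)" "x = chart_inv (c k) y" using \<open>x \<in> U k\<close> by (auto simp: U_def)
    then have "snd (c k) x = y" using chartD(5)[OF chart[OF c]] bsub by blast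
    then show ?thesis using that(2) y box_subset_cbox[of "p k" "q k"] by (auto simp: N_def in_coords_def)
  qed
  \<comment> \<open>A nonempty open overlap is not null, so it contains a point exceptional for
    neither box; subtracting the two convergent sequences at this point eliminates
    \<open>f\<close>.\<close>
  have overlapping: "convergent (\<lambda>n. \<beta> k (r n) - \<beta> l (r n))" if kl: "U k \<inter> U l \<noteq> {}" for k l
  proof -
    have "open (snd (c k) ` (U k \<inter> U l))"
      using Uop Uc by (intro open_chart_preimage[OF chart[OF c]] openin_Int) auto
    moreover have "snd (c k) ` (U k \<inter> U l) \<noteq> {}" using kl by simp
    ultimately have "\<not> negligible (snd (c k) ` (U k \<inter> U l))" by (rule open_not_negligible)
    moreover have "negligible (N k \<union> {x \<in> coord_dom (c k). chart_inv (c k) x \<in> fst (c l) \<and> snd (c l) (chart_inv (c k) x) \<in> N l})"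
      by (intro negligible_Un N negligible_chart_change[OF S c c])
    ultimately obtain y where y: "y \<in> snd (c k) ` (U k \<inter> U l)"
      "y \<notin> N k \<union> {x \<in> coord_dom (c k). chart_inv (c k) x \<in> fst (c l) \<and> snd (c l) (chart_inv (c k) x) \<in> N l}"
      using negligible_subset by blast
    then obtain x where x: "x \<in> U k" "x \<in> U l" "y = snd (c k) x" by blast
    then have xc: "x \<in> fst (c k)" "x \<in> fst (c l)" using Uc by auto
    have "snd (c k) x \<notin> N k" "snd (c l) x \<notin> N l"
      using y(2) x(3) xc chartD(6)[OF chart[OF c] xc(1)] chartD(7)[OF chart[OF c] xc(1)] by auto
    then have "convergent (\<lambda>n. f (r n) x - \<beta> k (r n))" "convergent (\<lambda>n. f (r n) x - \<beta> l (r n))"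
      using good x by auto
    from convergent_diff[OF this(2,1)] show ?thesis by simp
  qed
  \<comment> \<open>Overlapping boxes lie both in \<open>I\<close> or both outside, so a proper
    \<open>I\<close> would split \<open>M\<close> into two disjoint nonempty open sets.\<close>
  define I where "I = {k. convergent (\<lambda>n. \<beta> k (r n) - \<beta> 0 (r n))}"
  have "I = UNIV"
  proof (rule ccontr)
    assume "I \<noteq> UNIV"
    then obtain k where k: "k \<notin> I" by blast
    have disj: "(\<Union>i\<in>I. U i) \<inter> (\<Union>i\<in>-I. U i) = {}"
    proof (rule ccontr)
      assume "(\<Union>i\<in>I. U i) \<inter> (\<Union>i\<in>-I. U i) \<noteq> {}"
      then obtain i j where ij: "i \<in> I" "j \<notin> I" "U j \<inter> U i \<noteq> {}" by blast
      from convergent_add[OF overlapping[OF ij(3)], of "\<lambda>n. \<beta> i (r n) - \<beta> 0 (r n)"] ij(1,2)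
      show False by (simp add: I_def)
    qed
    have op: "openin (top_of_set M) (\<Union>i\<in>I. U i)" "openin (top_of_set M) (\<Union>i\<in>-I. U i)"
      using Uop by (auto intro!: openin_Union)
    have cov: "M \<subseteq> (\<Union>i\<in>I. U i) \<union> (\<Union>i\<in>-I. U i)" using cover by (auto simp: U_def)
    have "0 \<in> I" by (simp add: I_def convergent_const)
    then have ne1: "(\<Union>i\<in>I. U i) \<noteq> {}" using pq(2)[of 0] by (auto simp: U_def)
    have ne2: "(\<Union>i\<in>-I. U i) \<noteq> {}" using k pq(2)[of k] by (auto simp: U_def)
    have "\<not> connected M"
      unfolding connected_openin not_not
      by (rule exI[of _ "\<Union>i\<in>I. U i"], rule exI[of _ "\<Union>i\<in>-I. U i"], intro conjI op cov disj ne1 ne2)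
    with conn show False by contradiction
  qed
  then have conv: "convergent (\<lambda>n. \<beta> k (r n) - \<beta> 0 (r n))" for k by (auto simp: I_def)
  show thesis
  proof (rule that[of r "\<lambda>n. \<beta> 0 (r n)"])
    show "strict_mono r" by (rule r)
    \<comment> \<open>Local boundedness of the functions makes the constants of box 0 vanish, by the
      first clause of \<open>Q\<close>.\<close>
    show "\<forall>n. \<beta> 0 (r n) = 0" if "functions_L2_bounded A f"
      using \<beta>[of 0] that c[of 0] unfolding functions_L2_bounded_def Q_def by blast
    fix d assume d: "d \<in> A"
    \<comment> \<open>The exceptional points in chart \<open>d\<close> come from the null sets of
      the countably many boxes, pulled back through the changes of charts.\<close>
    let ?B = "\<lambda>k. {x \<in> coord_dom d. chart_inv d x \<in> fst (c k) \<and> snd (c k) (chart_inv d x) \<in> N k}"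
    have "negligible (\<Union>k. ?B k)"
      by (rule negligible_countable_Union) (auto intro: negligible_chart_change[OF S d c N])
    moreover have "{x. \<not> (x \<in> coord_dom d \<longrightarrow> convergent (\<lambda>n. in_coords d (f (r n)) x - \<beta> 0 (r n)))} \<subseteq> (\<Union>k. ?B k)"
    proof
      fix x assume "x \<in> {x. \<not> (x \<in> coord_dom d \<longrightarrow> convergent (\<lambda>n. in_coords d (f (r n)) x - \<beta> 0 (r n)))}"
      then have x: "x \<in> coord_dom d" "\<not> convergent (\<lambda>n. in_coords d (f (r n)) x - \<beta> 0 (r n))" by auto
      let ?y = "chart_inv d x"
      have "?y \<in> M" using chartD(3,4)[OF chart[OF d]] x(1) by blast
      then obtain k where k: "?y \<in> U k" using cover by (auto simp: U_def)
      have "snd (c k) ?y \<in> N k"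
      proof (rule ccontr)
        assume "snd (c k) ?y \<notin> N k"
        from convergent_add[OF good[OF k this] conv[of k]]
        have "convergent (\<lambda>n. f (r n) ?y - \<beta> 0 (r n))" by simp
        with x(2) show False by (simp add: in_coords_def)
      qed
      then have "x \<in> ?B k" using x(1) k subsetD[OF Uc] by auto
      then show "x \<in> (\<Union>k. ?B k)" by (rule UN_I[OF UNIV_I])
    qed
    ultimately show "AE x in lebesgue. x \<in> coord_dom d \<longrightarrow> convergent (\<lambda>n. in_coords d (f (r n)) x - \<beta> 0 (r n))"
      unfolding AE_lebesgue_iff_negligible by (rule negligible_subset)
  qed
qed

text \<open>Bounds on the second fundamental forms leave the position in space free, hence the
  translations \<open>a\<close>. The last clause is stated without them because they change no
  derivative.\<close>

theorem theorem6p3: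
  fixes M :: "'a::{t2_space, second_countable_topology} set"
    and A :: "'a chart set"
    and g :: "'a metric_tensor"
    and f :: "nat \<Rightarrow> 'a \<Rightarrow> real^3"
  assumes surface: "smooth_surface M A"
    and sc: "simply_connected M"
    and metric: "H1loc_metric A g"
    and imm: "\<And>n. H2loc_isometric_immersion A g (f n)"
    and bdd: "sff_L2_bounded A g f"
  shows "\<exists>(r :: nat \<Rightarrow> nat) (a :: nat \<Rightarrow> real^3) (F :: 'a \<Rightarrow> real^3).
           strict_mono r \<and>
           (functions_L2_bounded A f \<longrightarrow> (\<forall>n. a n = 0)) \<and>
           weakly_conv_H2loc A (\<lambda>n p. f (r n) p - a n) F \<and>
           H2loc_isometric_immersion A g F \<and>
           sff_weakly_conv_L2loc A g (\<lambda>n. f (r n)) F"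
proof -
  have W: "open (coord_dom c)" if "c \<in> A" for c
    using surface that by (auto simp: smooth_surface_def is_chart_def)
  have fam: "immersion_family c g f" if c: "c \<in> A" for c
    unfolding immersion_family_def
  proof (intro conjI allI)
    show "open (coord_dom c)" by (rule W[OF c])
    show "Hloc 2 (coord_dom c) (in_coords c (f n))" for n
      using imm[of n] c unfolding H2loc_isometric_immersion_def by blast
    have "AE x in lebesgue_on (coord_dom c). inj (differential c (f n) x) \<and>
        (\<forall>X Y. differential c (f n) x X \<bullet> differential c (f n) x Y = X \<bullet> (g c x *v Y))" for n
      using imm[of n] c unfolding H2loc_isometric_immersion_def by blast
    then show "AE x in lebesgue_on (coord_dom c). \<forall>X Y. differential c (f n) x X \<bullet> differential c (f n) x Y = X \<bullet> (g c x *v Y)" for n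
      by (rule eventually_mono) blast
    show "L2_bounded (coord_dom c) (\<lambda>n. second_fundamental_form c g (f n) i j)" for i j
      using bdd c unfolding sff_L2_bounded_def by blast
  qed
  have "\<exists>(r :: nat \<Rightarrow> nat) a. strict_mono r \<and> (functions_L2_bounded A f \<longrightarrow> (\<forall>n. a n = 0)) \<and>
    (\<forall>c\<in>A. AE x in lebesgue. x \<in> coord_dom c \<longrightarrow> convergent (\<lambda>n. in_coords c (f (r n)) x - a n))"
  proof (rule convergent_after_translation[OF surface simply_connected_imp_connected_space[OF sc], of g f])
    fix r :: "nat \<Rightarrow> nat" and a
    assume "strict_mono r" "functions_L2_bounded A f \<Longrightarrow> \<forall>n. a n = 0"
      "\<And>c. c \<in> A \<Longrightarrow> AE x in lebesgue. x \<in> coord_dom c \<longrightarrow> convergent (\<lambda>n. in_coords c (f (r n)) x - a n)"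
    then show ?thesis by (intro exI[of _ r] exI[of _ a]) simp
  qed (rule fam)
  then obtain r :: "nat \<Rightarrow> nat" and a where r: "strict_mono r" and a: "functions_L2_bounded A f \<longrightarrow> (\<forall>n. a n = 0)"
    and conv: "\<And>c. c \<in> A \<Longrightarrow> AE x in lebesgue. x \<in> coord_dom c \<longrightarrow> convergent (\<lambda>n. in_coords c (f (r n)) x - a n)"
    by blast
  \<comment> \<open>Pointwise limits on the surface itself give one map for all charts; the points
    where \<open>lim\<close> is arbitrary are null in each chart.\<close>
  define F where "F p = lim (\<lambda>n. f (r n) p - a n)" for p
  have lim: "AE x in lebesgue_on (coord_dom c). (\<lambda>n. in_coords c (f (r n)) x - a n) \<longlonglongrightarrow> in_coords c F x" if c: "c \<in> A" for c
    unfolding AE_lebesgue_on_iff[OF open_lebesgue[OF W[OF c]]]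
    using conv[OF c] by eventually_elim (simp add: F_def in_coords_def convergent_LIMSEQ_iff)
  have H2: "weakly_conv_H2loc A (\<lambda>n p. f (r n) p - a n) F"
    unfolding weakly_conv_H2loc_def using weakly_conv_Hloc_limit[OF fam lim] by blast
  have "H2loc_isometric_immersion A g F"
    unfolding H2loc_isometric_immersion_def
  proof (intro ballI conjI)
    fix c assume c: "c \<in> A"
    show "Hloc 2 (coord_dom c) (in_coords c F)"
      using H2 c unfolding weakly_conv_H2loc_def weakly_conv_Hloc_def by blast
    have "AE x in lebesgue_on (coord_dom c). transpose (g c x) = g c x \<and> (\<forall>X. X \<noteq> 0 \<longrightarrow> X \<bullet> (g c x *v X) > 0)"
      using metric c unfolding H1loc_metric_def by blast
    with limit_isometric[OF fam[OF c] lim[OF c]]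
    show "AE x in lebesgue_on (coord_dom c). inj (differential c F x) \<and>
        (\<forall>X Y. differential c F x X \<bullet> differential c F x Y = X \<bullet> (g c x *v Y))"
      by eventually_elim (blast intro: differential_inj)
  qed
  moreover have "sff_weakly_conv_L2loc A g (\<lambda>n. f (r n)) F"
    unfolding sff_weakly_conv_L2loc_def using sff_weakly_conv[OF fam lim] by blast
  ultimately show ?thesis using r a H2 by blast
qed

end
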